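(* Let $X$ be a fan with at least three vertices, and let $G$ be a graph. If $G$ is $X$-minor-free, then $\operatorname{ltd}(G)\leq \binom{|V(X)|-1}{2}$.
   Context: All graphs are finite and simple; the null graph is allowed. A fan is a graph that becomes a path (possibly null) after deleting at most one vertex. A model of $H$ in $G$ is a family $(B_x\mid x\in V(H))$ of pairwise disjoint subsets of $V(G)$ such that each $G[B_x]$ is non-empty and connected, and for every edge $xy\in E(H)$ there is an edge of $G$ between $B_x$ and $B_y$; $G$ is $H$-minor-free if it has no model of $H$. A rooted forest is a disjoint union of rooted trees; its closure is the graph on the same vertex set in which $v\neq w$ are adjacent iff one is an ancestor of the other. An elimination forest of $G$ is a rooted forest $F$ with $V(F)=V(G)$ such that $G$ is a subgraph of the closure of $F$. A layering of $G$ is a sequence $(L_i\mid i\geq 0)$ of pairwise disjoint subsets of $V(G)$ with union $V(G)$ such that every edge has both ends in $L_i\cup L_{i+1}$ for some $i$. The width of a pair $(F,(L_i))$ is $\max\{|V(R)\cap L_i| : R \text{ a root-to-leaf path in } F,\ i\ge 0\}$. The layered treedepth $\operatorname{ltd}(G)$ is the minimum width of such a pair, over elimination forests $F$ of $G$ and layerings of $G$. *)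

theory Defs
  imports "Graph_Theory.Graph_Theory"
begin

text \<open>
  Finite simple graphs, the null graph included, are the symmetric digraphs of the locale
  \<^locale>\<open>pair_graph\<close>: an edge between \<open>u\<close> and \<open>v\<close> is the pair of arcs \<open>(u, v)\<close>, \<open>(v, u)\<close>.
\<close>

text \<open>The empty list \<open>vs\<close> gives the null path.\<close>

definition path_graph :: "('a, 'b) pre_digraph \<Rightarrow> bool" where
  "path_graph P \<longleftrightarrow> graph P \<and>
     (\<exists>vs. distinct vs \<and> verts P = set vs \<and>
           arcs_ends P = set (vwalk_arcs vs) \<union> (set (vwalk_arcs vs))\<inverse>)"

definition fan :: "'a pair_pre_digraph \<Rightarrow> bool" where
  "fan X \<longleftrightarrow> pair_graph X \<and>
     (path_graph X \<or> (\<exists>v \<in> pverts X. path_graph (pre_digraph.del_vert X v)))"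

text \<open>
  Branch sets are non-empty because \<^const>\<open>connected\<close> excludes the null graph.
  The values of \<open>B\<close> outside \<open>V(H)\<close> are irrelevant.
\<close>

definition minor_model ::
  "('x \<Rightarrow> 'a set) \<Rightarrow> 'x pair_pre_digraph \<Rightarrow> 'a pair_pre_digraph \<Rightarrow> bool" where
  "minor_model B H G \<longleftrightarrow>
     (\<forall>x \<in> pverts H. B x \<subseteq> pverts G \<and> connected (induce_subgraph G (B x))) \<and>
     (\<forall>x \<in> pverts H. \<forall>y \<in> pverts H. x \<noteq> y \<longrightarrow> B x \<inter> B y = {}) \<and>
     (\<forall>(x, y) \<in> parcs H. \<exists>u \<in> B x. \<exists>v \<in> B y. (u, v) \<in> parcs G)"

definition minor_free :: "'x pair_pre_digraph \<Rightarrow> 'a pair_pre_digraph \<Rightarrow> bool" where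
  "minor_free H G \<longleftrightarrow> \<not> (\<exists>B. minor_model B H G)"

text \<open>
  Rooted trees and forests are oriented away from their roots, so arcs lead from parents to
  children. Hence \<open>u\<close> is an ancestor of \<open>v\<close> iff \<open>v\<close> is reachable from \<open>u\<close>, the roots are
  the vertices without incoming arcs and the leaves those without outgoing arcs.
\<close>

definition rooted_tree :: "'a pair_pre_digraph \<Rightarrow> 'a \<Rightarrow> bool" where
  "rooted_tree T r \<longleftrightarrow> pair_fin_digraph T \<and> r \<in> pverts T \<and>
     (\<forall>v \<in> pverts T. \<exists>!p. pre_digraph.awalk T r p v)"

definition rooted_forest :: "'a pair_pre_digraph \<Rightarrow> bool" where
  "rooted_forest F \<longleftrightarrow> pair_fin_digraph F \<and>
     (\<exists>\<T>. (\<forall>T \<in> \<T>. \<exists>r. rooted_tree T r) \<and>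
           pairwise (\<lambda>S T. disjnt (pverts S) (pverts T)) \<T> \<and>
           pverts F = (\<Union>T \<in> \<T>. pverts T) \<and> parcs F = (\<Union>T \<in> \<T>. parcs T))"

definition forest_closure :: "'a pair_pre_digraph \<Rightarrow> 'a pair_pre_digraph" where
  "forest_closure F =
     \<lparr> pverts = pverts F,
       parcs = {(v, w). v \<in> pverts F \<and> w \<in> pverts F \<and> v \<noteq> w \<and>
                        (v \<rightarrow>\<^sup>*\<^bsub>F\<^esub> w \<or> w \<rightarrow>\<^sup>*\<^bsub>F\<^esub> v)} \<rparr>"

definition elimination_forest :: "'a pair_pre_digraph \<Rightarrow> 'a pair_pre_digraph \<Rightarrow> bool" where
  "elimination_forest F G \<longleftrightarrow>
     rooted_forest F \<and> pverts F = pverts G \<and> subgraph G (forest_closure F)"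

definition root_leaf_path :: "'a pair_pre_digraph \<Rightarrow> 'a list \<Rightarrow> bool" where
  "root_leaf_path F R \<longleftrightarrow>
     vpath R F \<and> in_arcs F (hd R) = {} \<and> out_arcs F (last R) = {}"

definition layering :: "(nat \<Rightarrow> 'a set) \<Rightarrow> 'a pair_pre_digraph \<Rightarrow> bool" where
  "layering L G \<longleftrightarrow>
     (\<forall>i j. i \<noteq> j \<longrightarrow> L i \<inter> L j = {}) \<and> (\<Union>i. L i) = pverts G \<and>
     (\<forall>(u, v) \<in> parcs G. \<exists>i. u \<in> L i \<union> L (Suc i) \<and> v \<in> L i \<union> L (Suc i))"

text \<open>
  The inserted \<open>0\<close> only matters for the null forest, which has no root-to-leaf path and
  gets width \<open>0\<close>.
\<close>

definition layered_width :: "'a pair_pre_digraph \<Rightarrow> (nat \<Rightarrow> 'a set) \<Rightarrow> nat" where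
  "layered_width F L = Max (insert 0 {card (set R \<inter> L i) | R i. root_leaf_path F R})"

definition layered_treedepth :: "'a pair_pre_digraph \<Rightarrow> nat" where
  "layered_treedepth G =
     (LEAST w. \<exists>F L. elimination_forest F G \<and> layering L G \<and> w = layered_width F L)"

end

theory Submission
  imports Defs
begin

text \<open>
  Every fan \<open>X\<close> with \<open>k + 1\<close> vertices is contained in the graph consisting of a hub and a path on
  \<open>k\<close> vertices that are all adjacent to the hub. Hence, if \<open>R\<close> and \<open>C\<close> are disjoint connected sets
  of vertices of \<open>G\<close> and \<open>S\<close> is the set of the vertices of \<open>C\<close> with a neighbour in \<open>R\<close>, then \<open>C\<close>
  contains no model of the path with \<open>k\<close> vertices all of whose branch sets meet \<open>S\<close>. The main point
  is that all vertices of \<open>S\<close> can then be removed from \<open>C\<close> by an elimination process of depth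
  \<open>k choose 2\<close>. The removed vertices form one layer; what remains falls into connected sets \<open>D\<close>
  whose complement is connected if the process is chosen minimal, and one recurses with the
  complement of \<open>D\<close> in place of \<open>R\<close>.

  The elimination lemma is proved by induction on the number of vertices of the excluded rooted path,
  now \<open>l + 1\<close>. Two disjoint rooted models in a connected set can be joined, keeping the longer half
  of each; hence a model with \<open>l\<close> branch sets intersects every model with \<open>l - 1\<close> branch sets.
  One explores the set by growing a rooted path model while the unexplored part \<open>C\<close> shrinks and
  always contains a rooted model with \<open>l\<close> branch sets. Menger's theorem, in the form that
  augmentation keeps the ends of the given paths, provides a set \<open>X\<close> separating the boundary
  \<open>Z\<close> of \<open>C\<close> from the vertices of \<open>S\<close> in \<open>C\<close>. When \<open>C\<close> is minimal, the components left by
  the deletion of \<open>X\<close> have no rooted model of length \<open>l\<close> or meet \<open>Z\<close>; in the latter, deleting \<open>Z\<close>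
  leaves parts that avoid \<open>S\<close> or have no rooted model of length \<open>l - 1\<close>. Since \<open>card X \<le> l\<close> and
  \<open>card X + card Z < 2 * l\<close>, both cases stay within the budget \<open>(l choose 2) + l\<close>.
\<close>

subsection \<open>Graphs and fans\<close>

lemma pair_graph_finite: "pair_graph G \<Longrightarrow> finite (pverts G)"
  using pair_fin_digraph.pair_finite_verts[of G] by (simp add: pair_graph_def pair_digraph_def)

lemma pair_graph_arcD:
  assumes "pair_graph G" "(u, v) \<in> parcs G"
  shows "u \<in> pverts G" "v \<in> pverts G" "u \<noteq> v"
  using assms pair_wf_digraph.in_arcsD1[of G u v] pair_wf_digraph.in_arcsD2[of G u v]
    pair_loopfree_digraph.pair_no_loops[of G "(u, v)"]
  by (simp_all add: pair_graph_def pair_digraph_def pair_loopfree_digraph_def)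

lemma pcas_snoc: "pcas u (q @ [a]) v \<longleftrightarrow> pcas u q (fst a) \<and> snd a = v"
  by (induction q arbitrary: u) auto

lemma vwalk_arcs_snoc: "xs \<noteq> [] \<Longrightarrow> vwalk_arcs (xs @ [v]) = vwalk_arcs xs @ [(last xs, v)]"
  by (induction xs rule: vwalk_arcs.induct) auto

lemma vwalk_arcs_nth: "(x, y) \<in> set (vwalk_arcs vs) \<Longrightarrow> \<exists>i. Suc i < length vs \<and> x = vs ! i \<and> y = vs ! Suc i"
proof (induction vs rule: vwalk_arcs.induct)
  case (3 a b xs)
  then consider "x = a" "y = b" | i where "Suc i < length (b # xs)" "x = (b # xs) ! i" "y = (b # xs) ! Suc i"
    by auto
  then show ?case
  proof cases
    case 1
    then show ?thesis by (intro exI[of _ 0]) simp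
  next
    case (2 i)
    then show ?thesis by (intro exI[of _ "Suc i"]) simp
  qed
qed simp_all

text \<open>The position \<open>0\<close> is the hub; it may be adjacent to all other vertices.\<close>

lemma fan_enumeration:
  assumes "fan X"
  obtains vs where "distinct vs" "set vs = pverts X"
    "\<And>x y. (x, y) \<in> parcs X \<Longrightarrow> \<exists>i j. i < length vs \<and> j < length vs \<and> i \<noteq> j \<and> x = vs ! i \<and> y = vs ! j \<and>
       (i = 0 \<or> j = 0 \<or> i = Suc j \<or> j = Suc i)"
proof -
  have X: "pair_graph X" using assms unfolding fan_def by blast
  have step: "\<exists>i j. i < length vs \<and> j < length vs \<and> i \<noteq> j \<and> x = vs ! i \<and> y = vs ! j \<and> (i = Suc j \<or> j = Suc i)"
    if xy: "(x, y) \<in> set (vwalk_arcs vs) \<union> (set (vwalk_arcs vs))\<inverse>" for x y and vs :: "'a list"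
  proof -
    consider "(x, y) \<in> set (vwalk_arcs vs)" | "(y, x) \<in> set (vwalk_arcs vs)" using xy by blast
    then show ?thesis
    proof cases
      case 1
      then obtain i where "Suc i < length vs" "x = vs ! i" "y = vs ! Suc i" using vwalk_arcs_nth by metis
      then show ?thesis by (intro exI[of _ i] exI[of _ "Suc i"]) simp
    next
      case 2
      then obtain i where "Suc i < length vs" "y = vs ! i" "x = vs ! Suc i" using vwalk_arcs_nth by metis
      then show ?thesis by (intro exI[of _ "Suc i"] exI[of _ i]) simp
    qed
  qed
  consider "path_graph (with_proj X)" | v where "v \<in> pverts X" "path_graph (pre_digraph.del_vert X v)"
    using assms unfolding fan_def by blast
  then show ?thesis
  proof cases
    case 1
    then obtain vs where "distinct vs" "pverts X = set vs" "parcs X = set (vwalk_arcs vs) \<union> (set (vwalk_arcs vs))\<inverse>"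
      unfolding path_graph_def by auto
    \<comment> \<open>If \<open>X\<close> itself is a path, position \<open>0\<close> is merely its
      first vertex; consecutive positions already account for all arcs.\<close>
    then show ?thesis using that[of vs] step[of _ _ vs] by blast
  next
    case (2 v)
    then obtain vs where vs: "distinct vs" "pverts X - {v} = set vs"
      "arcs_ends (pre_digraph.del_vert X v) = set (vwalk_arcs vs) \<union> (set (vwalk_arcs vs))\<inverse>"
      unfolding path_graph_def by (auto simp: pre_digraph.del_vert_def)
    have arcs: "arcs_ends (pre_digraph.del_vert X v) = {(x, y) \<in> parcs X. x \<noteq> v \<and> y \<noteq> v}"
      by (auto simp: pre_digraph.del_vert_def arcs_ends_conv)
    show ?thesis
    proof (rule that[of "v # vs"])
      show "distinct (v # vs)" "set (v # vs) = pverts X" using vs 2(1) by auto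
      fix x y assume xy: "(x, y) \<in> parcs X"
      have xyV: "x \<in> set (v # vs)" "y \<in> set (v # vs)" "x \<noteq> y"
        using pair_graph_arcD[OF X xy] vs(2) 2(1) by auto
      show "\<exists>i j. i < length (v # vs) \<and> j < length (v # vs) \<and> i \<noteq> j \<and> x = (v # vs) ! i \<and> y = (v # vs) ! j \<and>
       (i = 0 \<or> j = 0 \<or> i = Suc j \<or> j = Suc i)"
      proof (cases "x = v \<or> y = v")
        case True
        obtain i where i: "i < length (v # vs)" "x = (v # vs) ! i" using xyV(1) by (metis in_set_conv_nth)
        obtain j where j: "j < length (v # vs)" "y = (v # vs) ! j" using xyV(2) by (metis in_set_conv_nth)
        have "i \<noteq> j" using i j xyV(3) by blast
        show ?thesis
        proof (cases "x = v")
          case True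
          then show ?thesis using j xyV(3) by (intro exI[of _ 0] exI[of _ j]) (auto intro!: gr0I)
        next
          case False
          then have "y = v" using \<open>x = v \<or> y = v\<close> by blast
          then show ?thesis using i xyV(3) by (intro exI[of _ i] exI[of _ 0]) (auto intro!: gr0I)
        qed
      next
        case False
        then have "(x, y) \<in> set (vwalk_arcs vs) \<union> (set (vwalk_arcs vs))\<inverse>" using xy vs(3) arcs by blast
        from step[OF this] obtain i j where "i < length vs" "j < length vs" "i \<noteq> j" "x = vs ! i" "y = vs ! j"
          "i = Suc j \<or> j = Suc i" by blast
        \<comment> \<open>Prepending the hub \<open>v\<close> shifts all positions on the path by
          one.\<close>
        then show ?thesis by (intro exI[of _ "Suc i"] exI[of _ "Suc j"]) auto
      qed
    qed
  qed
qed

subsection \<open>Connected sets and components\<close>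

locale sym_relation =
  fixes E :: "'a rel"
  assumes E_sym: "(x, y) \<in> E \<Longrightarrow> (y, x) \<in> E"
begin

definition touch :: "'a set \<Rightarrow> 'a set \<Rightarrow> bool" where
  "touch A B \<longleftrightarrow> (\<exists>x\<in>A. \<exists>y\<in>B. (x, y) \<in> E)"

text \<open>Connectedness is phrased by cuts instead of walks, which makes unions easy to treat;
  \<open>conn_imp_path\<close> recovers paths.\<close>

definition conn :: "'a set \<Rightarrow> bool" where
  "conn A \<longleftrightarrow> A \<noteq> {} \<and> (\<forall>U. U \<subseteq> A \<longrightarrow> U \<noteq> {} \<longrightarrow> U \<noteq> A \<longrightarrow> touch U (A - U))"

text \<open>The absence of edges to the rest of \<open>W\<close> stands for maximality, which
  \<open>comps_max\<close> recovers.\<close>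

definition comps :: "'a set \<Rightarrow> 'a set set" where
  "comps W = {D. D \<subseteq> W \<and> conn D \<and> \<not> touch D (W - D)}"

definition simple_path :: "'a list \<Rightarrow> bool" where
  "simple_path p \<longleftrightarrow> p \<noteq> [] \<and> distinct p \<and> successively (\<lambda>x y. (x, y) \<in> E) p"

text \<open>Connected sets take the role of paths. As usual in Menger's theorem, \<open>X\<close>
  may contain vertices of \<open>A\<close> and of \<open>B\<close>.\<close>

definition separates :: "'a set \<Rightarrow> 'a set \<Rightarrow> 'a set \<Rightarrow> 'a set \<Rightarrow> bool" where
  "separates H X A B \<longleftrightarrow> (\<forall>K. K \<subseteq> H - X \<longrightarrow> conn K \<longrightarrow> K \<inter> A = {} \<or> K \<inter> B = {})"

lemma touch_sym: "touch A B \<Longrightarrow> touch B A"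
  unfolding touch_def using E_sym by blast

lemma touch_mono: "touch A B \<Longrightarrow> A \<subseteq> A' \<Longrightarrow> B \<subseteq> B' \<Longrightarrow> touch A' B'"
  unfolding touch_def by blast

lemma touchI: "x \<in> A \<Longrightarrow> y \<in> B \<Longrightarrow> (x, y) \<in> E \<Longrightarrow> touch A B"
  unfolding touch_def by blast

lemma connD: "conn A \<Longrightarrow> U \<inter> A \<noteq> {} \<Longrightarrow> \<not> A \<subseteq> U \<Longrightarrow> touch (A \<inter> U) (A - U)"
proof -
  assume A: "conn A" "U \<inter> A \<noteq> {}" "\<not> A \<subseteq> U"
  then have "touch (A \<inter> U) (A - A \<inter> U)" unfolding conn_def by blast
  moreover have "A - A \<inter> U = A - U" by blast
  ultimately show ?thesis by simp
qed

lemma conn_nonempty: "conn A \<Longrightarrow> A \<noteq> {}"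
  unfolding conn_def by blast

lemma conn_subset: "conn A \<Longrightarrow> A \<inter> D \<noteq> {} \<Longrightarrow> \<not> touch D (W - D) \<Longrightarrow> A \<subseteq> W \<Longrightarrow> A \<subseteq> D"
  using connD[of A D] touch_mono[of "A \<inter> D" "A - D" D "W - D"] by blast

lemma conn_singleton: "conn {x}"
  unfolding conn_def by blast

text \<open>A cut without crossing edges cannot split a connected set, so each of \<open>A\<close>
  and \<open>B\<close> lies on one side; a common vertex or an edge between them forces the same
  side.\<close>

lemma conn_Un:
  assumes "conn A" "conn B" "A \<inter> B \<noteq> {} \<or> touch A B"
  shows "conn (A \<union> B)"
  unfolding conn_def
proof (intro conjI allI impI)
  show "A \<union> B \<noteq> {}" using assms conn_nonempty by blast
  fix U assume U: "U \<subseteq> A \<union> B" "U \<noteq> {}" "U \<noteq> A \<union> B"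
  show "touch U (A \<union> B - U)"
  proof (rule ccontr)
    assume nt: "\<not> touch U (A \<union> B - U)"
    have 1: "A \<inter> U = {} \<or> A \<subseteq> U"
      using connD[OF assms(1), of U] touch_mono[of "A \<inter> U" "A - U" U "A \<union> B - U"] nt by blast
    have 2: "B \<inter> U = {} \<or> B \<subseteq> U"
      using connD[OF assms(2), of U] touch_mono[of "B \<inter> U" "B - U" U "A \<union> B - U"] nt by blast
    consider "A \<subseteq> U" "B \<inter> U = {}" | "B \<subseteq> U" "A \<inter> U = {}" using 1 2 U by blast
    then show False
    proof cases
      case 1
      then have "touch A B" using assms conn_nonempty by blast
      then show False using nt touch_mono[of A B U "A \<union> B - U"] 1 by blast
    next
      case 2
      then have "touch B A" using assms conn_nonempty touch_sym by blast
      then show False using nt touch_mono[of B A U "A \<union> B - U"] 2 by blast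
    qed
  qed
qed

lemma conn_insert: "conn A \<Longrightarrow> x \<in> A \<Longrightarrow> (x, y) \<in> E \<Longrightarrow> conn (insert y A)"
  using conn_Un[OF _ conn_singleton, of A y] touchI[of x A y "{y}"] by simp

lemma conn_Union:
  assumes "\<A> \<noteq> {}" "\<And>A. A \<in> \<A> \<Longrightarrow> conn A \<and> x \<in> A"
  shows "conn (\<Union>\<A>)"
  unfolding conn_def
proof (intro conjI allI impI)
  show "\<Union>\<A> \<noteq> {}" using assms by blast
  fix U assume U: "U \<subseteq> \<Union>\<A>" "U \<noteq> {}" "U \<noteq> \<Union>\<A>"
  show "touch U (\<Union>\<A> - U)"
  proof (rule ccontr)
    assume nt: "\<not> touch U (\<Union>\<A> - U)"
    have 1: "A \<inter> U = {} \<or> A \<subseteq> U" if "A \<in> \<A>" for A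
      using connD[of A U] touch_mono[of "A \<inter> U" "A - U" U "\<Union>\<A> - U"] nt that assms by blast
    show False
    proof (cases "x \<in> U")
      case True
      then show False using 1 assms U by blast
    next
      case False
      then show False using 1 assms U by blast
    qed
  qed
qed

text \<open>Adding \<open>A\<close> to every \<open>B\<close> gives connected sets with a common
  vertex, to which \<open>conn_Union\<close> applies.\<close>

lemma conn_Un_star:
  assumes "conn A" "\<And>B. B \<in> \<B> \<Longrightarrow> conn B \<and> (A \<inter> B \<noteq> {} \<or> touch A B)"
  shows "conn (A \<union> \<Union>\<B>)"
proof -
  obtain x where x: "x \<in> A" using assms(1) conn_nonempty by blast
  have "conn (\<Union>(insert A ((\<lambda>B. A \<union> B) ` \<B>)))"
    by (rule conn_Union[of _ x]) (use x assms conn_Un in auto)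
  moreover have "\<Union>(insert A ((\<lambda>B. A \<union> B) ` \<B>)) = A \<union> \<Union>\<B>" by blast
  ultimately show ?thesis by simp
qed

lemma compsD: "D \<in> comps W \<Longrightarrow> D \<subseteq> W \<and> conn D \<and> \<not> touch D (W - D)"
  unfolding comps_def by blast

lemma comps_subset: "D \<in> comps W \<Longrightarrow> D \<subseteq> W" unfolding comps_def by blast

lemma comps_conn: "D \<in> comps W \<Longrightarrow> conn D" unfolding comps_def by blast

lemma comps_closed: "D \<in> comps W \<Longrightarrow> x \<in> D \<Longrightarrow> (x, y) \<in> E \<Longrightarrow> y \<in> W \<Longrightarrow> y \<in> D"
  unfolding comps_def touch_def by blast

lemma comps_max: "D \<in> comps W \<Longrightarrow> conn A \<Longrightarrow> A \<subseteq> W \<Longrightarrow> A \<inter> D \<noteq> {} \<Longrightarrow> A \<subseteq> D"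
  using conn_subset compsD by blast

lemma comps_disjoint: "D \<in> comps W \<Longrightarrow> D' \<in> comps W \<Longrightarrow> D \<noteq> D' \<Longrightarrow> D \<inter> D' = {}"
  using comps_max[of D W D'] comps_max[of D' W D] compsD by blast

lemma comps_I: "D \<subseteq> W \<Longrightarrow> conn D \<Longrightarrow> (\<And>x y. x \<in> D \<Longrightarrow> y \<in> W \<Longrightarrow> (x, y) \<in> E \<Longrightarrow> y \<in> D) \<Longrightarrow> D \<in> comps W"
  unfolding comps_def touch_def by blast

text \<open>The component is the union of all connected subsets of \<open>W\<close> through a fixed
  vertex of \<open>A\<close>; any neighbour of it in \<open>W\<close> could be added.\<close>

lemma conn_comps_superset:
  assumes "conn A" "A \<subseteq> W"
  obtains D where "D \<in> comps W" "A \<subseteq> D"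
proof -
  obtain x where x: "x \<in> A" using assms conn_nonempty by blast
  define D where "D = \<Union>{B. B \<subseteq> W \<and> conn B \<and> x \<in> B}"
  have cD: "conn D" unfolding D_def by (rule conn_Union[of _ x]) (use assms x in auto)
  have AD: "A \<subseteq> D" unfolding D_def using assms x by blast
  have "D \<in> comps W"
  proof (rule comps_I)
    show "D \<subseteq> W" unfolding D_def by blast
    show "conn D" by (rule cD)
    fix y z assume "y \<in> D" "z \<in> W" "(y, z) \<in> E"
    then have "conn (insert z D)" "insert z D \<subseteq> W" "x \<in> insert z D"
      using conn_insert[OF cD] AD x D_def by auto
    then show "z \<in> D" unfolding D_def by blast
  qed
  then show ?thesis using AD that by blast
qed

lemma comps_cover: "x \<in> W \<Longrightarrow> \<exists>D\<in>comps W. x \<in> D"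
  using conn_comps_superset[OF conn_singleton, of x W] by auto

lemma comps_of_conn: "conn W \<Longrightarrow> comps W = {W}"
proof -
  assume W: "conn W"
  then have "W \<in> comps W" by (intro comps_I) auto
  moreover have "D = W" if "D \<in> comps W" for D
    using comps_max[OF that W order_refl] comps_subset[OF that] conn_nonempty[OF comps_conn[OF that]] by blast
  ultimately show ?thesis by blast
qed

lemma simple_path_conn: "simple_path p \<Longrightarrow> conn (set p)"
proof (induction p)
  case Nil
  then show ?case by (simp add: simple_path_def)
next
  case (Cons x p)
  show ?case
  proof (cases p)
    case Nil
    then show ?thesis by (simp add: conn_singleton)
  next
    case (Cons y q)
    then have "simple_path p" "(x, y) \<in> E" using Cons.prems by (auto simp: simple_path_def)
    then show ?thesis using conn_insert[of "set p" y x] E_sym Cons.IH Cons by auto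
  qed
qed

lemma simple_path_Nil [simp]: "\<not> simple_path []"
  by (simp add: simple_path_def)

lemma simple_path_singleton [simp]: "simple_path [x]"
  by (simp add: simple_path_def)

lemma simple_path_append:
  "simple_path (p @ q) \<longleftrightarrow> (p = [] \<and> simple_path q) \<or> (q = [] \<and> simple_path p) \<or>
     (simple_path p \<and> simple_path q \<and> set p \<inter> set q = {} \<and> (last p, hd q) \<in> E)"
  unfolding simple_path_def by (auto simp: successively_append_iff)

text \<open>No edge of \<open>A\<close> leaves the set of vertices reached from \<open>x\<close> by
  simple paths: a path to one end of such an edge can be extended to the other end or already has a
  prefix ending there.\<close>

lemma conn_imp_path:
  assumes "conn A" "x \<in> A" "y \<in> A"
  obtains p where "simple_path p" "hd p = x" "last p = y" "set p \<subseteq> A"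
proof -
  define U where "U = {y\<in>A. \<exists>p. simple_path p \<and> hd p = x \<and> last p = y \<and> set p \<subseteq> A}"
  have "x \<in> U" unfolding U_def using assms by (auto intro!: exI[of _ "[x]"] simp: simple_path_def)
  have "A \<subseteq> U"
  proof (rule ccontr)
    assume "\<not> A \<subseteq> U"
    then obtain u v where uv: "u \<in> U" "v \<in> A" "v \<notin> U" "(u, v) \<in> E"
      using connD[OF assms(1), of U] \<open>x \<in> U\<close> assms unfolding touch_def by blast
    then obtain p where p: "simple_path p" "hd p = x" "last p = u" "set p \<subseteq> A" unfolding U_def by blast
    have "v \<notin> set p"
    proof
      assume "v \<in> set p"
      then obtain p1 p2 where p12: "p = (p1 @ [v]) @ p2" by (metis append.assoc append_Cons append_Nil split_list)
      then have "simple_path (p1 @ [v])" using p(1) simple_path_append[of "p1 @ [v]" p2] by auto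
      moreover have "hd (p1 @ [v]) = x" using p12 p(2) by (cases p1) auto
      ultimately have "v \<in> U" unfolding U_def using p(4) p12 uv
        by (auto intro!: exI[of _ "p1 @ [v]"])
      then show False using uv by blast
    qed
    then have "simple_path (p @ [v])" using p uv by (simp add: simple_path_append)
    then have "v \<in> U" unfolding U_def using p uv
      by (auto intro!: exI[of _ "p @ [v]"] simp: simple_path_def)
    then show False using uv by blast
  qed
  then show ?thesis using assms that unfolding U_def by blast
qed

lemma separatesD: "separates H X A B \<Longrightarrow> K \<subseteq> H \<Longrightarrow> conn K \<Longrightarrow> K \<inter> X = {} \<Longrightarrow> K \<inter> A = {} \<or> K \<inter> B = {}"
  unfolding separates_def by blast

lemma separates_mono: "separates H X A B \<Longrightarrow> A' \<subseteq> A \<Longrightarrow> B' \<subseteq> B \<Longrightarrow> separates H X A' B'"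
  unfolding separates_def by blast

subsection \<open>Disjoint paths and separators\<close>

text \<open>A linkage is indexed by the ends of its paths in \<open>B\<close>; the paths start in \<open>A\<close>.\<close>

definition linkage :: "'a set \<Rightarrow> 'a set \<Rightarrow> 'a set \<Rightarrow> 'a set \<Rightarrow> ('a \<Rightarrow> 'a list) \<Rightarrow> bool" where
  "linkage H A B U f \<longleftrightarrow> U \<subseteq> B \<and>
     (\<forall>b\<in>U. simple_path (f b) \<and> last (f b) = b \<and> hd (f b) \<in> A \<and> set (f b) \<subseteq> H \<and> set (f b) \<inter> B = {b}) \<and>
     (\<forall>b\<in>U. \<forall>b'\<in>U. b \<noteq> b' \<longrightarrow> set (f b) \<inter> set (f b') = {})"

lemma linkageD:
  assumes "linkage H A B U f"
  shows "U \<subseteq> B"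
    and "b \<in> U \<Longrightarrow> simple_path (f b)" and "b \<in> U \<Longrightarrow> last (f b) = b" and "b \<in> U \<Longrightarrow> hd (f b) \<in> A"
    and "b \<in> U \<Longrightarrow> set (f b) \<subseteq> H" and "b \<in> U \<Longrightarrow> set (f b) \<inter> B = {b}"
    and "b \<in> U \<Longrightarrow> b' \<in> U \<Longrightarrow> b \<noteq> b' \<Longrightarrow> set (f b) \<inter> set (f b') = {}"
  using assms unfolding linkage_def by blast+

lemma simple_path_suffix: "simple_path (p @ q) \<Longrightarrow> q \<noteq> [] \<Longrightarrow> simple_path q"
  using simple_path_append by blast

lemma simple_path_prefix: "simple_path (p @ q) \<Longrightarrow> p \<noteq> [] \<Longrightarrow> simple_path p"
  using simple_path_append by blast

lemma simple_path_join:
  assumes "simple_path p" "last p = x" "x # q = [x] \<or> simple_path (x # q)" "set p \<inter> set q = {}"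
  shows "simple_path (p @ q)"
proof (cases q)
  case Nil
  then show ?thesis using assms by simp
next
  case (Cons y r)
  then have "simple_path ([x] @ q)" using assms by simp
  then have "simple_path q" "(x, hd q) \<in> E" using Cons simple_path_append[of "[x]" q] by auto
  then show ?thesis using assms simple_path_append by blast
qed

lemma set_Int_eq_last:
  assumes "xs \<noteq> []" "last xs = z" "set xs \<subseteq> S" "S \<inter> B = {z}"
  shows "set xs \<inter> B = {last xs}"
proof -
  have "z \<in> set xs" using assms(1,2) last_in_set by blast
  then show ?thesis using assms by blast
qed

lemma Int_singleton_disjoint: "A \<inter> B = {x} \<Longrightarrow> C \<subseteq> B \<Longrightarrow> x \<notin> C \<Longrightarrow> A \<inter> C = {}"
  by fast

lemma path_to_first:
  assumes "simple_path p" "set p \<inter> B \<noteq> {}"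
  obtains q where "simple_path q" "hd q = hd p" "set q \<subseteq> set p" "set q \<inter> B = {last q}"
proof -
  have "\<exists>y\<in>set p. y \<in> B" using assms by blast
  then obtain ys y zs where p: "p = ys @ y # zs" "y \<in> B" "\<forall>u\<in>set ys. u \<notin> B"
    using split_list_first_prop[of p "\<lambda>y. y \<in> B"] by blast
  show ?thesis
  proof (rule that[of "ys @ [y]"])
    show "simple_path (ys @ [y])" using assms(1) p simple_path_prefix[of "ys @ [y]" zs] by simp
    show "hd (ys @ [y]) = hd p" using p by (cases ys) auto
    show "set (ys @ [y]) \<subseteq> set p" using p by auto
    show "set (ys @ [y]) \<inter> B = {last (ys @ [y])}" using p by auto
  qed
qed

text \<open>
  Augmentation keeps the ends of the old paths. Following Goering, the paths are cut off where a
  path avoiding the old ends leaves them for the last time, and the set \<open>B\<close> is enlarged by the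
  removed tails.
\<close>

lemma linkage_augment:
  assumes "finite H" "B \<subseteq> H" "linkage H A B U f"
    and "\<And>X. X \<subseteq> H \<Longrightarrow> separates H X A B \<Longrightarrow> card U < card X"
  shows "\<exists>w f'. w \<in> B - U \<and> linkage H A B (insert w U) f'"
  using assms
proof (induction "card (H - B)" arbitrary: B U f rule: less_induct)
  case less
  note L = linkageD[OF less.prems(3)]
  have UH: "U \<subseteq> H" using L(1) less.prems by blast
  \<comment> \<open>The ends \<open>U\<close> are too few to separate, so there is a path
    \<open>r\<close> from \<open>A\<close> to \<open>B\<close> that avoids them.\<close>
  have "\<not> separates H U A B" using less.prems(4)[OF UH] by blast
  then obtain K where K: "K \<subseteq> H - U" "conn K" "K \<inter> A \<noteq> {}" "K \<inter> B \<noteq> {}"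
    unfolding separates_def by blast
  then obtain a b where "a \<in> K" "a \<in> A" "b \<in> K" "b \<in> B" by blast
  then obtain r0 where r0: "simple_path r0" "hd r0 = a" "last r0 = b" "set r0 \<subseteq> K"
    using conn_imp_path[OF K(2)] by metis
  then have "set r0 \<inter> B \<noteq> {}" using \<open>b \<in> B\<close> by (metis IntI empty_iff last_in_set simple_path_Nil)
  then obtain r where r: "simple_path r" "hd r = a" "set r \<subseteq> set r0" "set r \<inter> B = {last r}"
    using path_to_first[OF r0(1)] r0 by metis
  have rH: "set r \<subseteq> H" "set r \<inter> U = {}" using r r0 K by blast+
  have rne: "r \<noteq> []" using r by auto
  have lastr: "last r \<in> B" "last r \<notin> U" "last r \<in> set r" using r rH rne by auto
  define P where "P = (\<Union>b\<in>U. set (f b))"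
  show ?case
  proof (cases "set r \<inter> P = {}")
    case True
    have "linkage H A B (insert (last r) U) (f(last r := r))"
      unfolding linkage_def using L lastr r rH True \<open>a \<in> A\<close> unfolding P_def by (auto; blast)
    then show ?thesis using lastr by blast
  next
    case False
    \<comment> \<open>Here \<open>x\<close> is the last vertex of \<open>r\<close> on an old path,
      so the rest \<open>r2\<close> avoids all old paths.\<close>
    then obtain r1 x r2 where rs: "r = r1 @ x # r2" "x \<in> P" "\<forall>u\<in>set r2. u \<notin> P"
      using split_list_last_prop[of r "\<lambda>y. y \<in> P"] by blast
    obtain b where b: "b \<in> U" "x \<in> set (f b)" using rs unfolding P_def by blast
    obtain p1 p2 where fb: "f b = p1 @ x # p2" using b split_list by metis
    have xU: "x \<notin> U" using rH rs by auto
    have xB: "x \<notin> B" using L(6)[OF b(1)] b(2) xU b(1) by auto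
    have r2ne: "r2 \<noteq> []" using rs xB lastr by auto
    have p2ne: "p2 \<noteq> []" using fb L(3)[OF b(1)] xU b(1) by auto
    have xH: "x \<in> H" using rs rH by auto
    have lastp2: "last p2 = b" using fb L(3)[OF b(1)] p2ne by auto
    have lastr2: "last r2 = last r" using rs r2ne by auto
    have spb: "simple_path (f b)" using L(2) b by blast
    have dfb: "distinct (f b)" "distinct r" using spb r(1) unfolding simple_path_def by blast+
    have spx: "simple_path (p1 @ [x])" "simple_path (x # p2)" "simple_path (x # r2)"
      using spb fb simple_path_prefix[of "p1 @ [x]" p2] simple_path_suffix[of p1 "x # p2"]
        r(1) rs simple_path_suffix[of r1 "x # r2"] by auto
    have r2P: "set r2 \<inter> P = {}" using rs by blast
    have p2P: "set p2 \<subseteq> P" using fb b unfolding P_def by auto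
    \<comment> \<open>Both tails after \<open>x\<close>, the old one \<open>p2\<close> and the new
      one \<open>r2\<close>, join the target, and the path of \<open>b\<close> is cut off at
      \<open>x\<close>. The number of paths stays the same, while \<open>H - B'\<close> loses
      \<open>x\<close>, so the induction hypothesis applies.\<close>
    define B' where "B' = B \<union> set (x # p2) \<union> set (x # r2)"
    define U' where "U' = insert x (U - {b})"
    define f' where "f' = f(x := p1 @ [x])"
    have p1B: "set p1 \<inter> B' = {}"
    proof -
      have "set p1 \<inter> B = {}" using L(6)[OF b(1)] fb lastp2 p2ne dfb by auto
      moreover have "set p1 \<inter> set (x # p2) = {}" using dfb fb by auto
      moreover have "set p1 \<inter> set r2 = {}"
      proof -
        have "set p1 \<subseteq> P" using b(1) fb unfolding P_def by force
        then show ?thesis using r2P by blast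
      qed
      moreover have "x \<notin> set p1" using dfb fb by auto
      ultimately show ?thesis unfolding B'_def by auto
    qed
    have oth: "set (f c) \<inter> B' = {c}" if c: "c \<in> U - {b}" for c
    proof -
      have "set (f c) \<inter> set (x # p2) = {}" using L(7)[of c b] c b fb by auto
      moreover have "set (f c) \<inter> set r2 = {}" using r2P c unfolding P_def by blast
      ultimately show ?thesis using L(6)[of c] c unfolding B'_def by auto
    qed
    have L': "linkage H A B' U' f'"
      unfolding linkage_def
    proof (intro conjI ballI impI)
      show "U' \<subseteq> B'" unfolding U'_def B'_def using L(1) by auto
      fix c assume c: "c \<in> U'"
      have cx: "c = x \<or> (c \<in> U - {b} \<and> c \<noteq> x)" using c xU unfolding U'_def by auto
      have hdx: "hd (p1 @ [x]) = hd (f b)" using fb by (cases p1) auto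
      show "simple_path (f' c)" using cx spx L(2) unfolding f'_def by auto
      show "last (f' c) = c" using cx L(3) unfolding f'_def by auto
      show "hd (f' c) \<in> A" using cx L(4)[of c] L(4)[OF b(1)] hdx unfolding f'_def by auto
      show "set (f' c) \<subseteq> H" using cx L(5)[of c] L(5)[OF b(1)] fb unfolding f'_def by auto
      show "set (f' c) \<inter> B' = {c}" using cx oth[of c] p1B unfolding f'_def B'_def by auto
      fix c' assume c': "c' \<in> U'" "c \<noteq> c'"
      have cx': "c' = x \<or> (c' \<in> U - {b} \<and> c' \<noteq> x)" using c' xU unfolding U'_def by auto
      have sub: "set (p1 @ [x]) \<subseteq> set (f b)" using fb by auto
      show "set (f' c) \<inter> set (f' c') = {}"
        using cx cx' c'(2) L(7)[of c c'] L(7)[of c b] L(7)[of b c'] b sub unfolding f'_def by auto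
    qed
    have cU': "card U' = card U"
    proof -
      have "finite U" using UH less.prems(1) finite_subset by blast
      then show ?thesis unfolding U'_def using xU card.remove[of U b] b(1) by simp
    qed
    have B'H: "B' \<subseteq> H" using less.prems(2) xH rH rs L(5)[OF b(1)] fb unfolding B'_def by auto
    have "card (H - B') < card (H - B)"
      by (rule psubset_card_mono) (use less.prems(1) xH xB in \<open>auto simp: B'_def\<close>)
    moreover have "card U' < card X" if "X \<subseteq> H" "separates H X A B'" for X
      using less.prems(4)[OF that(1)] separates_mono[OF that(2), of A B] cU' unfolding B'_def by auto
    ultimately obtain y g where y: "y \<in> B' - U'" and g: "linkage H A B' (insert y U') g"
      using less.hyps[OF _ less.prems(1) B'H L'] by blast
    note G = linkageD[OF g]
    have yx: "y \<noteq> x" using y unfolding U'_def by auto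
    have disj: "set p2 \<inter> set r2 = {}" using r2P p2P by blast
    have xnot: "x \<notin> set p2" "x \<notin> set r2" using spx unfolding simple_path_def by auto
    have bp2: "b \<in> set p2" "b \<in> B" using last_in_set[OF p2ne] lastp2 b(1) L(1) by auto
    have p2f: "set p2 \<subseteq> set (f b)" "set r2 \<subseteq> set r" using fb rs by auto
    have p2B: "set p2 \<inter> B = {b}" using L(6)[OF b(1)] p2f bp2 by blast
    have lr2: "last r \<in> set r2" using last_in_set[OF r2ne] lastr2 by simp
    have r2B: "set r2 \<inter> B = {last r}" using r(4) p2f lr2 lastr(1) by blast
    have ynU: "y \<notin> U - {b}" using y unfolding U'_def by blast
    \<comment> \<open>The new linkage ends in \<open>x\<close> and an additional \<open>y\<close>.
      If \<open>y\<close> lies on one tail, it follows that tail to its end and \<open>x\<close>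
      takes the other tail; if \<open>y\<close> lies on neither, it is in \<open>B\<close> already
      and \<open>x\<close> takes \<open>p2\<close>. In each case \<open>b\<close> is an end
      again.\<close>
    have "\<exists>c d. (x # c = [x] \<or> simple_path (x # c)) \<and> (y # d = [y] \<or> simple_path (y # d)) \<and>
        set c \<inter> set d = {} \<and> y \<notin> set c \<and> x \<notin> set d \<and> y \<notin> set d \<and> set c \<union> set d \<subseteq> set p2 \<union> set r2 \<and>
        x \<notin> set c \<and>
        set (x # c) \<inter> B = {last (x # c)} \<and> set (y # d) \<inter> B = {last (y # d)} \<and>
        (b = last (x # c) \<or> b = last (y # d))"
    proof -
      consider "y \<in> set p2" | "y \<in> set r2" | "y \<in> B" "y \<notin> set p2" "y \<notin> set r2"
        using y yx unfolding B'_def by auto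
      then show ?thesis
      proof cases
        case 1
        then obtain p3 p4 where p34: "p2 = p3 @ y # p4" using split_list by metis
        have sub: "set p3 \<subseteq> set p2" "set p4 \<subseteq> set p2" "set (y # p4) \<subseteq> set p2" using p34 by auto
        have lst: "last (y # p4) = b" using lastp2 p34 by simp
        have "simple_path (y # p4)" using spx(2) p34 simple_path_suffix[of "x # p3" "y # p4"] by simp
        moreover have "y \<notin> set p4" using spx(2) p34 unfolding simple_path_def by simp
        moreover have "set (y # p4) \<inter> B = {last (y # p4)}"
          using set_Int_eq_last[OF _ lst sub(3) p2B] by blast
        moreover have "set (x # r2) \<inter> B = {last (x # r2)}"
          using r2B xB lastr2 r2ne by simp
        moreover have "set r2 \<inter> set p4 = {}" "y \<notin> set r2" "x \<notin> set p4" "set r2 \<union> set p4 \<subseteq> set p2 \<union> set r2"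
          using disj sub 1 xnot by blast+
        ultimately show ?thesis using spx(3) xnot lst by metis
      next
        case 2
        then obtain p3 p4 where p34: "r2 = p3 @ y # p4" using split_list by metis
        have sub: "set p3 \<subseteq> set r2" "set p4 \<subseteq> set r2" "set (y # p4) \<subseteq> set r2" using p34 by auto
        have lst: "last (y # p4) = last r" using lastr2 p34 by simp
        have "simple_path (y # p4)" using spx(3) p34 simple_path_suffix[of "x # p3" "y # p4"] by simp
        moreover have "y \<notin> set p4" using spx(3) p34 unfolding simple_path_def by simp
        moreover have "set (y # p4) \<inter> B = {last (y # p4)}"
          using set_Int_eq_last[OF _ lst sub(3) r2B] by blast
        moreover have "set (x # p2) \<inter> B = {last (x # p2)}"
          using p2B xB lastp2 p2ne by simp
        moreover have "b = last (x # p2)" using lastp2 p2ne by simp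
        moreover have "set p2 \<inter> set p4 = {}" "y \<notin> set p2" "x \<notin> set p4" "set p2 \<union> set p4 \<subseteq> set p2 \<union> set r2"
          using disj sub 2 xnot by blast+
        ultimately show ?thesis using spx(2) xnot by metis
      next
        case 3
        have "set (x # p2) \<inter> B = {last (x # p2)}"
          using p2B xB lastp2 p2ne by simp
        moreover have "b = last (x # p2)" using lastp2 p2ne by simp
        moreover have "set [y] \<inter> B = {last [y]}" using 3 by simp
        ultimately show ?thesis
          using spx(2) xnot 3 yx by (intro exI[of _ p2] exI[of _ "[]"]) simp
      qed
    qed
    then obtain c d where cd: "x # c = [x] \<or> simple_path (x # c)" "y # d = [y] \<or> simple_path (y # d)"
        "set c \<inter> set d = {}" "y \<notin> set c" "x \<notin> set d" "y \<notin> set d" "set c \<union> set d \<subseteq> set p2 \<union> set r2"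
        "x \<notin> set c"
        "set (x # c) \<inter> B = {last (x # c)}" "set (y # d) \<inter> B = {last (y # d)}"
        "b = last (x # c) \<or> b = last (y # d)" by blast
    have xin: "x \<in> insert y U'" "y \<in> insert y U'" unfolding U'_def by auto
    have gB: "set (g z) \<inter> B' = {z}" if "z \<in> insert y U'" for z using G(6)[OF that] .
    have cdB': "set c \<union> set d \<subseteq> B'" using cd(7) unfolding B'_def by auto
    define qx where "qx = g x @ c"
    define qy where "qy = g y @ d"
    have gcd: "set (g x) \<inter> set c = {}" "set (g y) \<inter> set d = {}"
      using Int_singleton_disjoint[OF gB[OF xin(1)], of "set c"] Int_singleton_disjoint[OF gB[OF xin(2)], of "set d"]
        cdB' cd(6,8) by simp_all
    have sx: "simple_path qx" unfolding qx_def
      by (rule simple_path_join[OF G(2)[OF xin(1)] G(3)[OF xin(1)] cd(1) gcd(1)])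
    have sy: "simple_path qy" unfolding qy_def
      by (rule simple_path_join[OF G(2)[OF xin(2)] G(3)[OF xin(2)] cd(2) gcd(2)])
    have gne: "g x \<noteq> []" "g y \<noteq> []" using G(2) xin by fastforce+
    have lx: "last qx = last (x # c)" "last qy = last (y # d)"
      unfolding qx_def qy_def using G(3)[OF xin(1)] G(3)[OF xin(2)] by auto
    have hx: "hd qx \<in> A" "hd qy \<in> A"
      unfolding qx_def qy_def using G(4)[OF xin(1)] G(4)[OF xin(2)] gne by auto
    have qB: "set qx \<inter> B = {last qx}" "set qy \<inter> B = {last qy}"
    proof -
      have "set (g x) \<inter> B \<subseteq> {x}" "set (g y) \<inter> B \<subseteq> {y}" "x \<in> set (g x)" "y \<in> set (g y)"
        using gB[OF xin(1)] gB[OF xin(2)] unfolding B'_def by blast+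
      then have "set qx \<inter> B = set (x # c) \<inter> B" "set qy \<inter> B = set (y # d) \<inter> B"
        unfolding qx_def qy_def by auto
      then show "set qx \<inter> B = {last qx}" "set qy \<inter> B = {last qy}" using cd lx by auto
    qed
    have qxy: "set qx \<inter> set qy = {}"
    proof -
      have "set (g x) \<inter> set (g y) = {}" using G(7)[OF xin] yx by simp
      moreover have "set (g x) \<inter> set d = {}" "set (g y) \<inter> set c = {}"
        using Int_singleton_disjoint[OF gB[OF xin(1)], of "set d"] Int_singleton_disjoint[OF gB[OF xin(2)], of "set c"]
          cdB' cd(4,5) by simp_all
      ultimately show ?thesis using gcd cd(3) unfolding qx_def qy_def by auto
    qed
    have qH: "set qx \<subseteq> H" "set qy \<subseteq> H"
      using G(5)[OF xin(1)] G(5)[OF xin(2)] cdB' B'H unfolding qx_def qy_def by auto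
    have other: "set (g z) \<inter> (set qx \<union> set qy) = {}" "set (g z) \<inter> B = {z}" if z: "z \<in> U - {b}" for z
    proof -
      have zin: "z \<in> insert y U'" "z \<noteq> x" "z \<noteq> y" using z xU ynU unfolding U'_def by auto
      have zB: "z \<in> B" using z L(1) by auto
      have "z \<notin> set p2 \<inter> B" unfolding p2B using z by auto
      moreover have "z \<notin> set r2 \<inter> B" unfolding r2B using z lastr(2) by auto
      ultimately have "z \<notin> set c \<union> set d" using zB cd(7) by auto
      then have "set (g z) \<inter> (set c \<union> set d) = {}"
        using Int_singleton_disjoint[OF gB[OF zin(1)] cdB'] by simp
      then show "set (g z) \<inter> (set qx \<union> set qy) = {}"
        using G(7)[OF zin(1) xin(1) zin(2)] G(7)[OF zin(1) xin(2) zin(3)] unfolding qx_def qy_def by auto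
      have "set (g z) \<inter> B \<subseteq> set (g z) \<inter> B'" unfolding B'_def by blast
      moreover have "z \<in> set (g z)" using gB[OF zin(1)] by auto
      ultimately show "set (g z) \<inter> B = {z}" using zB unfolding gB[OF zin(1)] by auto
    qed
    have lne: "last qx \<noteq> last qy" using qxy qB by auto
    have lnU: "last qx \<notin> U - {b}" "last qy \<notin> U - {b}"
    proof -
      show "last qx \<notin> U - {b}"
      proof
        assume h: "last qx \<in> U - {b}"
        then have "last qx \<in> set (g (last qx))" using other(2) by blast
        then show False using other(1)[OF h] qB(1) by blast
      qed
      show "last qy \<notin> U - {b}"
      proof
        assume h: "last qy \<in> U - {b}"
        then have "last qy \<in> set (g (last qy))" using other(2) by blast
        then show False using other(1)[OF h] qB(2) by blast
      qed
    qed
    define h where "h = g(last qx := qx, last qy := qy)"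
    define V where "V = insert (last qx) (insert (last qy) (U - {b}))"
    have "linkage H A B V h"
      unfolding linkage_def
    proof (intro conjI ballI impI)
      show "V \<subseteq> B" unfolding V_def using L(1) qB by auto
      fix z assume "z \<in> V"
      then consider "z = last qx" | "z = last qy" | "z \<in> U - {b}" "z \<noteq> last qx" "z \<noteq> last qy"
        unfolding V_def by blast
      note zc = this
      have gz: "simple_path (g z)" "last (g z) = z" "hd (g z) \<in> A" "set (g z) \<subseteq> H" if "z \<in> U - {b}"
        using G(2-5)[of z] that unfolding U'_def by auto
      show "simple_path (h z)" using zc by cases (use sx sy gz lne in \<open>auto simp: h_def\<close>)
      show "last (h z) = z" using zc by cases (use gz lne in \<open>auto simp: h_def\<close>)
      show "hd (h z) \<in> A" using zc by cases (use hx gz lne in \<open>auto simp: h_def\<close>)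
      show "set (h z) \<subseteq> H"
      proof (cases rule: zc)
        case 1 then show ?thesis using qH lne by (simp add: h_def)
      next
        case 2 then show ?thesis using qH lne by (simp add: h_def)
      next
        case 3 then show ?thesis using gz by (simp add: h_def)
      qed
      show "set (h z) \<inter> B = {z}" using zc by cases (use qB other lne in \<open>simp_all add: h_def\<close>)
      fix z' assume "z' \<in> V" and zz: "z \<noteq> z'"
      then consider "z' = last qx" | "z' = last qy" | "z' \<in> U - {b}" "z' \<noteq> last qx" "z' \<noteq> last qy"
        unfolding V_def by blast
      note zc' = this
      have gg: "set (g z) \<inter> set (g z') = {}" if "z \<in> U - {b}" "z' \<in> U - {b}"
        using G(7)[of z z'] that zz unfolding U'_def by auto
      have hx: "h (last qx) = qx" and hy: "h (last qy) = qy" using lne by (simp_all add: h_def)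
      show "set (h z) \<inter> set (h z') = {}"
      proof (cases rule: zc)
        case 1
        show ?thesis
          by (cases rule: zc') (use 1 hx hy qxy zz other(1)[of z'] in \<open>auto simp: h_def\<close>)
      next
        case 2
        show ?thesis
          by (cases rule: zc') (use 2 hx hy qxy zz other(1)[of z'] in \<open>auto simp: h_def\<close>)
      next
        case 3
        show ?thesis
          by (cases rule: zc') (use 3 hx hy zz other(1)[of z] gg in \<open>auto simp: h_def\<close>)
      qed
    qed
    \<comment> \<open>One of the two extended paths ends in \<open>b\<close>; the end of the other
      is the additional one.\<close>
    moreover have "\<exists>w. w \<in> B - U \<and> V = insert w U"
    proof (cases "b = last (x # c)")
      case True
      then have "last qy \<notin> U" using lnU lne lx by auto
      moreover have "V = insert (last qy) U" unfolding V_def using True lx b by auto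
      ultimately show ?thesis using qB by blast
    next
      case False
      then have "b = last qy" using cd(11) lx by auto
      then have "last qx \<notin> U" "V = insert (last qx) U" using lnU lne b unfolding V_def by auto
      then show ?thesis using qB by blast
    qed
    ultimately show ?thesis by blast
  qed
qed

text \<open>Each path joins \<open>A\<close> to \<open>B'\<close> and so contains a vertex of
  \<open>X\<close>; disjoint paths contain different ones. If \<open>X\<close> is no larger than the
  linkage, nothing of \<open>X\<close> is left over for a second hit.\<close>

lemma linkage_hits:
  assumes "linkage H A B U f" "separates H X A B'" "U \<subseteq> B'" "finite X" "X \<subseteq> H"
  shows "card U \<le> card X"
    and "card X \<le> card U \<Longrightarrow> \<exists>g. inj_on g U \<and> g ` U = X \<and> (\<forall>b\<in>U. set (f b) \<inter> X = {g b})"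
proof -
  note L = linkageD[OF assms(1)]
  have "set (f b) \<inter> X \<noteq> {}" if b: "b \<in> U" for b
  proof
    assume "set (f b) \<inter> X = {}"
    then have "set (f b) \<inter> A = {} \<or> set (f b) \<inter> B' = {}"
      using separatesD[OF assms(2) L(5)[OF b]] simple_path_conn[OF L(2)[OF b]] by blast
    moreover have "hd (f b) \<in> set (f b)" "last (f b) \<in> set (f b)"
      using L(2)[OF b] by (cases "f b"; force)+
    ultimately show False using L(3)[OF b] L(4)[OF b] b assms(3) by auto
  qed
  then have "\<forall>b\<in>U. \<exists>x. x \<in> set (f b) \<inter> X" by blast
  then obtain g where g: "\<forall>b\<in>U. g b \<in> set (f b) \<inter> X" by metis
  have inj: "inj_on g U"
    using g L(7) unfolding inj_on_def by (metis Int_iff empty_iff)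
  have gX: "g ` U \<subseteq> X" using g by blast
  show "card U \<le> card X" using card_inj_on_le[OF inj gX assms(4)] .
  assume "card X \<le> card U"
  then have im: "g ` U = X"
    using card_subset_eq[OF assms(4) gX] card_image[OF inj] card_inj_on_le[OF inj gX assms(4)] by simp
  have "set (f b) \<inter> X = {g b}" if b: "b \<in> U" for b
  proof
    show "{g b} \<subseteq> set (f b) \<inter> X" using g b by blast
    show "set (f b) \<inter> X \<subseteq> {g b}"
    proof
      fix y assume y: "y \<in> set (f b) \<inter> X"
      then obtain b' where b': "b' \<in> U" "y = g b'" using im by blast
      then have "b' = b" using L(7)[OF b' (1) b] g y by blast
      then show "y \<in> {g b}" using b' by simp
    qed
  qed
  then show "\<exists>g. inj_on g U \<and> g ` U = X \<and> (\<forall>b\<in>U. set (f b) \<inter> X = {g b})" using inj im by blast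
qed

text \<open>Menger's theorem with persistent ends: augmentation, which only adds ends, is repeated
  until some separator is no larger than the linkage.\<close>

lemma linkage_max:
  assumes "finite H" "B \<subseteq> H" "linkage H A B U f"
  shows "\<exists>U' f' X. U \<subseteq> U' \<and> linkage H A B U' f' \<and> X \<subseteq> H \<and> card X = card U' \<and> separates H X A B"
  using assms(3)
proof (induction "card (B - U)" arbitrary: U f rule: less_induct)
  case less
  have finB: "finite B" using assms finite_subset by blast
  have UB: "U \<subseteq> B" using linkageD(1)[OF less.prems] .
  show ?case
  proof (cases "\<exists>X\<subseteq>H. separates H X A B \<and> card X \<le> card U")
    case True
    then obtain X where X: "X \<subseteq> H" "separates H X A B" "card X \<le> card U" by blast
    then have "card X = card U"
      using linkage_hits(1)[OF less.prems X(2) UB _ X(1)] finite_subset[OF X(1) assms(1)] by simp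
    then show ?thesis using X less.prems by blast
  next
    case False
    then obtain w f' where w: "w \<in> B - U" "linkage H A B (insert w U) f'"
      using linkage_augment[OF assms(1,2) less.prems] by (metis not_le)
    have "card (B - insert w U) < card (B - U)"
      by (rule psubset_card_mono) (use finB w in auto)
    from less.hyps[OF this w(2)] show ?thesis by blast
  qed
qed

text \<open>
  One step of the construction: either the paths from \<open>Z\<close> are pushed to a separator that leaves
  \<open>Z\<close>, or \<open>v\<close> becomes the end of an additional path.
\<close>

lemma linkage_step:
  assumes fin: "finite C" "finite Z" and "C \<inter> Z = {}" "conn C" "\<And>z. z \<in> Z \<Longrightarrow> touch {z} C"
    and "v \<in> C" "A \<subseteq> C" "A \<noteq> {}" "linkage (C \<union> Z) A Z U f"
  obtains U' f' X g where "U \<subseteq> U'" "U' \<subseteq> insert v Z" "linkage (C \<union> Z) A (U' \<union> Z) U' f'"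
    "X \<subseteq> C \<union> Z" "X \<inter> C \<noteq> {}" "separates (C \<union> Z) X A Z" "card X = card U'"
    "inj_on g U'" "g ` U' = X" "\<And>b. b \<in> U' \<Longrightarrow> set (f' b) \<inter> X = {g b}" "v \<in> U' \<Longrightarrow> v \<in> X"
proof -
  let ?H = "C \<union> Z"
  have finH: "finite ?H" using fin by blast
  \<comment> \<open>Otherwise \<open>C\<close> itself would join \<open>A\<close> to
    \<open>v\<close>.\<close>
  have notsub: "X \<inter> C \<noteq> {}" if X: "X \<subseteq> ?H" "separates ?H X A (insert v Z)" for X
  proof
    assume "X \<inter> C = {}"
    then have "C \<inter> A = {} \<or> C \<inter> insert v Z = {}" using separatesD[OF X(2) _ assms(4)] by blast
    then show False using assms by blast
  qed
  \<comment> \<open>Otherwise \<open>C\<close> together with a vertex of \<open>Z\<close> outside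
    \<open>X\<close> would join \<open>A\<close> to \<open>Z\<close>.\<close>
  have notsub': "X \<inter> C \<noteq> {}" if X: "X \<subseteq> ?H" "separates ?H X A Z" "\<not> Z \<subseteq> X" for X
  proof
    assume XC: "X \<inter> C = {}"
    obtain z where z: "z \<in> Z" "z \<notin> X" using X(3) by blast
    then have "conn (C \<union> {z})" using conn_Un[OF assms(4) conn_singleton] touch_sym[OF assms(5)] by blast
    then have "(C \<union> {z}) \<inter> A = {} \<or> (C \<union> {z}) \<inter> Z = {}"
      using separatesD[OF X(2), of "C \<union> {z}"] XC z by blast
    then show False using assms z by blast
  qed
  show ?thesis
  proof (cases "\<exists>X\<subseteq>?H. separates ?H X A (insert v Z) \<and> card X \<le> card Z")
    case True
    then obtain X1 where X1: "X1 \<subseteq> ?H" "separates ?H X1 A (insert v Z)" "card X1 \<le> card Z" by blast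
    obtain U' f' X0 where m: "U \<subseteq> U'" "linkage ?H A Z U' f'" "X0 \<subseteq> ?H" "card X0 = card U'" "separates ?H X0 A Z"
      using linkage_max[OF finH _ assms(9)] by blast
    have U'Z: "U' \<subseteq> Z" using linkageD(1)[OF m(2)] .
    \<comment> \<open>If the paths exhaust \<open>Z\<close>, then \<open>X1\<close> is a separator
      of the right size; if not, \<open>X0\<close> is smaller than \<open>Z\<close> and hence omits
      a vertex of \<open>Z\<close>. Either way the separator enters \<open>C\<close>.\<close>
    have "\<exists>X. X \<subseteq> ?H \<and> card X = card U' \<and> separates ?H X A Z \<and> X \<inter> C \<noteq> {}"
    proof (cases "card U' = card Z")
      case True
      have sep1: "separates ?H X1 A Z" using separates_mono[OF X1(2)] by blast
      have "card X1 = card U'"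
        using True X1(3) linkage_hits(1)[OF m(2) sep1 U'Z finite_subset[OF X1(1) finH] X1(1)] by simp
      then show ?thesis using X1(1) sep1 notsub[OF X1(1,2)] by (intro exI[of _ X1]) simp
    next
      case False
      then have "card X0 < card Z" using m(4) card_mono[OF fin(2) U'Z] by simp
      then have "\<not> Z \<subseteq> X0" using card_mono[of X0 Z] finite_subset[OF m(3) finH] by auto
      then show ?thesis using m(3-5) notsub'[OF m(3,5)] by (intro exI[of _ X0]) simp
    qed
    then obtain X where X: "X \<subseteq> ?H" "card X = card U'" "separates ?H X A Z" "X \<inter> C \<noteq> {}" by blast
    obtain g where g: "inj_on g U'" "g ` U' = X" "\<forall>b\<in>U'. set (f' b) \<inter> X = {g b}"
      using linkage_hits(2)[OF m(2) X(3) U'Z finite_subset[OF X(1) finH] X(1)] X(2) by auto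
    have eq: "U' \<union> Z = Z" using U'Z by blast
    have "v \<notin> U'" using U'Z assms(3,6) by blast
    then show ?thesis
      using that[of U' f' X g, unfolded eq] m(1,2) U'Z X g by blast
  next
    case False
    let ?B = "insert v Z"
    have cB: "card ?B = Suc (card Z)" using assms(3,6) fin by (simp add: disjoint_iff)
    have "linkage ?H A ?B {} f" unfolding linkage_def by simp
    then obtain U' f' X0 where m: "linkage ?H A ?B U' f'" "X0 \<subseteq> ?H" "card X0 = card U'" "separates ?H X0 A ?B"
      using linkage_max[OF finH, of ?B A "{}" f] assms(6) by blast
    \<comment> \<open>No separator is as small as \<open>Z\<close>, so there are more than
      \<open>card Z\<close> paths and their ends exhaust \<open>insert v Z\<close>, which itself
      serves as \<open>X\<close>.\<close>
    have "card Z < card U'" using False m by (metis not_le)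
    then have U'B: "U' = ?B"
      using card_subset_eq[of ?B U'] linkageD(1)[OF m(1)] cB card_mono[of ?B U'] fin(2) by simp
    have U'Z: "U' \<union> Z = ?B" using U'B by blast
    have sep: "separates ?H ?B A Z" unfolding separates_def by blast
    have "set (f' b) \<inter> ?B = {id b}" if "b \<in> U'" for b
      using linkageD(6)[OF m(1) that] by simp
    then show ?thesis
      using that[of U' f' ?B id] m(1) U'B U'Z sep assms(6,9) linkageD(1)[OF assms(9)] by auto
  qed
qed

subsection \<open>Rooted path models\<close>

definition path_model :: "'a set list \<Rightarrow> bool" where
  "path_model Bs \<longleftrightarrow> (\<forall>B\<in>set Bs. conn B) \<and> successively touch Bs \<and> sorted_wrt disjnt Bs"

definition rooted_path :: "'a set \<Rightarrow> nat \<Rightarrow> 'a set \<Rightarrow> bool" where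
  "rooted_path S n W \<longleftrightarrow>
     (\<exists>Bs. path_model Bs \<and> length Bs = n \<and> (\<forall>B\<in>set Bs. B \<subseteq> W \<and> B \<inter> S \<noteq> {}))"

lemma path_model_Nil [simp]: "path_model []"
  unfolding path_model_def by simp

lemma path_model_singleton [simp]: "path_model [B] \<longleftrightarrow> conn B"
  unfolding path_model_def by simp

lemma path_model_append:
  "path_model (As @ Bs) \<longleftrightarrow> path_model As \<and> path_model Bs \<and>
     (As = [] \<or> Bs = [] \<or> touch (last As) (hd Bs)) \<and> \<Union>(set As) \<inter> \<Union>(set Bs) = {}"
proof -
  have "(\<forall>x\<in>set As. \<forall>y\<in>set Bs. disjnt x y) \<longleftrightarrow> \<Union>(set As) \<inter> \<Union>(set Bs) = {}"
    unfolding disjnt_def by blast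
  then show ?thesis
    unfolding path_model_def by (auto simp: successively_append_iff sorted_wrt_append)
qed

lemma path_model_rev: "path_model (rev Bs) \<longleftrightarrow> path_model Bs"
proof -
  have 1: "(\<lambda>x y. touch y x) = touch" using touch_sym by blast
  have 2: "(\<lambda>x y :: 'a set. disjnt y x) = disjnt" by (intro ext) (auto simp: disjnt_sym)
  show ?thesis unfolding path_model_def successively_rev sorted_wrt_rev set_rev 1 2 by (rule refl)
qed

lemma rooted_pathI:
  "path_model Bs \<Longrightarrow> length Bs = n \<Longrightarrow> (\<And>B. B \<in> set Bs \<Longrightarrow> B \<subseteq> W \<and> B \<inter> S \<noteq> {}) \<Longrightarrow> rooted_path S n W"
  unfolding rooted_path_def by blast

lemma rooted_path_mono: "rooted_path S n W \<Longrightarrow> m \<le> n \<Longrightarrow> W \<subseteq> W' \<Longrightarrow> rooted_path S m W'"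
proof -
  assume "rooted_path S n W" and h: "m \<le> n" "W \<subseteq> W'"
  then obtain Bs where Bs: "path_model Bs" "length Bs = n" "\<forall>B\<in>set Bs. B \<subseteq> W \<and> B \<inter> S \<noteq> {}"
    unfolding rooted_path_def by blast
  have "path_model (take m Bs)" using Bs(1) path_model_append[of "take m Bs" "drop m Bs"] by simp
  moreover have "length (take m Bs) = m" using Bs h by simp
  ultimately show ?thesis using Bs(3) h(2) by (intro rooted_pathI) (auto dest: in_set_takeD)
qed

text \<open>The sets \<open>g u\<close> will be linkage paths, or pieces of them, with end
  \<open>u\<close>; a branch set swallows those that end in it and can thereby reach
  \<open>S\<close>.\<close>

definition attach :: "'a set \<Rightarrow> ('a \<Rightarrow> 'a set) \<Rightarrow> 'a set \<Rightarrow> 'a set" where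
  "attach U g A = A \<union> \<Union>(g ` (A \<inter> U))"

lemma attach_superset: "A \<subseteq> attach U g A" unfolding attach_def by blast

text \<open>Growing the branch sets keeps all contacts. They stay disjoint because
  \<open>g u\<close> meets the model at most in \<open>u\<close> and the sets \<open>g u\<close> are
  disjoint from each other.\<close>

lemma path_model_attach:
  assumes "path_model As"
    and g: "\<And>u. u \<in> U \<Longrightarrow> u \<in> g u \<and> conn (g u) \<and> g u \<inter> \<Union>(set As) \<subseteq> {u}"
    and disj: "\<And>u u'. u \<in> U \<Longrightarrow> u' \<in> U \<Longrightarrow> u \<noteq> u' \<Longrightarrow> g u \<inter> g u' = {}"
  shows "path_model (map (attach U g) As)"
proof -
  have "conn (attach U g A)" if "A \<in> set As" for A
    unfolding attach_def
  proof (rule conn_Un_star)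
    show "conn A" using assms(1) that unfolding path_model_def by blast
  next
    fix B assume "B \<in> g ` (A \<inter> U)"
    then show "conn B \<and> (A \<inter> B \<noteq> {} \<or> touch A B)" using g by blast
  qed
  moreover have "successively touch (map (attach U g) As)"
    unfolding successively_map
    by (rule successively_mono[of touch]) (use assms(1) attach_superset touch_mono in \<open>auto simp: path_model_def\<close>)
  moreover have "sorted_wrt disjnt (map (attach U g) As)"
    unfolding sorted_wrt_map
  proof (rule sorted_wrt_mono_rel[of _ disjnt])
    show "sorted_wrt disjnt As" using assms(1) unfolding path_model_def by blast
    fix A B assume AB: "A \<in> set As" "B \<in> set As" "disjnt A B"
    then have AB': "A \<inter> B = {}" unfolding disjnt_def by blast
    have 1: "g u \<inter> B = {}" if "u \<in> A \<inter> U" for u using g[of u] that AB AB' by blast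
    have 2: "A \<inter> g u = {}" if "u \<in> B \<inter> U" for u using g[of u] that AB AB' by blast
    have 3: "g u \<inter> g u' = {}" if "u \<in> A \<inter> U" "u' \<in> B \<inter> U" for u u'
      using disj[of u u'] that AB' by blast
    show "disjnt (attach U g A) (attach U g B)"
      unfolding disjnt_def
    proof (rule equals0I)
      fix z assume z: "z \<in> attach U g A \<inter> attach U g B"
      consider "z \<in> A" | u where "u \<in> A \<inter> U" "z \<in> g u" using z unfolding attach_def by blast
      note zA = this
      consider "z \<in> B" | u where "u \<in> B \<inter> U" "z \<in> g u" using z unfolding attach_def by blast
      note zB = this
      show False
      proof (cases rule: zA)
        case 1
        then show False by (cases rule: zB) (use AB' 2 in auto)
      next
        case z: (2 u)
        then show False by (cases rule: zB) (use 1[OF z(1)] 3[OF z(1)] in auto)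
      qed
    qed
  qed
  ultimately show ?thesis unfolding path_model_def by simp
qed

text \<open>Cutting at the branch set that contains \<open>x\<close>, and keeping it on both sides,
  gives two pieces whose lengths sum to \<open>length Bs + 1\<close>; the longer one is
  taken.\<close>

lemma path_model_half:
  assumes "path_model Bs" "x \<in> \<Union>(set Bs)"
  shows "\<exists>Cs. path_model Cs \<and> set Cs \<subseteq> set Bs \<and> Cs \<noteq> [] \<and> x \<in> last Cs \<and> (length Bs + 2) div 2 \<le> length Cs"
proof -
  obtain B where "B \<in> set Bs" "x \<in> B" using assms by blast
  then obtain xs ys where Bs: "Bs = xs @ B # ys" using split_list by metis
  have 1: "path_model (xs @ [B])" using assms(1) Bs path_model_append[of "xs @ [B]" ys] by simp
  have 2: "path_model (rev (B # ys))" using assms(1) Bs path_model_append[of xs "B # ys"] path_model_rev by blast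
  show ?thesis
  proof (cases "(length Bs + 2) div 2 \<le> length (xs @ [B])")
    case True
    then show ?thesis using 1 Bs \<open>x \<in> B\<close> by (intro exI[of _ "xs @ [B]"]) auto
  next
    case False
    then show ?thesis using 2 Bs \<open>x \<in> B\<close> by (intro exI[of _ "rev (B # ys)"]) auto
  qed
qed

text \<open>
  Two disjoint models are joined at their contact; the longer half of each is kept. A model of
  maximal total size makes contact because a missing edge could be used to enlarge it.
\<close>

lemma rooted_path_combine:
  assumes "finite W" "conn W" "rooted_path S a V" "rooted_path S b V'" "V \<inter> V' = {}" "V \<union> V' \<subseteq> W"
    "0 < a" "0 < b" "c \<le> (a + 2) div 2 + (b + 2) div 2"
  shows "rooted_path S c W"
proof -
  obtain Bs' where Bs': "path_model Bs'" "length Bs' = b" "\<forall>B\<in>set Bs'. B \<subseteq> V' \<and> B \<inter> S \<noteq> {}"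
    using assms(4) unfolding rooted_path_def by blast
  define V1 where "V1 = \<Union>(set Bs')"
  define ok where "ok Bs \<longleftrightarrow> path_model Bs \<and> length Bs = a \<and> (\<forall>B\<in>set Bs. B \<subseteq> W - V1 \<and> B \<inter> S \<noteq> {})" for Bs
  have V1: "V1 \<subseteq> V'" "V1 \<noteq> {}"
  proof -
    show "V1 \<subseteq> V'" using Bs' unfolding V1_def by blast
    have "hd Bs' \<in> set Bs'" using Bs'(2) assms(8) by (cases Bs') auto
    then show "V1 \<noteq> {}" using Bs' unfolding V1_def by blast
  qed
  have "\<exists>Bs. ok Bs" using assms(3,5,6) V1 unfolding rooted_path_def ok_def by blast
  moreover have "card (\<Union>(set Bs)) < Suc (card W)" if "ok Bs" for Bs
  proof -
    have "\<Union>(set Bs) \<subseteq> W" using that unfolding ok_def by blast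
    then show ?thesis using card_mono[OF assms(1)] le_imp_less_Suc by blast
  qed
  ultimately obtain Bs where Bs: "ok Bs" and mx: "\<And>Cs. ok Cs \<Longrightarrow> card (\<Union>(set Cs)) \<le> card (\<Union>(set Bs))"
    using ex_has_greatest_nat[of ok _ "\<lambda>Bs. card (\<Union>(set Bs))" "Suc (card W)"] by blast
  define V0 where "V0 = \<Union>(set Bs)"
  have V0: "V0 \<subseteq> W - V1" using Bs unfolding V0_def ok_def by blast
  have "hd Bs \<in> set Bs" using Bs assms(7) unfolding ok_def by (cases Bs) auto
  then have "V0 \<noteq> {}" using Bs unfolding V0_def ok_def by blast
  have "touch V0 V1"
  proof (rule ccontr)
    assume nt: "\<not> touch V0 V1"
    \<comment> \<open>An edge leaving \<open>V0\<close> ends in some \<open>y\<close> outside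
      \<open>V1\<close>; giving \<open>y\<close> to the branch set of the other end contradicts the
      maximal size of \<open>Bs\<close>.\<close>
    have "touch (W \<inter> V0) (W - V0)" using connD[OF assms(2), of V0] V0 V1 assms(6) \<open>V0 \<noteq> {}\<close> by blast
    then obtain x y where xy: "x \<in> V0" "y \<in> W" "y \<notin> V0" "(x, y) \<in> E" unfolding touch_def by blast
    then have "y \<notin> V1" using nt touchI by blast
    let ?g = "\<lambda>u. {u, y}"
    let ?Cs = "map (attach {x} ?g) Bs"
    have "path_model ?Cs"
    proof (rule path_model_attach)
      show "path_model Bs" using Bs unfolding ok_def by blast
      have "conn {x, y}" using xy(4) conn_insert[OF conn_singleton, of x x y] by (simp add: insert_commute)
      then show "u \<in> ?g u \<and> conn (?g u) \<and> ?g u \<inter> \<Union>(set Bs) \<subseteq> {u}" if "u \<in> {x}" for u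
        using that xy(3) unfolding V0_def by auto
    qed auto
    then have "ok ?Cs" using Bs xy(2) \<open>y \<notin> V1\<close> unfolding ok_def attach_def by auto
    moreover have "insert y V0 \<subseteq> \<Union>(set ?Cs)" using xy(1) unfolding V0_def attach_def by auto
    moreover have "finite (\<Union>(set ?Cs))"
      using calculation(1) finite_subset[OF _ assms(1), of "\<Union>(set ?Cs)"] unfolding ok_def by blast
    ultimately have "card (insert y V0) \<le> card V0"
      using mx[of ?Cs] card_mono[of "\<Union>(set ?Cs)" "insert y V0"] unfolding V0_def by linarith
    moreover have "finite V0" using V0 assms(1) finite_subset by blast
    ultimately show False using xy(3) by simp
  qed
  then obtain x y where xy: "x \<in> V0" "y \<in> V1" "(x, y) \<in> E" unfolding touch_def by blast
  obtain Cs where Cs: "path_model Cs" "set Cs \<subseteq> set Bs" "Cs \<noteq> []" "x \<in> last Cs" "(a + 2) div 2 \<le> length Cs"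
    using path_model_half[of Bs x] Bs xy(1) unfolding ok_def V0_def by metis
  obtain Ds where Ds: "path_model Ds" "set Ds \<subseteq> set Bs'" "Ds \<noteq> []" "y \<in> last Ds" "(b + 2) div 2 \<le> length Ds"
    using path_model_half[OF Bs'(1) xy(2)[unfolded V1_def]] Bs'(2) by metis
  have "\<Union>(set Cs) \<subseteq> V0" "\<Union>(set Ds) \<subseteq> V1" using Cs(2) Ds(2) unfolding V0_def V1_def by blast+
  then have "\<Union>(set Cs) \<inter> \<Union>(set (rev Ds)) = {}" using V0 by auto
  then have "path_model (Cs @ rev Ds)"
    unfolding path_model_append path_model_rev
    using Cs Ds touchI[OF Cs(4) Ds(4) xy(3)] by (simp add: hd_rev)
  moreover have "B \<subseteq> W \<and> B \<inter> S \<noteq> {}" if "B \<in> set (Cs @ rev Ds)" for B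
  proof -
    have "\<forall>B\<in>set Bs. B \<subseteq> W \<and> B \<inter> S \<noteq> {}" using Bs unfolding ok_def by blast
    moreover have "\<forall>B\<in>set Bs'. B \<subseteq> W \<and> B \<inter> S \<noteq> {}" using Bs' assms(6) by blast
    ultimately show ?thesis using that Cs(2) Ds(2) by auto
  qed
  ultimately have "rooted_path S (length (Cs @ rev Ds)) W" using rooted_pathI[OF _ refl] by blast
  then show ?thesis by (rule rooted_path_mono) (use Cs(5) Ds(5) assms(9) in auto)
qed

subsection \<open>Eliminating the root vertices\<close>

text \<open>
  \<open>eliminable S b W\<close>: by deleting vertices one at a time and passing to a component after each deletion,
  the vertices of \<open>S\<close> are used up after at most \<open>b\<close> deletions.
\<close>

primrec eliminable :: "'a set \<Rightarrow> nat \<Rightarrow> 'a set \<Rightarrow> bool" where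
  "eliminable S 0 W \<longleftrightarrow> W \<inter> S = {}"
| "eliminable S (Suc b) W \<longleftrightarrow> W \<inter> S = {} \<or> (\<exists>x\<in>W. \<forall>D\<in>comps (W - {x}). eliminable S b D)"

lemma eliminable_disjoint: "W \<inter> S = {} \<Longrightarrow> eliminable S b W"
  by (cases b) auto

lemma eliminable_mono: "eliminable S b W \<Longrightarrow> b \<le> b' \<Longrightarrow> eliminable S b' W"
proof (induction b arbitrary: W b')
  case 0
  then show ?case by (simp add: eliminable_disjoint)
next
  case (Suc b)
  then obtain c where "b' = Suc c" "b \<le> c" by (cases b') auto
  have "W \<inter> S = {} \<or> (\<exists>x\<in>W. \<forall>D\<in>comps (W - {x}). eliminable S c D)"
    using Suc.prems(1) Suc.IH[OF _ \<open>b \<le> c\<close>] by (metis eliminable.simps(2))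
  then show ?case using \<open>b' = Suc c\<close> by simp
qed

text \<open>The vertices of \<open>X\<close> are deleted one after another, and those outside the
  current set cost nothing. Components that arise in stages are components of
  \<open>W - X\<close>.\<close>

lemma eliminable_delete:
  assumes "finite X" "conn W" "\<And>D. D \<in> comps (W - X) \<Longrightarrow> eliminable S b D"
  shows "eliminable S (b + card X) W"
  using assms
proof (induction X arbitrary: W rule: finite_induct)
  case empty
  then show ?case by (simp add: comps_of_conn)
next
  case (insert x X)
  show ?case
  proof (cases "x \<in> W")
    case False
    then have "W - insert x X = W - X" by blast
    then have "eliminable S (b + card X) W" using insert by simp
    then show ?thesis using insert.hyps by (elim eliminable_mono) simp
  next
    case True
    have "eliminable S (b + card X) D'" if D': "D' \<in> comps (W - {x})" for D'
    proof (rule insert.IH)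
      show "conn D'" using comps_conn D' by blast
      fix D assume D: "D \<in> comps (D' - X)"
      have "D \<in> comps (W - insert x X)"
      proof (rule comps_I)
        show "D \<subseteq> W - insert x X" using comps_subset[OF D] comps_subset[OF D'] by blast
        show "conn D" using comps_conn D by blast
        fix a e assume "a \<in> D" "e \<in> W - insert x X" "(a, e) \<in> E"
        then show "e \<in> D"
          using comps_closed[OF D', of a e] comps_closed[OF D, of a e] comps_subset[OF D] by blast
      qed
      then show "eliminable S b D" by (rule insert.prems)
    qed
    then have "eliminable S (Suc (b + card X)) W" using True by auto
    then show ?thesis using insert.hyps by simp
  qed
qed

section \<open>Exploration of a connected set by a growing path model\<close>

definition neighbours :: "'a set \<Rightarrow> 'a set \<Rightarrow> 'a set" where
  "neighbours W C = {z \<in> W - C. touch {z} C}"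

lemma neighboursI: "z \<in> W \<Longrightarrow> z \<notin> C \<Longrightarrow> c \<in> C \<Longrightarrow> (z, c) \<in> E \<Longrightarrow> z \<in> neighbours W C"
  unfolding neighbours_def touch_def by blast

lemma neighbours_nonempty: "conn W \<Longrightarrow> C \<subseteq> W \<Longrightarrow> C \<noteq> {} \<Longrightarrow> C \<noteq> W \<Longrightarrow> neighbours W C \<noteq> {}"
proof -
  assume "conn W" "C \<subseteq> W" "C \<noteq> {}" "C \<noteq> W"
  then have "touch C (W - C)" unfolding conn_def by blast
  then show ?thesis unfolding neighbours_def touch_def using E_sym by blast
qed

lemma neighbours_comps: "D \<in> comps (W - X) \<Longrightarrow> neighbours W D \<subseteq> X"
  unfolding neighbours_def touch_def using comps_closed E_sym by blast

text \<open>
  \<open>C\<close> is the part still to be explored and \<open>As\<close> a path model outside \<open>C\<close>, every member of which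
  attaches to \<open>C\<close> by at most one vertex. A member without a vertex of \<open>S\<close> can reach \<open>S\<close> inside
  \<open>C\<close>, and all these members can do so disjointly.
\<close>

definition exploration :: "'a set \<Rightarrow> 'a set \<Rightarrow> 'a set \<Rightarrow> 'a set list \<Rightarrow> bool" where
  "exploration S W C As \<longleftrightarrow> C \<subseteq> W \<and> conn C \<and> path_model As \<and> As \<noteq> [] \<and> \<Union>(set As) \<subseteq> W - C \<and>
     neighbours W C \<subseteq> \<Union>(set As) \<and> (\<forall>A\<in>set As. \<forall>x\<in>A \<inter> neighbours W C. \<forall>y\<in>A \<inter> neighbours W C. x = y) \<and>
     last As \<inter> neighbours W C \<noteq> {} \<and> hd As \<inter> S \<noteq> {} \<and>
     (\<forall>A\<in>set As. A \<inter> S = {} \<longrightarrow> A \<inter> neighbours W C \<noteq> {}) \<and>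
     (\<exists>f. linkage (C \<union> neighbours W C) (S \<inter> C) (neighbours W C) {z \<in> neighbours W C. \<exists>A\<in>set As. z \<in> A \<and> A \<inter> S = {}} f)"

text \<open>The single branch set \<open>{s}\<close> meets \<open>S\<close>, so no path into
  \<open>C\<close> is demanded and the linkage is empty.\<close>

lemma exploration_init:
  assumes "conn W" "s \<in> W" "s \<in> S" "C \<in> comps (W - {s})"
  shows "exploration S W C [{s}]"
proof -
  have C: "C \<subseteq> W - {s}" "conn C" using comps_subset comps_conn assms by blast+
  have neighbours: "neighbours W C = {s}"
    using neighbours_comps[OF assms(4)] neighbours_nonempty[OF assms(1), of C] C conn_nonempty[OF C(2)] assms(2) by blast
  have "{z \<in> neighbours W C. \<exists>A\<in>set [{s}]. z \<in> A \<and> A \<inter> S = {}} = {}" using assms(3) by auto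
  then have "linkage (C \<union> neighbours W C) (S \<inter> C) (neighbours W C) {z \<in> neighbours W C. \<exists>A\<in>set [{s}]. z \<in> A \<and> A \<inter> S = {}} f" for f
    unfolding linkage_def by (simp only:) simp
  then show ?thesis unfolding exploration_def using C neighbours assms conn_singleton by auto
qed

text \<open>Sending each vertex of \<open>Z\<close> to a member that contains it is
  injective.\<close>

lemma card_transversal:
  assumes "Z \<subseteq> \<Union>(set As)" "\<forall>A\<in>set As. \<forall>x\<in>A \<inter> Z. \<forall>y\<in>A \<inter> Z. x = y"
  shows "card Z \<le> length As"
proof -
  have "\<forall>z\<in>Z. \<exists>A\<in>set As. z \<in> A" using assms(1) by blast
  then obtain h where h: "\<forall>z\<in>Z. h z \<in> set As \<and> z \<in> h z" by metis
  have "inj_on h Z" unfolding inj_on_def using h assms(2) by (metis IntI)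
  then have "card Z \<le> card (set As)" using card_inj_on_le[of h Z "set As"] h by auto
  then show ?thesis using card_length le_trans by blast
qed

lemma path_model_eq: "path_model As \<Longrightarrow> A \<in> set As \<Longrightarrow> B \<in> set As \<Longrightarrow> x \<in> A \<Longrightarrow> x \<in> B \<Longrightarrow> A = B"
proof (induction As)
  case Nil
  then show ?case by simp
next
  case (Cons C As)
  then have "path_model As" "\<forall>D\<in>set As. disjnt C D"
    unfolding path_model_def by (auto simp: successively_Cons)
  then show ?case using Cons unfolding disjnt_def by auto
qed

text \<open>If \<open>v\<close> is an end of the linkage, its path becomes a new last branch set,
  adjacent to the old last one through the edge from \<open>z\<close> to \<open>v\<close>.\<close>

lemma path_model_attach_append:
  assumes "path_model As" "As \<noteq> []"
    and g: "\<And>u. u \<in> V \<Longrightarrow> u \<in> g u \<and> conn (g u) \<and> g u \<inter> \<Union>(set As) \<subseteq> {u}"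
    and disj: "\<And>u u'. u \<in> V \<Longrightarrow> u' \<in> V \<Longrightarrow> u \<noteq> u' \<Longrightarrow> g u \<inter> g u' = {}"
    and v: "v \<notin> \<Union>(set As)" "z \<in> last As" "(z, v) \<in> E"
  shows "path_model (map (attach V g) As @ (if v \<in> V then [g v] else []))"
proof (cases "v \<in> V")
  case False
  then show ?thesis using path_model_attach[OF assms(1) g disj] by simp
next
  case True
  have "touch (last (map (attach V g) As)) (g v)"
    using v g[OF True] assms(2) attach_superset[of "last As" V g] touchI[of z _ v "g v"]
    by (auto simp: last_map)
  moreover have "attach V g A \<inter> g v = {}" if A: "A \<in> set As" for A
  proof -
    have "A \<inter> g v = {}" using g[OF True] v(1) A by blast
    moreover have "g u \<inter> g v = {}" if "u \<in> A \<inter> V" for u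
      using disj[of u v] that True v(1) A by blast
    ultimately show ?thesis unfolding attach_def by blast
  qed
  ultimately show ?thesis
    using True path_model_attach[OF assms(1) g disj] g[OF True] by (auto simp: path_model_append)
qed

text \<open>The linkage towards \<open>Z\<close> is pushed to a separator \<open>X\<close>.
  Attaching its paths to the members of \<open>As\<close> gives a rooted model; its length is at
  most \<open>l\<close>, which bounds \<open>X\<close> and \<open>Z\<close>. For a component
  \<open>D\<close> of \<open>W - X\<close> inside \<open>C\<close>, the parts of the paths outside
  \<open>D\<close> are attached instead, and the parts inside \<open>D\<close> form the linkage of
  the new exploration.\<close>

lemma exploration_step:
  assumes "finite W" "conn W" "exploration S W C As" "S \<inter> C \<noteq> {}" "\<not> rooted_path S (Suc l) W"
  shows "\<exists>X. X \<subseteq> W \<and> card X \<le> l \<and> card X + card (neighbours W C) < 2 * l \<and>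
    separates (C \<union> neighbours W C) X (S \<inter> C) (neighbours W C) \<and>
    (\<forall>D\<in>comps (W - X). D \<inter> neighbours W C = {} \<longrightarrow> D \<inter> C \<noteq> {} \<longrightarrow> D \<subset> C \<and> (\<exists>As'. exploration S W D As'))"
proof -
  define Z where "Z = neighbours W C"
  define U where "U = {z \<in> Z. \<exists>A\<in>set As. z \<in> A \<and> A \<inter> S = {}}"
  obtain f where st: "C \<subseteq> W" "conn C" "path_model As" "As \<noteq> []" "\<Union>(set As) \<subseteq> W - C" "Z \<subseteq> \<Union>(set As)"
      "\<forall>A\<in>set As. \<forall>x\<in>A \<inter> Z. \<forall>y\<in>A \<inter> Z. x = y" "last As \<inter> Z \<noteq> {}" "hd As \<inter> S \<noteq> {}"
      "\<forall>A\<in>set As. A \<inter> S = {} \<longrightarrow> A \<inter> Z \<noteq> {}"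
      "linkage (C \<union> Z) (S \<inter> C) Z U f"
    using assms(3) unfolding exploration_def Z_def U_def by (elim conjE exE) (rule that[unfolded Z_def U_def]; assumption)
  have ZW: "Z \<subseteq> W - C" unfolding Z_def neighbours_def by blast
  obtain zl where zl: "zl \<in> last As" "zl \<in> Z" using st(8) by blast
  \<comment> \<open>A path ending in \<open>v\<close> can extend the model behind its last
    member.\<close>
  then obtain v where v: "v \<in> C" "(zl, v) \<in> E" unfolding Z_def neighbours_def touch_def by blast
  have fin: "finite C" "finite Z" using assms(1) st(1) ZW finite_subset by blast+
  have touchZ: "touch {z} C" if "z \<in> Z" for z using that unfolding Z_def neighbours_def by blast
  have CZ: "C \<inter> Z = {}" using ZW by blast
  have SC: "S \<inter> C \<subseteq> C" by blast
  obtain U' f' X g where s: "U \<subseteq> U'" "U' \<subseteq> insert v Z" "linkage (C \<union> Z) (S \<inter> C) (U' \<union> Z) U' f'"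
    "X \<subseteq> C \<union> Z" "X \<inter> C \<noteq> {}" "separates (C \<union> Z) X (S \<inter> C) Z" "card X = card U'"
    "inj_on g U'" "g ` U' = X" "\<And>b. b \<in> U' \<Longrightarrow> set (f' b) \<inter> X = {g b}" "v \<in> U' \<Longrightarrow> v \<in> X"
    using linkage_step[OF fin CZ st(2) touchZ v(1) SC assms(4) st(11)] by metis
  note L = linkageD[OF s(3)]
  define P where "P u = set (f' u)" for u
  have P: "conn (P u)" "u \<in> P u" "P u \<inter> S \<noteq> {}" "P u \<subseteq> C \<union> Z" "P u \<inter> \<Union>(set As) \<subseteq> {u}" if u: "u \<in> U'" for u
  proof -
    show "conn (P u)" using L(2)[OF u] simple_path_conn unfolding P_def by blast
    have ne: "f' u \<noteq> []" using L(2)[OF u] by auto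
    show "u \<in> P u" using L(3)[OF u] last_in_set[OF ne] unfolding P_def by simp
    show "P u \<inter> S \<noteq> {}" using L(4)[OF u] hd_in_set[OF ne] unfolding P_def by blast
    show sub: "P u \<subseteq> C \<union> Z" using L(5)[OF u] unfolding P_def .
    have "P u \<inter> \<Union>(set As) \<subseteq> P u \<inter> (U' \<union> Z)" using sub st(5) by blast
    then show "P u \<inter> \<Union>(set As) \<subseteq> {u}" using L(6)[OF u] unfolding P_def by simp
  qed
  have Pdisj: "P u \<inter> P u' = {}" if "u \<in> U'" "u' \<in> U'" "u \<noteq> u'" for u u'
    using L(7)[OF that] unfolding P_def .
  have vAs: "v \<notin> \<Union>(set As)" using st(5) v(1) by blast
  have AU: "A \<inter> U' \<subseteq> Z" if "A \<in> set As" for A using s(2) vAs that by blast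
  have model: "path_model (map (attach V G) As @ (if v \<in> V then [G v] else []))"
    if V: "V \<subseteq> U'" and G: "\<And>u. u \<in> V \<Longrightarrow> u \<in> G u \<and> conn (G u) \<and> G u \<subseteq> P u" for V G
  proof (rule path_model_attach_append[OF st(3,4) _ _ vAs zl(1) v(2)])
    show "u \<in> G u \<and> conn (G u) \<and> G u \<inter> \<Union>(set As) \<subseteq> {u}" if "u \<in> V" for u
      using G[OF that] P(5)[of u] V that by blast
    show "G u \<inter> G u' = {}" if "u \<in> V" "u' \<in> V" "u \<noteq> u'" for u u'
      using G[OF that(1)] G[OF that(2)] Pdisj[of u u'] V that by blast
  qed
  have attW: "attach V P A \<subseteq> W" if "V \<subseteq> U'" "A \<in> set As" for V A
  proof -
    have "P u \<subseteq> W" if "u \<in> A \<inter> V" for u using P(4)[of u] that \<open>V \<subseteq> U'\<close> st(1) ZW by blast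
    then show ?thesis using st(5) that(2) unfolding attach_def by blast
  qed
  have root: "attach V P A \<inter> S \<noteq> {}" if rt: "V \<subseteq> U'" "A \<in> set As" "A \<inter> S \<noteq> {} \<or> A \<inter> U \<subseteq> V" for V A
  proof (cases "A \<inter> S = {}")
    case False
    then show ?thesis unfolding attach_def by blast
  next
    case True
    then obtain z where z: "z \<in> A" "z \<in> Z" using st(10) rt(2) by blast
    then have "z \<in> A \<inter> V" using rt True unfolding U_def by blast
    then show ?thesis using P(3)[of z] rt(1) unfolding attach_def by blast
  qed
  let ?P = "map (attach U' P) As"
  have Pprop: "u \<in> P u \<and> conn (P u) \<and> P u \<subseteq> P u" if "u \<in> U'" for u using P[OF that] by blast
  have rootU': "B \<subseteq> W \<and> B \<inter> S \<noteq> {}" if B: "B \<in> set ?P" for B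
  proof -
    obtain A where A: "A \<in> set As" "B = attach U' P A" using B by auto
    have "A \<inter> U \<subseteq> U'" using s(1) by blast
    then show ?thesis using attW[OF order_refl A(1)] root[OF order_refl A(1)] A(2) by blast
  qed
  have lenl: "length As \<le> l"
  proof (rule ccontr)
    assume nl: "\<not> length As \<le> l"
    have "path_model ?P" using model[OF order_refl Pprop] path_model_append by blast
    then have "rooted_path S (length As) W" using rootU' by (intro rooted_pathI[of ?P]) simp_all
    then show False using assms(5) rooted_path_mono[of S "length As" W "Suc l" W] nl by simp
  qed
  have cZ: "card Z \<le> length As" using card_transversal[OF st(6,7)] .
  \<comment> \<open>In both situations the model can be lengthened by one branch set: by the path of
    \<open>v\<close> at the end, or by the path at the first member at the beginning.\<close>
  have short: "length As < l" if sh: "v \<in> U' \<or> hd As \<inter> U' \<noteq> {}"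
  proof -
    have "rooted_path S (Suc (length As)) W"
    proof (cases "v \<in> U'")
      case True
      have pm: "path_model (?P @ [P v])" using model[OF order_refl Pprop] True by simp
      have "B \<subseteq> W \<and> B \<inter> S \<noteq> {}" if "B \<in> set (?P @ [P v])" for B
        using that rootU'[of B] P(3,4)[OF True] st(1) ZW by auto
      then show ?thesis using pm by (intro rooted_pathI[of "?P @ [P v]"]) simp_all
    next
      case False
      then obtain z where z: "z \<in> hd As" "z \<in> U'" using sh by blast
      have hdAs: "hd As \<in> set As" using st(4) by simp
      have zZ: "z \<in> Z" using AU[OF hdAs] z by blast
      \<comment> \<open>The first member meets \<open>S\<close> by itself and can give up its path;
        this path without its end \<open>z\<close> becomes a new first branch set.\<close>
      define U1 where "U1 = U' - {z}"
      define q where "q = butlast (f' z)"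
      have ne: "f' z \<noteq> []" using L(2)[OF z(2)] by auto
      have fz: "f' z = q @ [z]" using append_butlast_last_id[OF ne] L(3)[OF z(2)] unfolding q_def by simp
      have "q \<noteq> []" using fz L(4)[OF z(2)] zZ CZ by auto
      have q: "simple_path q" "(last q, z) \<in> E" "z \<notin> set q" "hd q \<in> S"
        using L(2)[OF z(2)] L(4)[OF z(2)] \<open>q \<noteq> []\<close> unfolding fz by (auto simp: simple_path_append)
      let ?Q = "map (attach U1 P) As"
      have U1: "U1 \<subseteq> U'" unfolding U1_def by blast
      have pmQ: "path_model ?Q" using model[OF U1, of P] Pprop U1 path_model_append by blast
      have qP: "set q \<subseteq> P z" unfolding P_def fz by auto
      have dq: "set q \<inter> attach U1 P A = {}" if A: "A \<in> set As" for A
      proof -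
        have "set q \<inter> A = {}" using qP P(5)[OF z(2)] A q(3) by blast
        moreover have "set q \<inter> P u = {}" if "u \<in> A \<inter> U1" for u
          using Pdisj[of z u] that z(2) qP unfolding U1_def by blast
        ultimately show ?thesis unfolding attach_def by blast
      qed
      have "touch (set q) (hd ?Q)"
        using touchI[OF last_in_set[OF \<open>q \<noteq> []\<close>] _ q(2), of "hd ?Q"] z(1) st(4) attach_superset[of "hd As" U1 P]
        by (auto simp: hd_map)
      then have pm: "path_model ([set q] @ ?Q)"
        unfolding path_model_append using pmQ dq simple_path_conn[OF q(1)] by auto
      have rt: "B \<subseteq> W \<and> B \<inter> S \<noteq> {}" if B: "B \<in> set ?Q" for B
      proof -
        obtain A where A: "A \<in> set As" "B = attach U1 P A" using B by auto
        have "A \<inter> S \<noteq> {} \<or> A \<inter> U \<subseteq> U1"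
        proof (cases "z \<in> A")
          case True
          then have "A = hd As" using path_model_eq[OF st(3) A(1) hdAs _ z(1)] by blast
          then show ?thesis using st(9) by blast
        next
          case False
          then show ?thesis using s(1) unfolding U1_def by blast
        qed
        then show ?thesis using attW[OF U1 A(1)] root[OF U1 A(1)] A(2) by blast
      qed
      have "set q \<subseteq> W" using qP P(4)[OF z(2)] st(1) ZW by blast
      moreover have "set q \<inter> S \<noteq> {}" using q(4) \<open>q \<noteq> []\<close> by (metis IntI empty_iff hd_in_set)
      ultimately have "B \<subseteq> W \<and> B \<inter> S \<noteq> {}" if "B \<in> set ([set q] @ ?Q)" for B
        using that rt by auto
      then show ?thesis using pm by (intro rooted_pathI[of "[set q] @ ?Q"]) simp_all
    qed
    then show ?thesis using assms(5) rooted_path_mono[of S "Suc (length As)" W "Suc l" W] by (metis not_less_eq_eq not_less order_refl)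
  qed
  \<comment> \<open>If \<open>short\<close> applies, then \<open>card Z < l\<close> and
    \<open>card U' \<le> card Z + 1\<close>. Otherwise all ends lie in the members after the first,
    so \<open>card U' < length As \<le> l\<close> while \<open>card Z \<le> l\<close>.\<close>
  have cards: "card X \<le> l \<and> card X + card Z < 2 * l"
  proof (cases "v \<in> U' \<or> hd As \<inter> U' \<noteq> {}")
    case True
    have "card U' \<le> Suc (card Z)" using card_mono[OF _ s(2)] fin(2) card_insert_le_m1[of "Suc (card Z)" Z v] by simp
    then show ?thesis using short[OF True] cZ s(7) by simp
  next
    case False
    have hdtl: "As = hd As # tl As" using st(4) by simp
    have "U' \<subseteq> \<Union>(set (tl As))"
    proof
      fix u assume u: "u \<in> U'"
      then have "u \<in> \<Union>(set (hd As # tl As))" using s(2) st(6) False hdtl by auto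
      then show "u \<in> \<Union>(set (tl As))" using u False by auto
    qed
    moreover have "\<forall>A\<in>set (tl As). \<forall>x\<in>A \<inter> U'. \<forall>y\<in>A \<inter> U'. x = y"
    proof (intro ballI)
      fix A x y assume h: "A \<in> set (tl As)" "x \<in> A \<inter> U'" "y \<in> A \<inter> U'"
      have "A \<in> set As" using h(1) st(4) list.set_sel(2) by metis
      then show "x = y" using st(7) AU h(2,3) by blast
    qed
    ultimately have "card U' \<le> length (tl As)" by (rule card_transversal)
    moreover have "0 < length As" using st(4) by simp
    ultimately show ?thesis using lenl cZ s(7) unfolding length_tl by arith
  qed
  have XW: "X \<subseteq> W" using s(4) st(1) ZW by blast
  have "D \<subset> C \<and> (\<exists>As'. exploration S W D As')" if D: "D \<in> comps (W - X)" "D \<inter> Z = {}" "D \<inter> C \<noteq> {}" for D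
  proof -
    have Dp: "D \<subseteq> W - X" "conn D" using D(1) comps_subset comps_conn by blast+
    have "\<not> touch C (W - Z - C)" unfolding touch_def Z_def using neighboursI E_sym by blast
    then have DC: "D \<subseteq> C" using conn_subset[of D C "W - Z"] Dp D by blast
    have DC': "D \<noteq> C" using s(5) Dp by blast
    have uD: "u \<notin> D" if "u \<in> U'" for u using that s(2,11) D(2) Dp by blast
    have DX: "D \<inter> X = {}" using Dp by blast
    define N where "N = neighbours W D"
    have NX: "N \<subseteq> X" using neighbours_comps[OF D(1)] unfolding N_def .
    have ND: "N \<inter> D = {}" "N \<subseteq> W" unfolding N_def neighbours_def by blast+
    have "D \<subseteq> W" "D \<noteq> W" using Dp(1) DC DC' st(1) by blast+
    then have Nne: "N \<noteq> {}"
      using neighbours_nonempty[OF assms(2) _ conn_nonempty[OF Dp(2)]] unfolding N_def by simp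
    \<comment> \<open>A path meets \<open>X\<close> only in \<open>g u\<close>, so each of its two
      parts before and after \<open>g u\<close> lies in \<open>D\<close> or avoids it. The part
      towards \<open>u\<close> avoids \<open>D\<close>; hence \<open>G u\<close> is the whole path
      or its part from \<open>g u\<close> on.\<close>
    define G where "G u = P u - D" for u
    have gX: "g u \<in> X" "g u \<in> P u" if "u \<in> U'" for u using s(10)[OF that] unfolding P_def by auto
    have PX: "P u \<inter> X = {g u}" if "u \<in> U'" for u using s(10)[OF that] unfolding P_def .
    have G: "u \<in> G u \<and> conn (G u) \<and> G u \<subseteq> P u" "g u \<in> G u" "G u \<inter> X \<subseteq> {g u}"
      "G u \<inter> S = {} \<Longrightarrow> \<exists>p. simple_path p \<and> last p = g u \<and> hd p \<in> S \<inter> D \<and> set p \<subseteq> insert (g u) D \<and>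
         set p \<subseteq> P u \<and> g u \<in> N" if u: "u \<in> U'" for u
    proof -
      show "g u \<in> G u" using gX[OF u] DX unfolding G_def by blast
      show "G u \<inter> X \<subseteq> {g u}" using PX[OF u] unfolding G_def by blast
      obtain t h where th: "f' u = t @ g u # h" using gX(2)[OF u] split_list unfolding P_def by metis
      have sp: "simple_path (f' u)" using L(2)[OF u] .
      have dist: "distinct (f' u)" using sp unfolding simple_path_def by blast
      have thP: "set t \<subseteq> P u" "set h \<subseteq> P u" unfolding P_def th by auto
      have gth: "g u \<notin> set t" "g u \<notin> set h" using dist th by auto
      have thX: "set t \<inter> X = {}" "set h \<inter> X = {}"
        using Int_singleton_disjoint[OF _ thP(1) gth(1), of X] Int_singleton_disjoint[OF _ thP(2) gth(2), of X] PX[OF u]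
        by (simp_all add: Int_commute)
      have PW: "P u \<subseteq> W" using P(4)[OF u] st(1) ZW by blast
      have sph: "simple_path (g u # h)" using sp th simple_path_suffix[of t "g u # h"] by simp
      \<comment> \<open>If \<open>h\<close> entered \<open>D\<close>, it would stay there since it
        avoids \<open>X\<close>, and its last vertex \<open>u\<close> would be in
        \<open>D\<close>.\<close>
      have hD: "set h \<inter> D = {}"
      proof (rule ccontr)
        assume hD: "set h \<inter> D \<noteq> {}"
        then have hne: "h \<noteq> []" by auto
        then have "simple_path h" using sph simple_path_suffix[of "[g u]" h] by simp
        then have "set h \<subseteq> D"
          using comps_max[OF D(1) simple_path_conn] hD thX thP(2) PW by blast
        moreover have "last h = u" using L(3)[OF u] th hne by simp
        ultimately show False using last_in_set[OF hne] uD[OF u] by auto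
      qed
      have tD: "set t \<subseteq> D \<or> set t \<inter> D = {}"
      proof (cases "t = []")
        case False
        then have "simple_path t" using sp th simple_path_prefix[of t "g u # h"] by simp
        then show ?thesis
          using comps_max[OF D(1) simple_path_conn] thX thP(1) PW by blast
      qed simp
      have "conn (G u)"
      proof (cases "set t \<inter> D = {}")
        case True
        then have "P u \<inter> D = {}" using hD DX gX(1)[OF u] unfolding P_def th by auto
        then have "G u = P u" unfolding G_def by blast
        then show ?thesis using P(1)[OF u] by simp
      next
        case False
        then have "set t \<subseteq> D" using tD by blast
        then have "G u = set (g u # h)" using hD DX gX(1)[OF u] unfolding G_def P_def th by auto
        then show ?thesis using simple_path_conn[OF sph] by simp
      qed
      then show "u \<in> G u \<and> conn (G u) \<and> G u \<subseteq> P u" using P(2)[OF u] uD[OF u] unfolding G_def by blast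
      \<comment> \<open>The start of the path is in \<open>S\<close>, so it was lost to
        \<open>D\<close>; then all of \<open>t\<close> is in \<open>D\<close> and leads from
        \<open>S\<close> to the neighbour \<open>g u\<close> of \<open>D\<close>.\<close>
      assume GS: "G u \<inter> S = {}"
      let ?p = "t @ [g u]"
      have hdp: "hd ?p = hd (f' u)" unfolding th by (cases t) auto
      have hdS: "hd (f' u) \<in> S" "hd (f' u) \<in> P u" using L(4)[OF u] sp unfolding P_def by (auto simp: simple_path_def)
      then have hdD: "hd (f' u) \<in> D" using GS unfolding G_def by blast
      have tne: "t \<noteq> []"
      proof
        assume "t = []"
        then have "hd (f' u) = g u" unfolding th by simp
        then show False using hdD gX(1)[OF u] DX by auto
      qed
      then have "hd t \<in> D" using hdp hdD by simp
      then have tD': "set t \<subseteq> D" using tD hd_in_set[OF tne] by blast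
      have spp: "simple_path ?p" using sp th simple_path_prefix[of ?p h] by simp
      then have "(last t, g u) \<in> E" using tne by (simp add: simple_path_append)
      then have "g u \<in> N" unfolding N_def
        using neighboursI[of "g u" W D "last t"] last_in_set[OF tne] tD' E_sym gX(1)[OF u] DX XW by blast
      then show "\<exists>p. simple_path p \<and> last p = g u \<and> hd p \<in> S \<inter> D \<and> set p \<subseteq> insert (g u) D \<and>
         set p \<subseteq> P u \<and> g u \<in> N"
        using spp hdp hdS hdD tD' thP gX(2)[OF u] by (intro exI[of _ ?p]) auto
    qed
    define Bs where "Bs = map (attach U' G) As @ (if v \<in> U' then [G v] else [])"
    have pmB: "path_model Bs" unfolding Bs_def using model[OF order_refl G(1)] .
    \<comment> \<open>\<open>V\<close> collects the ends of the paths swallowed by \<open>B\<close>.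
      There is at most one, whence \<open>B\<close> meets \<open>X\<close> in at most one
      vertex.\<close>
    have Bs_cases: "\<exists>V. V \<subseteq> U' \<and> (\<forall>x\<in>V. \<forall>y\<in>V. x = y) \<and> B \<inter> X \<subseteq> g ` V \<and> (\<forall>u\<in>V. G u \<subseteq> B) \<and>
        B \<inter> D = {} \<and> B \<subseteq> W \<and> (B \<inter> S = {} \<longrightarrow> V \<noteq> {})" if B: "B \<in> set Bs" for B
    proof -
      have GW: "G u \<subseteq> W" "G u \<inter> D = {}" if "u \<in> U'" for u
        using P(4)[OF that] st(1) ZW unfolding G_def by blast+
      consider A where "A \<in> set As" "B = attach U' G A" | "v \<in> U'" "B = G v"
        using B unfolding Bs_def by (auto split: if_splits)
      then show ?thesis
      proof cases
        case (1 A)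
        have "A \<inter> X \<subseteq> g ` (A \<inter> U')"
        proof
          fix y assume y: "y \<in> A \<inter> X"
          then obtain u where u: "u \<in> U'" "y = g u" using s(9) by blast
          have "y \<in> P u \<inter> \<Union>(set As)" using gX(2)[OF u(1)] u(2) y 1(1) by blast
          then have "y = u" using P(5)[OF u(1)] by blast
          then show "y \<in> g ` (A \<inter> U')" using u y by blast
        qed
        moreover have "G u \<inter> X \<subseteq> g ` (A \<inter> U')" if "u \<in> A \<inter> U'" for u using G(3)[of u] that by blast
        ultimately have "B \<inter> X \<subseteq> g ` (A \<inter> U')" unfolding 1(2) attach_def by blast
        moreover have "\<forall>x\<in>A \<inter> U'. \<forall>y\<in>A \<inter> U'. x = y" using AU[OF 1(1)] st(7) 1(1) by blast
        moreover have "B \<inter> D = {}" "B \<subseteq> W"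
          using st(5) 1(1) DC GW unfolding 1(2) attach_def by blast+
        moreover have "A \<inter> U' \<noteq> {}" if "B \<inter> S = {}"
        proof -
          have "A \<inter> S = {}" using that unfolding 1(2) attach_def by blast
          then have "A \<inter> U \<noteq> {}" using st(10) 1(1) unfolding U_def by blast
          then show ?thesis using s(1) by blast
        qed
        ultimately show ?thesis unfolding 1(2) by (intro exI[of _ "A \<inter> U'"]) (auto simp: attach_def)
      next
        case 2
        then show ?thesis using G(3)[of v] GW[of v] by (intro exI[of _ "{v}"]) auto
      qed
    qed
    have XBs: "X \<subseteq> \<Union>(set Bs)"
    proof
      fix x assume "x \<in> X"
      then obtain u where u: "u \<in> U'" "x = g u" using s(9) by blast
      show "x \<in> \<Union>(set Bs)"
      proof (cases "u = v")
        case True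
        then show ?thesis using u G(2)[OF u(1)] unfolding Bs_def by auto
      next
        case False
        then obtain A where "A \<in> set As" "u \<in> A" using u(1) s(2) st(6) by blast
        then show ?thesis using u G(2)[OF u(1)] unfolding Bs_def attach_def by auto
      qed
    qed
    \<comment> \<open>The model is cut behind its last member with a neighbour of \<open>D\<close>,
      since the last member of an exploration must attach to the unexplored part.\<close>
    have "\<exists>B\<in>set Bs. B \<inter> N \<noteq> {}" using XBs NX Nne by blast
    then obtain ys B zs where Bspl: "Bs = ys @ B # zs" "B \<inter> N \<noteq> {}" "\<forall>u\<in>set zs. u \<inter> N = {}"
      by (rule split_list_last_propE) blast
    define Cs where "Cs = ys @ [B]"
    have CsBs: "set Cs \<subseteq> set Bs" unfolding Cs_def Bspl by auto
    have pmC: "path_model Cs" using pmB path_model_append[of Cs zs] unfolding Cs_def Bspl(1) by simp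
    have hdC: "hd Cs = attach U' G (hd As)"
    proof -
      have "hd Cs = hd Bs" unfolding Cs_def Bspl(1) by (cases ys) auto
      then show ?thesis unfolding Bs_def using st(4) by (simp add: hd_map)
    qed
    \<comment> \<open>The members of \<open>Cs\<close> without a vertex of \<open>S\<close> are
      linked by the initial parts of the paths, which lie in \<open>D\<close> except for the end
      \<open>g u\<close>.\<close>
    define U2 where "U2 = {z \<in> N. \<exists>A\<in>set Cs. z \<in> A \<and> A \<inter> S = {}}"
    have "\<exists>p. simple_path p \<and> last p = z \<and> hd p \<in> S \<inter> D \<and> set p \<subseteq> D \<union> N \<and> set p \<inter> N = {z} \<and>
        (\<exists>u\<in>U'. g u = z \<and> set p \<subseteq> P u)" if z: "z \<in> U2" for z
    proof -
      obtain A where A: "A \<in> set Bs" "z \<in> A" "A \<inter> S = {}" "z \<in> N" using z CsBs unfolding U2_def by blast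
      obtain V where V: "V \<subseteq> U'" "A \<inter> X \<subseteq> g ` V" "\<forall>u\<in>V. G u \<subseteq> A" using Bs_cases[OF A(1)] by blast
      obtain u where u: "u \<in> V" "z = g u" using V(2) A(2,4) NX by blast
      have uU: "u \<in> U'" using u(1) V(1) by blast
      have "G u \<inter> S = {}" using V(3) u(1) A(3) by blast
      from G(4)[OF uU this] obtain p where p: "simple_path p" "last p = g u" "hd p \<in> S \<inter> D"
        "set p \<subseteq> insert (g u) D" "set p \<subseteq> P u" by blast
      have "p \<noteq> []" using p(1) by auto
      then have zp: "z \<in> set p" using p(2) u(2) last_in_set by metis
      have pz: "set p \<subseteq> insert z D" using p(4) u(2) by simp
      have "set p \<inter> N = {z}" using pz zp ND(1) A(4) by blast
      moreover have "set p \<subseteq> D \<union> N" using pz A(4) by blast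
      ultimately show ?thesis using p u(2) uU by blast
    qed
    then have "\<forall>z\<in>U2. \<exists>p. simple_path p \<and> last p = z \<and> hd p \<in> S \<inter> D \<and> set p \<subseteq> D \<union> N \<and> set p \<inter> N = {z} \<and>
        (\<exists>u\<in>U'. g u = z \<and> set p \<subseteq> P u)" by blast
    then obtain F where F: "\<forall>z\<in>U2. simple_path (F z) \<and> last (F z) = z \<and> hd (F z) \<in> S \<inter> D \<and>
        set (F z) \<subseteq> D \<union> N \<and> set (F z) \<inter> N = {z} \<and> (\<exists>u\<in>U'. g u = z \<and> set (F z) \<subseteq> P u)"
      by metis
    have lk: "linkage (D \<union> N) (S \<inter> D) N U2 F"
      unfolding linkage_def
    proof (intro conjI ballI impI)
      show "U2 \<subseteq> N" unfolding U2_def by blast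
      fix z z' assume z: "z \<in> U2" "z' \<in> U2" "z \<noteq> z'"
      obtain u where u: "u \<in> U'" "g u = z" "set (F z) \<subseteq> P u" using F z(1) by blast
      obtain u' where u': "u' \<in> U'" "g u' = z'" "set (F z') \<subseteq> P u'" using F z(2) by blast
      have "u \<noteq> u'" using u(2) u'(2) z(3) by blast
      then show "set (F z) \<inter> set (F z') = {}" using Pdisj[OF u(1) u'(1)] u(3) u'(3) by blast
    qed (use F in blast)+
    have "exploration S W D Cs"
      unfolding exploration_def N_def[symmetric] U2_def[symmetric]
    proof (intro conjI)
      show "D \<subseteq> W" "conn D" "path_model Cs" using Dp pmC by blast+
      show "Cs \<noteq> []" unfolding Cs_def by simp
      show "\<Union>(set Cs) \<subseteq> W - D"
      proof (rule Union_least)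
        fix B' assume "B' \<in> set Cs"
        then show "B' \<subseteq> W - D" using Bs_cases[of B'] CsBs by blast
      qed
      show "N \<subseteq> \<Union>(set Cs)"
      proof
        fix z assume z: "z \<in> N"
        then obtain B' where "B' \<in> set Bs" "z \<in> B'" using NX XBs by blast
        then show "z \<in> \<Union>(set Cs)" using Bspl(3) z unfolding Cs_def Bspl(1) by auto
      qed
      show "\<forall>A\<in>set Cs. \<forall>x\<in>A \<inter> N. \<forall>y\<in>A \<inter> N. x = y"
      proof (intro ballI)
        fix A x y assume h: "A \<in> set Cs" "x \<in> A \<inter> N" "y \<in> A \<inter> N"
        obtain V where V: "\<forall>x\<in>V. \<forall>y\<in>V. x = y" "A \<inter> X \<subseteq> g ` V" using Bs_cases[of A] h(1) CsBs by blast
        have "x \<in> g ` V" "y \<in> g ` V" using V(2) h(2,3) NX by blast+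
        then show "x = y" using V(1) by auto
      qed
      show "last Cs \<inter> N \<noteq> {}" using Bspl(2) unfolding Cs_def by simp
      show "hd Cs \<inter> S \<noteq> {}" using st(9) attach_superset[of "hd As" U' G] unfolding hdC by blast
      show "\<forall>A\<in>set Cs. A \<inter> S = {} \<longrightarrow> A \<inter> N \<noteq> {}"
      proof (intro ballI impI)
        fix A assume h: "A \<in> set Cs" "A \<inter> S = {}"
        obtain V where V: "V \<subseteq> U'" "\<forall>u\<in>V. G u \<subseteq> A" "V \<noteq> {}" using Bs_cases[of A] h CsBs by blast
        obtain u where u: "u \<in> V" using V(3) by blast
        have "u \<in> U'" "G u \<inter> S = {}" using u V h(2) by blast+
        then have "g u \<in> N" using G(4) by blast
        moreover have "g u \<in> A" using G(2)[OF \<open>u \<in> U'\<close>] V(2) u by blast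
        ultimately show "A \<inter> N \<noteq> {}" by blast
      qed
      show "\<exists>f. linkage (D \<union> N) (S \<inter> D) N U2 f" using lk by blast
    qed
    then show ?thesis using DC DC' by blast
  qed
  then show ?thesis using XW cards s(6) unfolding Z_def by blast
qed

section \<open>The elimination lemma\<close>

lemma rooted_path_1: "s \<in> W \<Longrightarrow> s \<in> S \<Longrightarrow> rooted_path S 1 W"
  using conn_singleton by (intro rooted_pathI[of "[{s}]"]) auto

lemma rooted_path_meets: "rooted_path S n W \<Longrightarrow> 0 < n \<Longrightarrow> S \<inter> W \<noteq> {}"
proof -
  assume "rooted_path S n W" "0 < n"
  then obtain Bs where Bs: "length Bs = n" "\<forall>B\<in>set Bs. B \<subseteq> W \<and> B \<inter> S \<noteq> {}"
    unfolding rooted_path_def by blast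
  then have "hd Bs \<in> set Bs" using \<open>0 < n\<close> by (cases Bs) auto
  then show ?thesis using Bs by blast
qed

lemma choose_two_Suc: "Suc l choose 2 = (l choose 2) + l"
  by (simp add: numeral_2_eq_2)

theorem eliminable_if_no_rooted_path:
  assumes "finite W" "conn W" "0 < n" "\<not> rooted_path S n W"
  shows "eliminable S (n choose 2) W"
  using assms
proof (induction n arbitrary: W rule: less_induct)
  case (less n)
  obtain l where n: "n = Suc l" using less.prems(3) by (cases n) auto
  show ?case
  proof (cases "l = 0 \<or> \<not> rooted_path S l W")
    case True
    show ?thesis
    proof (cases "l = 0")
      case True
      then have "W \<inter> S = {}" using less.prems(4) rooted_path_1[of _ W S] n by auto
      then show ?thesis by (rule eliminable_disjoint)
    next
      case False
      then have "eliminable S (l choose 2) W" using True less.IH[of l W] less.prems n by simp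
      then show ?thesis unfolding n choose_two_Suc by (rule eliminable_mono) simp
    qed
  next
    case False
    then have l: "0 < l" "rooted_path S l W" by auto
    have noSuc: "\<not> rooted_path S (Suc l) W" using less.prems(4) n by simp
    have IH: "eliminable S (m choose 2) D" if "0 < m" "m \<le> l" "\<not> rooted_path S m D" "conn D" "D \<subseteq> W" for m D
      using less.IH[of m D] that n less.prems(1) finite_subset by auto
    obtain s where s: "s \<in> W" "s \<in> S" using rooted_path_meets[OF l(2,1)] by blast
    \<comment> \<open>If deleting \<open>s\<close> destroys all rooted models with \<open>l\<close>
      branch sets, one deletion and the induction hypothesis suffice; otherwise \<open>s\<close>
      starts an exploration.\<close>
    show ?thesis
    proof (cases "\<exists>C\<in>comps (W - {s}). rooted_path S l C")
      case False
      have "eliminable S (l choose 2) D" if "D \<in> comps (W - {s})" for D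
        using IH[of l D] l(1) False that comps_conn[OF that] comps_subset[OF that] by blast
      then have "eliminable S ((l choose 2) + card {s}) W" using eliminable_delete[OF _ less.prems(2)] by blast
      then show ?thesis unfolding n choose_two_Suc using l(1) by (elim eliminable_mono) simp
    next
      case True
      then have "\<exists>C. (\<exists>As. exploration S W C As) \<and> rooted_path S l C"
        using exploration_init[OF less.prems(2) s] by blast
      then obtain C where C: "(\<exists>As. exploration S W C As) \<and> rooted_path S l C"
        and minC: "\<And>D. (\<exists>As. exploration S W D As) \<and> rooted_path S l D \<Longrightarrow> card C \<le> card D"
        using ex_has_least_nat[of "\<lambda>C. (\<exists>As. exploration S W C As) \<and> rooted_path S l C" _ card] by blast
      then obtain As where As: "exploration S W C As" by blast
      have SC: "S \<inter> C \<noteq> {}" using rooted_path_meets C l(1) by blast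
      have CW: "C \<subseteq> W" "conn C" using As by (simp_all add: exploration_def)
      define Z where "Z = neighbours W C"
      obtain X where X: "X \<subseteq> W" "card X \<le> l" "card X + card Z < 2 * l" "separates (C \<union> Z) X (S \<inter> C) Z"
        "\<forall>D\<in>comps (W - X). D \<inter> Z = {} \<longrightarrow> D \<inter> C \<noteq> {} \<longrightarrow> D \<subset> C \<and> (\<exists>As'. exploration S W D As')"
        using exploration_step[OF less.prems(1,2) As SC noSuc] unfolding Z_def[symmetric] by (elim exE conjE) (rule that)
      have finX: "finite X" using X(1) less.prems(1) finite_subset by blast
      have finZ: "finite Z" using less.prems(1) unfolding Z_def neighbours_def by simp
      \<comment> \<open>Joined with the model in \<open>C\<close>, a disjoint one with
        \<open>l - 1\<close> branch sets would give
        \<open>(l + 1) div 2 + (l + 2) div 2 = l + 1\<close> branch sets.\<close>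
      have disj: "\<not> rooted_path S m D" if "D \<inter> C = {}" "D \<subseteq> W" "0 < m" "l \<le> Suc m" for m D
      proof
        assume "rooted_path S m D"
        then have "rooted_path S (Suc l) W"
          by (rule rooted_path_combine[OF less.prems(1,2), of _ m D l C]) (use that C CW l in auto)
        then show False using noSuc by blast
      qed
      \<comment> \<open>The budget left after the deletion of \<open>X\<close>; it is at least
        \<open>l choose 2\<close> because \<open>card X \<le> l\<close>.\<close>
      define c where "c = (l choose 2) + l - card X"
      have cX: "c + card X = n choose 2" unfolding n choose_two_Suc c_def using X(2) by simp
      have "eliminable S c D" if D: "D \<in> comps (W - X)" for D
      proof (cases "rooted_path S l D")
        case False
        have "eliminable S (l choose 2) D"
          using IH[of l D] l(1) False comps_conn[OF D] comps_subset[OF D] by blast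
        then show ?thesis by (rule eliminable_mono) (use X(2) in \<open>simp add: c_def\<close>)
      next
        case True
        have DW: "D \<subseteq> W" "D \<inter> X = {}" "conn D" using comps_subset[OF D] comps_conn[OF D] by blast+
        have DC: "D \<inter> C \<noteq> {}" using disj[of D l] True DW l(1) by auto
        \<comment> \<open>A component \<open>D\<close> missing \<open>Z\<close> would be a smaller
          explorable set with \<open>l\<close> rooted branch sets, against the choice of
          \<open>C\<close>.\<close>
        have DZ: "D \<inter> Z \<noteq> {}"
        proof
          assume "D \<inter> Z = {}"
          then have "D \<subset> C" "card C \<le> card D" using X(5) D DC True minC[of D] by simp_all
          moreover have "finite C" using CW less.prems(1) finite_subset by blast
          ultimately show False using psubset_card_mono[of C D] by simp
        qed
        \<comment> \<open>This is \<open>l - 1\<close>, raised to \<open>1\<close> for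
          \<open>l = 1\<close> because the induction hypothesis wants a positive length; the cost
          \<open>1 choose 2\<close> is \<open>0\<close>.\<close>
        define m where "m = max 1 (l - 1)"
        have m: "0 < m" "m \<le> l" "l \<le> Suc m" using l(1) unfolding m_def by auto
        have "eliminable S (m choose 2) K" if K: "K \<in> comps (D - Z)" for K
        proof (cases "K \<inter> C = {}")
          case True
          have KW: "K \<subseteq> W" using comps_subset[OF K] DW(1) by blast
          show ?thesis using IH[OF m(1,2) disj[OF True KW m(1,3)] comps_conn[OF K] KW] .
        next
          case False
          have KD: "K \<subseteq> D" "conn K" "K \<inter> Z = {}" using comps_subset[OF K] comps_conn[OF K] by blast+
          have "\<not> touch C (W - Z - C)" unfolding touch_def Z_def using neighboursI E_sym by blast
          then have KC: "K \<subseteq> C" using conn_subset[of K C "W - Z"] KD DW False by blast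
          \<comment> \<open>The part \<open>K\<close> has a neighbour in \<open>Z\<close>, because
            \<open>D\<close> is connected and meets \<open>Z\<close>. As \<open>D\<close> avoids the
            separator \<open>X\<close>, no vertex of \<open>S\<close> can lie in
            \<open>K\<close>.\<close>
          have "touch K (D - K)"
            using DW(3) KD DZ conn_nonempty[OF KD(2)] unfolding conn_def by auto
          then obtain x y where xy: "x \<in> K" "y \<in> D - K" "(x, y) \<in> E" unfolding touch_def by blast
          then have yZ: "y \<in> Z" using comps_closed[OF K xy(1,3)] by blast
          have "conn (insert y K)" using conn_insert[OF KD(2) xy(1,3)] .
          then have "insert y K \<inter> (S \<inter> C) = {}"
            using separatesD[OF X(4), of "insert y K"] KC yZ xy DW(2) KD(1) by blast
          then show ?thesis using KC by (intro eliminable_disjoint) blast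
        qed
        then have "eliminable S ((m choose 2) + card Z) D" using eliminable_delete[OF finZ DW(3)] by blast
        \<comment> \<open>For \<open>m = l - 1\<close>, the bound
          \<open>card X + card Z \<le> 2 * l - 1\<close> gives the total
          \<open>(m choose 2) + m + l\<close>, which is \<open>(l choose 2) + l\<close>.\<close>
        moreover have "(m choose 2) + card Z \<le> c"
        proof (cases "l = 1")
          case True
          then show ?thesis using X(3) unfolding m_def c_def by (simp add: binomial_eq_0)
        next
          case False
          then have "l = Suc m" using l(1) unfolding m_def by auto
          then have "l choose 2 = (m choose 2) + m" using choose_two_Suc by simp
          then show ?thesis using X(3) \<open>l = Suc m\<close> unfolding c_def by simp
        qed
        ultimately show ?thesis by (rule eliminable_mono)
      qed
      then have "eliminable S (c + card X) W" using eliminable_delete[OF finX less.prems(2)] by blast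
      then show ?thesis using cX by simp
    qed
  qed
qed

subsection \<open>Elimination forests and layerings\<close>

text \<open>A rooted forest on \<open>T\<close> is given by the list \<open>p v\<close> of vertices on the path from a root to \<open>v\<close>.\<close>

definition tree_paths :: "'a set \<Rightarrow> ('a \<Rightarrow> 'a list) \<Rightarrow> bool" where
  "tree_paths T p \<longleftrightarrow> (\<forall>v\<in>T. p v \<noteq> [] \<and> last (p v) = v \<and> distinct (p v) \<and> set (p v) \<subseteq> T \<and>
     (\<forall>u\<in>set (p v). \<exists>r. p v = p u @ r))"

definition comparable :: "('a \<Rightarrow> 'a list) \<Rightarrow> 'a \<Rightarrow> 'a \<Rightarrow> bool" where
  "comparable p u v \<longleftrightarrow> u \<in> set (p v) \<or> v \<in> set (p u)"

lemma tree_pathsD: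
  assumes "tree_paths T p" "v \<in> T"
  shows "p v \<noteq> []" "last (p v) = v" "distinct (p v)" "set (p v) \<subseteq> T" "v \<in> set (p v)"
    "u \<in> set (p v) \<Longrightarrow> \<exists>r. p v = p u @ r"
proof -
  show *: "p v \<noteq> []" "last (p v) = v" "distinct (p v)" "set (p v) \<subseteq> T"
    "u \<in> set (p v) \<Longrightarrow> \<exists>r. p v = p u @ r"
    using assms unfolding tree_paths_def by blast+
  show "v \<in> set (p v)" using last_in_set[OF *(1)] *(2) by simp
qed

text \<open>The forest on \<open>U D\<close> is hung below the last vertex of \<open>r D\<close>, a
  root path of \<open>T\<close>; an empty \<open>r D\<close> leaves its roots as roots. Prefixes of
  the composed paths are again of the required form.\<close>

lemma tree_paths_glue:
  assumes "tree_paths T p"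
    and U: "\<And>D. D \<in> \<D> \<Longrightarrow> tree_paths (U D) (q D) \<and> U D \<subseteq> D \<and> D \<inter> T = {} \<and> r D \<in> insert [] (p ` T)"
    and disj: "\<And>D D'. D \<in> \<D> \<Longrightarrow> D' \<in> \<D> \<Longrightarrow> D \<noteq> D' \<Longrightarrow> D \<inter> D' = {}"
  shows "\<exists>p'. tree_paths (T \<union> (\<Union>D\<in>\<D>. U D)) p' \<and> (\<forall>v\<in>T. p' v = p v) \<and>
    (\<forall>D\<in>\<D>. \<forall>v\<in>U D. p' v = r D @ q D v)"
proof -
  define c where "c v = (SOME D. D \<in> \<D> \<and> v \<in> D)" for v
  have c: "c v = D" if "D \<in> \<D>" "v \<in> D" for v D
  proof -
    have "c v \<in> \<D> \<and> v \<in> c v" unfolding c_def by (rule someI[of _ D]) (use that in blast)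
    then show ?thesis using disj[of "c v" D] that by blast
  qed
  define p' where "p' v = (if v \<in> T then p v else r (c v) @ q (c v) v)" for v
  have pT: "p' v = p v" if "v \<in> T" for v using that unfolding p'_def by simp
  have pU: "p' v = r D @ q D v" if "D \<in> \<D>" "v \<in> U D" for D v
  proof -
    have "v \<in> D" "v \<notin> T" using U[OF that(1)] that(2) by blast+
    then show ?thesis unfolding p'_def using c[OF that(1)] by simp
  qed
  have "tree_paths (T \<union> (\<Union>D\<in>\<D>. U D)) p'"
    unfolding tree_paths_def
  proof (intro ballI)
    fix v assume "v \<in> T \<union> (\<Union>D\<in>\<D>. U D)"
    then consider "v \<in> T" | D where "D \<in> \<D>" "v \<in> U D" by blast
    then show "p' v \<noteq> [] \<and> last (p' v) = v \<and> distinct (p' v) \<and> set (p' v) \<subseteq> T \<union> (\<Union>D\<in>\<D>. U D) \<and>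
     (\<forall>u\<in>set (p' v). \<exists>r. p' v = p' u @ r)"
    proof cases
      case 1
      note t = tree_pathsD[OF assms(1) 1]
      have "\<exists>r. p' v = p' u @ r" if "u \<in> set (p' v)" for u
        using that t(4) t(6)[of u] pT[of u] pT[OF 1] by auto
      then show ?thesis using t pT[OF 1] by auto
    next
      case (2 D)
      note UD = U[OF 2(1)]
      have tq: "tree_paths (U D) (q D)" using UD by blast
      note t = tree_pathsD[OF tq 2(2)]
      have pv: "p' v = r D @ q D v" using pU[OF 2] .
      have rT: "set (r D) \<subseteq> T \<and> distinct (r D) \<and> (\<forall>u\<in>set (r D). \<exists>s. r D = p u @ s)"
      proof (cases "r D = []")
        case False
        then obtain x where x: "x \<in> T" "r D = p x" using UD by blast
        show ?thesis using tree_pathsD[OF assms(1) x(1)] x(2) by simp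
      qed simp
      have "set (r D) \<inter> set (q D v) = {}" using rT t(4) UD by blast
      moreover have "\<exists>s. p' v = p' u @ s" if u: "u \<in> set (p' v)" for u
      proof (cases "u \<in> set (r D)")
        case True
        then have "u \<in> T" using rT by blast
        moreover obtain s where "r D = p u @ s" using rT True by blast
        ultimately show ?thesis using pv pT[of u] by simp
      next
        case False
        then have uq: "u \<in> set (q D v)" using u pv by simp
        then have "u \<in> U D" using t(4) by blast
        then have "p' u = r D @ q D u" using pU 2(1) by blast
        moreover obtain s where "q D v = q D u @ s" using t(6)[OF uq] by blast
        ultimately show ?thesis using pv by simp
      qed
      moreover have "set (p' v) \<subseteq> T \<union> (\<Union>D\<in>\<D>. U D)" using pv rT t(4) 2(1) by auto
      ultimately show ?thesis using t(1-3) rT pv by auto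
    qed
  qed
  then show ?thesis using pT pU by blast
qed

text \<open>This is an elimination forest of depth at most \<open>b\<close> for the torso of
  \<open>T\<close>: vertices of \<open>T\<close> attached to the same component of
  \<open>W - T\<close> count as adjacent. This lets each such component hang below one root path
  later.\<close>

definition partial_forest :: "'a set \<Rightarrow> 'a set \<Rightarrow> 'a set \<Rightarrow> ('a \<Rightarrow> 'a list) \<Rightarrow> nat \<Rightarrow> bool" where
  "partial_forest S W T p b \<longleftrightarrow> T \<subseteq> W \<and> W \<inter> S \<subseteq> T \<and> tree_paths T p \<and> (\<forall>v\<in>T. length (p v) \<le> b) \<and>
     (\<forall>u\<in>T. \<forall>v\<in>T. (u, v) \<in> E \<or> (\<exists>D\<in>comps (W - T). touch {u} D \<and> touch {v} D) \<longrightarrow> comparable p u v)"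

lemma partial_forest_empty: "W \<inter> S = {} \<Longrightarrow> partial_forest S W {} p b"
  unfolding partial_forest_def tree_paths_def by simp

text \<open>The deleted vertex becomes the root above the forests of the components. A component of
  \<open>W - T\<close> lies within one of these, so its neighbours other than the root do
  too.\<close>

lemma partial_forest_eliminable: "eliminable S b W \<Longrightarrow> \<exists>T p. partial_forest S W T p b"
proof (induction b arbitrary: W)
  case 0
  then show ?case using partial_forest_empty[of W S] unfolding eliminable.simps by blast
next
  case (Suc b)
  show ?case
  proof (cases "W \<inter> S = {}")
    case True
    then show ?thesis using partial_forest_empty by blast
  next
    case False
    then obtain x where x: "x \<in> W" "\<forall>D\<in>comps (W - {x}). eliminable S b D"
      using Suc.prems unfolding eliminable.simps by blast
    define \<D> where "\<D> = comps (W - {x})"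
    have "\<forall>D\<in>\<D>. \<exists>T p. partial_forest S D T p b" using Suc.IH x(2) unfolding \<D>_def by blast
    then obtain U q where Uq: "\<forall>D\<in>\<D>. partial_forest S D (U D) (q D) b" by metis
    have U: "U D \<subseteq> D" "D \<inter> S \<subseteq> U D" "tree_paths (U D) (q D)" "\<forall>v\<in>U D. length (q D v) \<le> b"
      "\<forall>u\<in>U D. \<forall>v\<in>U D. (u, v) \<in> E \<or> (\<exists>K\<in>comps (D - U D). touch {u} K \<and> touch {v} K) \<longrightarrow> comparable (q D) u v"
      if "D \<in> \<D>" for D
      using bspec[OF Uq that] unfolding partial_forest_def by blast+
    have DW: "D \<subseteq> W - {x}" if "D \<in> \<D>" for D using that comps_subset unfolding \<D>_def by blast
    have disj: "D \<inter> D' = {}" if "D \<in> \<D>" "D' \<in> \<D>" "D \<noteq> D'" for D D'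
      using comps_disjoint that unfolding \<D>_def by blast
    have closed: "e \<in> D" if "D \<in> \<D>" "a \<in> D" "(a, e) \<in> E" "e \<in> W - {x}" for D a e
      using comps_closed that unfolding \<D>_def by blast
    have "tree_paths {x} (\<lambda>v. [v])" unfolding tree_paths_def by simp
    then obtain p where p: "tree_paths ({x} \<union> (\<Union>D\<in>\<D>. U D)) p" "\<forall>v\<in>{x}. p v = [v]"
      "\<forall>D\<in>\<D>. \<forall>v\<in>U D. p v = [x] @ q D v"
      using tree_paths_glue[of "{x}" "\<lambda>v. [v]" \<D> U q "\<lambda>_. [x]"] U(1,3) DW disj by blast
    define T where "T = {x} \<union> (\<Union>D\<in>\<D>. U D)"
    have inU: "\<exists>D\<in>\<D>. v \<in> U D \<and> v \<in> D" if "v \<in> T" "v \<noteq> x" for v using that U(1) unfolding T_def by blast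
    have "partial_forest S W T p (Suc b)"
      unfolding partial_forest_def
    proof (intro conjI ballI impI)
      show "T \<subseteq> W" using x(1) U(1) DW unfolding T_def by blast
      show "W \<inter> S \<subseteq> T"
      proof
        fix s assume s: "s \<in> W \<inter> S"
        show "s \<in> T"
        proof (cases "s = x")
          case False
          then obtain D where D: "D \<in> \<D>" "s \<in> D" using s comps_cover[of s "W - {x}"] unfolding \<D>_def by blast
          then have "s \<in> U D" using U(2) s by blast
          then show ?thesis using D unfolding T_def by blast
        qed (simp add: T_def)
      qed
      show "tree_paths T p" using p unfolding T_def by blast
      show "length (p v) \<le> Suc b" if v: "v \<in> T" for v
      proof (cases "v = x")
        case True
        then show ?thesis using p(2) by simp
      next
        case False
        then obtain D where "D \<in> \<D>" "v \<in> U D" using inU v by blast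
        then show ?thesis using p(3) U(4) by simp
      qed
      fix u v assume uv: "u \<in> T" "v \<in> T"
        and lk: "(u, v) \<in> E \<or> (\<exists>K\<in>comps (W - T). touch {u} K \<and> touch {v} K)"
      have xin: "x \<in> set (p w)" if w: "w \<in> T" for w
      proof (cases "w = x")
        case True
        then show ?thesis using p(2) by simp
      next
        case False
        then obtain D where "D \<in> \<D>" "w \<in> U D" using inU w by blast
        then show ?thesis using p(3) by simp
      qed
      show "comparable p u v"
      proof (cases "u = x \<or> v = x")
        case True
        then show ?thesis using xin uv unfolding comparable_def by blast
      next
        case False
        then obtain D1 D2 where D: "D1 \<in> \<D>" "u \<in> U D1" "u \<in> D1" "D2 \<in> \<D>" "v \<in> U D2" "v \<in> D2"
          using inU uv by metis
        have "D1 = D2 \<and> comparable (q D1) u v"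
          using lk
        proof
          assume e: "(u, v) \<in> E"
          have "v \<in> D1" using closed[OF D(1,3) e] DW[OF D(4)] D(6) by blast
          then have "D1 = D2" using disj[OF D(1,4)] D(6) by blast
          then show ?thesis using U(5)[OF D(1)] D e by blast
        next
          assume "\<exists>K\<in>comps (W - T). touch {u} K \<and> touch {v} K"
          then obtain K where K: "K \<in> comps (W - T)" "touch {u} K" "touch {v} K" by blast
          have KW: "K \<subseteq> W - {x}" "K \<inter> T = {}" using comps_subset[OF K(1)] unfolding T_def by blast+
          obtain D3 where D3: "D3 \<in> \<D>" "K \<subseteq> D3"
            using conn_comps_superset[OF comps_conn[OF K(1)] KW(1)] unfolding \<D>_def by blast
          have "w \<in> D3" if w: "touch {w} K" "w \<in> W - {x}" for w
            using w D3 closed[OF D3(1)] E_sym unfolding touch_def by blast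
          then have "u \<in> D3" "v \<in> D3" using K(2,3) DW D by blast+
          then have eq: "D1 = D3" "D2 = D3" using disj D D3(1) by blast+
          \<comment> \<open>Within \<open>D3\<close> the set \<open>T\<close> consists of
            \<open>U D3\<close> only, so \<open>K\<close> is also a component there and the
            condition for \<open>D3\<close> applies.\<close>
          have "K \<in> comps (D3 - U D3)"
          proof (rule comps_I)
            show "K \<subseteq> D3 - U D3" using D3 KW(2) unfolding T_def by blast
            show "conn K" using comps_conn K(1) by blast
            fix a e assume ae: "a \<in> K" "e \<in> D3 - U D3" "(a, e) \<in> E"
            have "e \<notin> T"
            proof
              assume "e \<in> T"
              then obtain D where "D \<in> \<D>" "e \<in> U D" "e \<in> D" using inU[of e] ae(2) DW[OF D3(1)] by blast
              then show False using disj[of D D3] D3(1) ae(2) by blast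
            qed
            then show "e \<in> K" using comps_closed[OF K(1) ae(1,3)] ae(2) DW[OF D3(1)] by blast
          qed
          then show ?thesis using U(5)[OF D3(1)] D eq K(2,3) by blast
        qed
        then show ?thesis using p(3) D unfolding comparable_def by fastforce
      qed
    qed
    then show ?thesis by blast
  qed
qed

text \<open>Deleting vertices from all root paths moves the orphans to their nearest surviving
  ancestors and preserves prefixes.\<close>

lemma tree_paths_filter:
  assumes "tree_paths T p"
  shows "tree_paths (T - Y) (\<lambda>v. filter (\<lambda>u. u \<notin> Y) (p v))"
  unfolding tree_paths_def
proof (intro ballI)
  fix v assume v: "v \<in> T - Y"
  let ?f = "\<lambda>v. filter (\<lambda>u. u \<notin> Y) (p v)"
  have vT: "v \<in> T" using v by blast
  note t = tree_pathsD[OF assms vT]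
  have "p v = butlast (p v) @ [v]" using t(1,2) append_butlast_last_id[of "p v"] by simp
  then have "?f v = filter (\<lambda>u. u \<notin> Y) (butlast (p v)) @ [v]" using v by (metis DiffD2 filter.simps filter_append)
  then have "?f v \<noteq> []" "last (?f v) = v" by simp_all
  moreover have "\<exists>r. ?f v = ?f u @ r" if u: "u \<in> set (?f v)" for u
  proof -
    obtain r where "p v = p u @ r" using t(6)[of u] u by auto
    then show ?thesis by simp
  qed
  moreover have "distinct (?f v)" "set (?f v) \<subseteq> T - Y" using t(3,4) by auto
  ultimately show "?f v \<noteq> [] \<and> last (?f v) = v \<and> distinct (?f v) \<and> set (?f v) \<subseteq> T - Y \<and>
     (\<forall>u\<in>set (?f v). \<exists>r. ?f v = ?f u @ r)"
    by blast
qed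

text \<open>
  If the complement of \<open>D\<close> were disconnected, then a part of it avoiding \<open>K - C\<close> could be merged
  with \<open>D\<close>, and the forest would not be minimal.
\<close>

lemma minimal_partial_forest_conn:
  assumes "conn K" "C \<subseteq> K" "conn (K - C)" "finite K"
    and S: "S = {c \<in> C. \<exists>w\<in>K - C. (c, w) \<in> E}"
    and pf: "partial_forest S C T p b"
    and min: "\<And>T' p'. partial_forest S C T' p' b \<Longrightarrow> card T \<le> card T'"
    and D: "D \<in> comps (C - T)"
  shows "conn (K - D)"
proof -
  have T: "T \<subseteq> C" "C \<inter> S \<subseteq> T" "tree_paths T p" "\<forall>v\<in>T. length (p v) \<le> b"
      "\<forall>u\<in>T. \<forall>v\<in>T. (u, v) \<in> E \<or> (\<exists>D\<in>comps (C - T). touch {u} D \<and> touch {v} D) \<longrightarrow> comparable p u v"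
    using pf by (simp_all add: partial_forest_def)
  have DC: "D \<subseteq> C - T" "conn D" using comps_subset[OF D] comps_conn[OF D] .
  have "K - C \<subseteq> K - D" using DC by blast
  then obtain Y0 where Y0: "Y0 \<in> comps (K - D)" "K - C \<subseteq> Y0" using conn_comps_superset[OF assms(3)] by blast
  show ?thesis
  proof (cases "Y0 = K - D")
    case True
    then show ?thesis using comps_conn[OF Y0(1)] by simp
  next
    case False
    then obtain y where y: "y \<in> K - D" "y \<notin> Y0" using comps_subset[OF Y0(1)] by blast
    then obtain Y where Y: "Y \<in> comps (K - D)" "y \<in> Y" using comps_cover by blast
    have "Y \<inter> Y0 = {}" using comps_disjoint[OF Y(1) Y0(1)] Y(2) y(2) by blast
    then have YC: "Y \<subseteq> C - D" using comps_subset[OF Y(1)] Y0(2) by blast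
    have YS: "Y \<inter> S = {}"
    proof -
      have False if s: "s \<in> Y" "w \<in> K - C" "(s, w) \<in> E" for s w
        using comps_closed[OF Y(1) s(1,3)] s(2) YC DC by blast
      then show ?thesis unfolding S by blast
    qed
    have cY: "conn Y" using comps_conn[OF Y(1)] .
    have "touch Y D"
    proof -
      have "touch Y (K - Y)"
        using assms(1) YC assms(2) conn_nonempty[OF cY] conn_nonempty[OF DC(2)] DC(1) unfolding conn_def by blast
      then show ?thesis using comps_closed[OF Y(1)] unfolding touch_def by blast
    qed
    then have cDY: "conn (D \<union> Y)" using conn_Un[OF DC(2) cY] touch_sym by blast
    \<comment> \<open>Otherwise the connected set \<open>D \<union> Y\<close> would contradict that
      \<open>D\<close> is a component of \<open>C - T\<close>.\<close>
    have YT: "Y \<inter> T \<noteq> {}"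
    proof
      assume "Y \<inter> T = {}"
      then have "D \<union> Y \<subseteq> D" using comps_max[OF D cDY] YC DC conn_nonempty[OF DC(2)] by blast
      then show False using YC Y(2) by blast
    qed
    define T' where "T' = T - Y"
    define p' where "p' v = filter (\<lambda>u. u \<notin> Y) (p v)" for v
    have "partial_forest S C T' p' b"
      unfolding partial_forest_def
    proof (intro conjI ballI impI)
      show "T' \<subseteq> C" "C \<inter> S \<subseteq> T'" using T(1,2) YS unfolding T'_def by blast+
      show "tree_paths T' p'" using tree_paths_filter[OF T(3)] unfolding T'_def p'_def .
      show "length (p' v) \<le> b" if "v \<in> T'" for v
        using T(4) that le_trans[OF length_filter_le] unfolding p'_def T'_def by blast
      fix u v assume uv: "u \<in> T'" "v \<in> T'"
        and lk: "(u, v) \<in> E \<or> (\<exists>K\<in>comps (C - T'). touch {u} K \<and> touch {v} K)"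
      have "(u, v) \<in> E \<or> (\<exists>D\<in>comps (C - T). touch {u} D \<and> touch {v} D)"
        using lk
      proof
        assume "\<exists>K\<in>comps (C - T'). touch {u} K \<and> touch {v} K"
        then obtain L where L: "L \<in> comps (C - T')" "touch {u} L" "touch {v} L" by blast
        show ?thesis
        proof (cases "L \<inter> (D \<union> Y) = {}")
          case True
          have "L \<in> comps (C - T)"
          proof (rule comps_I)
            show "L \<subseteq> C - T" using comps_subset[OF L(1)] True unfolding T'_def by blast
            show "conn L" using comps_conn[OF L(1)] .
            show "e \<in> L" if "a \<in> L" "e \<in> C - T" "(a, e) \<in> E" for a e
              using comps_closed[OF L(1) that(1,3)] that(2) unfolding T'_def by blast
          qed
          then show ?thesis using L by blast
        next
          case False
          have "\<not> touch (D \<union> Y) ((C - T') - (D \<union> Y))"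
            using comps_closed[OF D] comps_closed[OF Y(1)] assms(2) unfolding touch_def T'_def by blast
          then have LDY: "L \<subseteq> D \<union> Y" using conn_subset[OF comps_conn[OF L(1)] False] comps_subset[OF L(1)] by blast
          \<comment> \<open>The merged part acquires no new neighbours: an edge from
            \<open>Y\<close> to \<open>w\<close> would put \<open>w\<close> into the component
            \<open>Y\<close> of \<open>K - D\<close>.\<close>
          have "touch {w} D" if w: "w \<in> T'" "touch {w} L" for w
          proof -
            obtain c where c: "c \<in> D \<union> Y" "(c, w) \<in> E" using w(2) LDY E_sym unfolding touch_def by blast
            have "w \<in> K - D" "w \<notin> Y" using w(1) T(1) DC assms(2) unfolding T'_def by blast+
            then have "c \<notin> Y" using comps_closed[OF Y(1) _ c(2)] by blast
            then show ?thesis using c E_sym unfolding touch_def by blast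
          qed
          then show ?thesis using L uv D by blast
        qed
      qed blast
      then have "comparable p u v" using T(5) uv unfolding T'_def by blast
      then show "comparable p' u v" using uv unfolding comparable_def p'_def T'_def by auto
    qed
    then have "card T \<le> card T'" by (rule min)
    moreover have "finite T" using finite_subset[OF T(1) finite_subset[OF assms(2,4)]] .
    then have "card T' < card T" by (rule psubset_card_mono) (use YT in \<open>auto simp: T'_def\<close>)
    ultimately show ?thesis by simp
  qed
qed

section \<open>Layered forests and their recursive construction\<close>

definition layered_forest :: "'a set \<Rightarrow> nat \<Rightarrow> ('a \<Rightarrow> 'a list) \<Rightarrow> ('a \<Rightarrow> nat) \<Rightarrow> bool" where
  "layered_forest W B p lay \<longleftrightarrow> tree_paths W p \<and>
     (\<forall>u\<in>W. \<forall>v\<in>W. (u, v) \<in> E \<longrightarrow> comparable p u v \<and> lay u \<le> Suc (lay v)) \<and>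
     (\<forall>v\<in>W. \<forall>i. card {u \<in> set (p v). lay u = i} \<le> B)"

text \<open>Pairwise comparable vertices form a chain; the longest of their root paths contains them
  all.\<close>

lemma deepest_common:
  assumes "tree_paths T p" "N \<subseteq> T" "finite N" "\<And>u v. u \<in> N \<Longrightarrow> v \<in> N \<Longrightarrow> comparable p u v"
  shows "\<exists>r. r \<in> insert [] (p ` T) \<and> N \<subseteq> set r"
proof (cases "N = {}")
  case False
  have "\<exists>t. t \<in> N \<and> (\<forall>u. u \<in> N \<longrightarrow> length (p u) \<le> length (p t))"
  proof -
    have fin: "finite ((\<lambda>t. length (p t)) ` N)" "(\<lambda>t. length (p t)) ` N \<noteq> {}" using assms(3) False by auto
    obtain t where "t \<in> N" "length (p t) = Max ((\<lambda>t. length (p t)) ` N)" using Max_in[OF fin] by auto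
    then show ?thesis using Max_ge[OF fin(1)] by auto
  qed
  then obtain t where t: "t \<in> N" "\<And>u. u \<in> N \<Longrightarrow> length (p u) \<le> length (p t)" by blast
  have "u \<in> set (p t)" if u: "u \<in> N" for u
  proof (rule ccontr)
    assume n: "u \<notin> set (p t)"
    have uT: "u \<in> T" and tT: "t \<in> T" using u t assms(2) by blast+
    have "t \<in> set (p u)" using assms(4)[OF u t(1)] n unfolding comparable_def by blast
    then obtain r where "p u = p t @ r" using tree_pathsD(6)[OF assms(1) uT] by blast
    then have "p u = p t" using t(2)[OF u] by simp
    then show False using n tree_pathsD(5)[OF assms(1) uT] by simp
  qed
  then show ?thesis using t(1) assms(2) by blast
next
  case True
  then show ?thesis by (intro exI[of _ "[]"]) simp
qed

text \<open>\<open>T\<close> becomes layer \<open>0\<close> and the layers of each component of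
  \<open>C - T\<close> move up by one. Neighbours of \<open>T\<close> had layer \<open>0\<close>
  there, so edges to \<open>T\<close> join layers \<open>0\<close> and \<open>1\<close>. The
  vertices of \<open>T\<close> touching a component lie on one root path, below which its forest is
  hung. Hence a root path meets layer \<open>0\<close> inside \<open>T\<close> and the later layers
  inside one component.\<close>

lemma layered_forest_glue:
  assumes "finite C" "T \<subseteq> C" "tree_paths T p" "\<And>v. v \<in> T \<Longrightarrow> length (p v) \<le> B"
    and cmp: "\<And>u v. u \<in> T \<Longrightarrow> v \<in> T \<Longrightarrow> (u, v) \<in> E \<or> (\<exists>D\<in>comps (C - T). touch {u} D \<and> touch {v} D) \<Longrightarrow>
           comparable p u v"
    and sub: "\<And>D. D \<in> comps (C - T) \<Longrightarrow> \<exists>q \<mu>. layered_forest D B q \<mu> \<and> (\<forall>v\<in>D. (\<exists>u\<in>T. (v, u) \<in> E) \<longrightarrow> \<mu> v = 0)"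
  shows "\<exists>p' lay. layered_forest C B p' lay \<and> (\<forall>v\<in>T. lay v = 0)"
proof -
  define \<D> where "\<D> = comps (C - T)"
  have "\<forall>D\<in>\<D>. \<exists>q \<mu>. layered_forest D B q \<mu> \<and> (\<forall>v\<in>D. (\<exists>u\<in>T. (v, u) \<in> E) \<longrightarrow> \<mu> v = 0)"
    using sub unfolding \<D>_def by blast
  then obtain q \<mu> where qm: "\<forall>D\<in>\<D>. layered_forest D B (q D) (\<mu> D) \<and> (\<forall>v\<in>D. (\<exists>u\<in>T. (v, u) \<in> E) \<longrightarrow> \<mu> D v = 0)"
    by metis
  have q: "tree_paths D (q D)" "\<forall>u\<in>D. \<forall>v\<in>D. (u, v) \<in> E \<longrightarrow> comparable (q D) u v \<and> \<mu> D u \<le> Suc (\<mu> D v)"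
    "\<forall>v\<in>D. \<forall>i. card {u \<in> set (q D v). \<mu> D u = i} \<le> B" "\<forall>v\<in>D. (\<exists>u\<in>T. (v, u) \<in> E) \<longrightarrow> \<mu> D v = 0"
    if "D \<in> \<D>" for D using qm that by (simp_all add: layered_forest_def)
  have finT: "finite T" using assms(1,2) finite_subset by blast
  have "\<forall>D\<in>\<D>. \<exists>r. r \<in> insert [] (p ` T) \<and> {t \<in> T. touch {t} D} \<subseteq> set r"
  proof
    fix D assume D: "D \<in> \<D>"
    show "\<exists>r. r \<in> insert [] (p ` T) \<and> {t \<in> T. touch {t} D} \<subseteq> set r"
    proof (rule deepest_common[OF assms(3)])
      show "{t \<in> T. touch {t} D} \<subseteq> T" "finite {t \<in> T. touch {t} D}" using finT by auto
      show "comparable p u v" if "u \<in> {t \<in> T. touch {t} D}" "v \<in> {t \<in> T. touch {t} D}" for u v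
        using cmp[of u v] that D unfolding \<D>_def by blast
    qed
  qed
  then obtain r where r: "\<forall>D\<in>\<D>. r D \<in> insert [] (p ` T) \<and> {t \<in> T. touch {t} D} \<subseteq> set (r D)" by metis
  have DC: "D \<subseteq> C - T" if "D \<in> \<D>" for D using comps_subset that unfolding \<D>_def by blast
  have disj: "D \<inter> D' = {}" if "D \<in> \<D>" "D' \<in> \<D>" "D \<noteq> D'" for D D'
    using comps_disjoint that unfolding \<D>_def by blast
  have cover: "\<exists>D\<in>\<D>. v \<in> D" if "v \<in> C" "v \<notin> T" for v
    using comps_cover[of v "C - T"] that unfolding \<D>_def by blast
  have "\<exists>p'. tree_paths (T \<union> (\<Union>D\<in>\<D>. D)) p' \<and> (\<forall>v\<in>T. p' v = p v) \<and> (\<forall>D\<in>\<D>. \<forall>v\<in>D. p' v = r D @ q D v)"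
    by (rule tree_paths_glue[OF assms(3) _ disj]) (use q(1) DC r in blast)+
  then obtain p' where p': "tree_paths (T \<union> (\<Union>D\<in>\<D>. D)) p'" "\<forall>v\<in>T. p' v = p v" "\<forall>D\<in>\<D>. \<forall>v\<in>D. p' v = r D @ q D v"
    by blast
  have TC: "T \<union> (\<Union>D\<in>\<D>. D) = C" using assms(2) DC cover by blast
  define c where "c v = (SOME D. D \<in> \<D> \<and> v \<in> D)" for v
  have c: "c v = D" if "D \<in> \<D>" "v \<in> D" for v D
  proof -
    have "c v \<in> \<D> \<and> v \<in> c v" unfolding c_def by (rule someI[of _ D]) (use that in blast)
    then show ?thesis using disj[of "c v" D] that by blast
  qed
  define lay where "lay v = (if v \<in> T then 0 else Suc (\<mu> (c v) v))" for v
  have lT: "lay v = 0" if "v \<in> T" for v using that unfolding lay_def by simp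
  have lD: "lay v = Suc (\<mu> D v)" if "D \<in> \<D>" "v \<in> D" for v D
    using DC[OF that(1)] that c[OF that] unfolding lay_def by auto
  have rlen: "set (r D) \<subseteq> T \<and> card (set (r D)) \<le> B" if D: "D \<in> \<D>" for D
  proof (cases "r D = []")
    case False
    then obtain t where t: "t \<in> T" "r D = p t" using r D by blast
    then show ?thesis
      using assms(4)[OF t(1)] card_length[of "p t"] tree_pathsD(4)[OF assms(3) t(1)] by simp
  qed simp
  have edgeTD: "comparable p' u v \<and> lay u = 0 \<and> lay v = 1" if h: "u \<in> T" "D \<in> \<D>" "v \<in> D" "(u, v) \<in> E" for u v D
  proof -
    have "u \<in> set (r D)" using r h unfolding touch_def by blast
    moreover have "\<mu> D v = 0" using q(4)[OF h(2)] h E_sym by blast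
    ultimately show ?thesis using lT[OF h(1)] lD[OF h(2,3)] p'(3) h unfolding comparable_def by auto
  qed
  have "layered_forest C B p' lay"
    unfolding layered_forest_def
  proof (intro conjI ballI allI impI)
    show "tree_paths C p'" using p'(1) TC by simp
  next
    fix u v assume uv: "u \<in> C" "v \<in> C" "(u, v) \<in> E"
    have "comparable p' u v \<and> lay u \<le> Suc (lay v)"
    proof (cases "u \<in> T")
      case True
      show ?thesis
      proof (cases "v \<in> T")
        case True
        then have "comparable p u v" using cmp[of u v] \<open>u \<in> T\<close> uv(3) by blast
        then show ?thesis using p'(2) True \<open>u \<in> T\<close> lT unfolding comparable_def by simp
      next
        case False
        then obtain D where "D \<in> \<D>" "v \<in> D" using cover uv by blast
        then show ?thesis using edgeTD[OF \<open>u \<in> T\<close> _ _ uv(3)] by simp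
      qed
    next
      case False
      then obtain D where D: "D \<in> \<D>" "u \<in> D" using cover uv by blast
      show ?thesis
      proof (cases "v \<in> T")
        case True
        then show ?thesis using edgeTD[OF True D E_sym[OF uv(3)]] unfolding comparable_def by auto
      next
        case False
        then have "v \<in> D" using comps_closed[of D "C - T" u v] D uv unfolding \<D>_def by blast
        then have "comparable (q D) u v \<and> \<mu> D u \<le> Suc (\<mu> D v)" using q(2)[OF D(1)] D(2) uv(3) by blast
        then show ?thesis using lD[OF D] lD[OF D(1) \<open>v \<in> D\<close>] p'(3) D \<open>v \<in> D\<close> unfolding comparable_def by auto
      qed
    qed
    then show "comparable p' u v" "lay u \<le> Suc (lay v)" by blast+
  next
    fix v i assume v: "v \<in> C"
    show "card {u \<in> set (p' v). lay u = i} \<le> B"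
    proof (cases "v \<in> T")
      case True
      have "card {u \<in> set (p' v). lay u = i} \<le> card (set (p v))"
        using p'(2) True by (intro card_mono) auto
      then show ?thesis using assms(4)[OF True] card_length[of "p v"] by simp
    next
      case False
      then obtain D where D: "D \<in> \<D>" "v \<in> D" using cover v by blast
      have pv: "p' v = r D @ q D v" using p'(3) D by blast
      have qD: "set (q D v) \<subseteq> D" using tree_pathsD(4)[OF q(1)[OF D(1)] D(2)] .
      show ?thesis
      proof (cases i)
        case 0
        have "{u \<in> set (p' v). lay u = i} \<subseteq> set (r D)" using pv qD lD[OF D(1)] 0 by auto
        then show ?thesis using card_mono[of "set (r D)"] rlen[OF D(1)] by (meson List.finite_set le_trans)
      next
        case (Suc j)
        have "{u \<in> set (p' v). lay u = i} \<subseteq> {u \<in> set (q D v). \<mu> D u = j}"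
          using pv qD lD[OF D(1)] Suc rlen[OF D(1)] lT by auto
        then have "card {u \<in> set (p' v). lay u = i} \<le> card {u \<in> set (q D v). \<mu> D u = j}"
          by (intro card_mono) auto
        then show ?thesis using q(3)[OF D(1)] D(2) le_trans by blast
      qed
    qed
  qed
  then show ?thesis using lT by blast
qed

text \<open>With \<open>K - C\<close> as hub, the roots \<open>S\<close> are the vertices of
  \<open>C\<close> next to it. A partial forest with fewest vertices provides layer
  \<open>0\<close>; by minimality the complement of every remaining component is connected and is
  the hub of the recursion.\<close>

lemma layered_forest_hub:
  assumes "finite K" "conn K" "0 < k"
    and nofan: "\<And>R C. R \<subseteq> K \<Longrightarrow> C \<subseteq> K \<Longrightarrow> R \<inter> C = {} \<Longrightarrow> conn R \<Longrightarrow> conn C \<Longrightarrow>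
      \<not> rooted_path {c \<in> C. \<exists>w\<in>R. (c, w) \<in> E} k C"
    and "conn C" "C \<subseteq> K" "conn (K - C)"
  shows "\<exists>p lay. layered_forest C (k choose 2) p lay \<and> (\<forall>v\<in>C. (\<exists>w\<in>K - C. (v, w) \<in> E) \<longrightarrow> lay v = 0)"
  using assms(5-7)
proof (induction "card C" arbitrary: C rule: less_induct)
  case less
  define S where "S = {c \<in> C. \<exists>w\<in>K - C. (c, w) \<in> E}"
  have finC: "finite C" using less.prems(2) assms(1) finite_subset by blast
  have "\<not> rooted_path S k C"
    unfolding S_def by (rule nofan) (use less.prems in auto)
  then have "eliminable S (k choose 2) C" using eliminable_if_no_rooted_path[OF finC less.prems(1) assms(3)] by blast
  then have "\<exists>Tp. partial_forest S C (fst Tp) (snd Tp) (k choose 2)" using partial_forest_eliminable by fastforce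
  then obtain Tp where Tp: "partial_forest S C (fst Tp) (snd Tp) (k choose 2)"
    "\<And>Tp'. partial_forest S C (fst Tp') (snd Tp') (k choose 2) \<Longrightarrow> card (fst Tp) \<le> card (fst Tp')"
    using ex_has_least_nat[of "\<lambda>Tp. partial_forest S C (fst Tp) (snd Tp) (k choose 2)" _ "\<lambda>Tp. card (fst Tp)"]
    by blast
  define T p where "T = fst Tp" and "p = snd Tp"
  have pf: "partial_forest S C T p (k choose 2)" using Tp(1) unfolding T_def p_def .
  have mn: "card T \<le> card T'" if "partial_forest S C T' p' (k choose 2)" for T' p'
    using Tp(2)[of "(T', p')"] that unfolding T_def by simp
  have T: "T \<subseteq> C" "C \<inter> S \<subseteq> T" "tree_paths T p" "\<forall>v\<in>T. length (p v) \<le> k choose 2"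
      "\<forall>u\<in>T. \<forall>v\<in>T. (u, v) \<in> E \<or> (\<exists>D\<in>comps (C - T). touch {u} D \<and> touch {v} D) \<longrightarrow> comparable p u v"
    using pf by (simp_all add: partial_forest_def)
  have "touch C (K - C)"
    using assms(2) less.prems conn_nonempty[OF less.prems(1)] conn_nonempty[OF less.prems(3)]
    unfolding conn_def[of K] by blast
  then have Sne: "S \<noteq> {}" unfolding S_def touch_def by blast
  have SC: "S \<subseteq> T" using T(2) unfolding S_def by blast
  have "\<exists>p' lay. layered_forest C (k choose 2) p' lay \<and> (\<forall>v\<in>T. lay v = 0)"
  proof (rule layered_forest_glue[OF finC T(1,3)])
    show "length (p v) \<le> k choose 2" if "v \<in> T" for v using T(4) that by blast
    show "comparable p u v"
      if "u \<in> T" "v \<in> T" "(u, v) \<in> E \<or> (\<exists>D\<in>comps (C - T). touch {u} D \<and> touch {v} D)" for u v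
      using T(5) that by blast
    fix D assume D: "D \<in> comps (C - T)"
    have DC: "D \<subseteq> C - T" "conn D" using comps_subset[OF D] comps_conn[OF D] .
    have cKD: "conn (K - D)"
      by (rule minimal_partial_forest_conn[OF assms(2) less.prems(2,3) assms(1) S_def pf mn D])
    \<comment> \<open>The recursion terminates since \<open>T\<close> contains the non-empty set
      \<open>S\<close>.\<close>
    have "D \<subset> C" using DC Sne SC T(1) by blast
    then have "card D < card C" using psubset_card_mono[OF finC] by blast
    from less.hyps[OF this DC(2) _ cKD] obtain q \<mu> where "layered_forest D (k choose 2) q \<mu>"
      "\<forall>v\<in>D. (\<exists>w\<in>K - D. (v, w) \<in> E) \<longrightarrow> \<mu> v = 0" using DC(1) less.prems(2) by blast
    moreover have "T \<subseteq> K - D" using DC(1) T(1) less.prems(2) by blast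
    ultimately show "\<exists>q \<mu>. layered_forest D (k choose 2) q \<mu> \<and> (\<forall>v\<in>D. (\<exists>u\<in>T. (v, u) \<in> E) \<longrightarrow> \<mu> v = 0)" by blast
  qed
  then show ?case using SC unfolding S_def by blast
qed

text \<open>In each component \<open>K\<close> of the graph a single vertex \<open>r\<close> forms
  layer \<open>0\<close>. For a component \<open>D\<close> of \<open>K - {r}\<close>, the set
  \<open>K - D\<close> is connected, since all other components attach to \<open>r\<close>; it is
  the first hub.\<close>

theorem layered_forest_exists:
  assumes "finite V" "2 \<le> k"
    and nofan: "\<And>R C. R \<subseteq> V \<Longrightarrow> C \<subseteq> V \<Longrightarrow> R \<inter> C = {} \<Longrightarrow> conn R \<Longrightarrow> conn C \<Longrightarrow>
      \<not> rooted_path {c \<in> C. \<exists>w\<in>R. (c, w) \<in> E} k C"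
  shows "\<exists>p lay. layered_forest V (k choose 2) p lay"
proof -
  have k2: "1 \<le> k choose 2"
    using assms(2) by (simp add: Suc_leI zero_less_binomial)
  have conn_case: "\<exists>p lay. layered_forest K (k choose 2) p lay" if K: "conn K" "K \<subseteq> V" for K
  proof -
    have finK: "finite K" using K(2) assms(1) finite_subset by blast
    obtain r where r: "r \<in> K" using conn_nonempty[OF K(1)] by blast
    have "\<exists>p' lay. layered_forest K (k choose 2) p' lay \<and> (\<forall>v\<in>{r}. lay v = 0)"
    proof (rule layered_forest_glue[OF finK])
      show "{r} \<subseteq> K" using r by blast
      show "tree_paths {r} (\<lambda>v. [v])" unfolding tree_paths_def by simp
      show "length [v] \<le> k choose 2" for v :: 'a using k2 by simp
      show "comparable (\<lambda>v. [v]) u v" if "u \<in> {r}" "v \<in> {r}" for u v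
        using that unfolding comparable_def by simp
      fix D assume D: "D \<in> comps (K - {r})"
      have DK: "D \<subseteq> K - {r}" "conn D" using comps_subset[OF D] comps_conn[OF D] .
      have "conn ({r} \<union> \<Union>(comps (K - {r}) - {D}))"
      proof (rule conn_Un_star[OF conn_singleton])
        fix B assume "B \<in> comps (K - {r}) - {D}"
        then have B: "B \<in> comps (K - {r})" by blast
        have "neighbours K B \<noteq> {}"
          using neighbours_nonempty[OF K(1), of B] comps_subset[OF B] conn_nonempty[OF comps_conn[OF B]] r by blast
        then have "touch {r} B" using neighbours_comps[OF B] unfolding neighbours_def by blast
        then show "conn B \<and> ({r} \<inter> B \<noteq> {} \<or> touch {r} B)" using comps_conn[OF B] by blast
      qed
      moreover have "{r} \<union> \<Union>(comps (K - {r}) - {D}) = K - D"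
      proof
        show "{r} \<union> \<Union>(comps (K - {r}) - {D}) \<subseteq> K - D"
          using r DK(1) comps_subset comps_disjoint[OF D] by blast
        show "K - D \<subseteq> {r} \<union> \<Union>(comps (K - {r}) - {D})"
          using comps_cover[of _ "K - {r}"] by blast
      qed
      ultimately have cKD: "conn (K - D)" by simp
      have "D \<subseteq> K" using DK(1) by blast
      have "\<exists>p lay. layered_forest D (k choose 2) p lay \<and> (\<forall>v\<in>D. (\<exists>w\<in>K - D. (v, w) \<in> E) \<longrightarrow> lay v = 0)"
        by (rule layered_forest_hub[OF finK K(1) _ _ DK(2) \<open>D \<subseteq> K\<close> cKD])
          (use assms(2) K(2) nofan in auto)
      moreover have "r \<in> K - D" using r DK(1) by blast
      ultimately show "\<exists>q \<mu>. layered_forest D (k choose 2) q \<mu> \<and> (\<forall>v\<in>D. (\<exists>u\<in>{r}. (v, u) \<in> E) \<longrightarrow> \<mu> v = 0)"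
        by blast
    qed
    then show ?thesis by blast
  qed
  \<comment> \<open>Gluing with the empty set \<open>T\<close> takes the disjoint union over the
    components of \<open>V\<close>.\<close>
  have "\<exists>p' lay. layered_forest V (k choose 2) p' lay \<and> (\<forall>v\<in>{}. lay v = 0)"
  proof (rule layered_forest_glue[OF assms(1)])
    show "tree_paths {} (\<lambda>v. [v])" unfolding tree_paths_def by simp
    fix D assume "D \<in> comps (V - {})"
    then have "D \<subseteq> V" "conn D" using comps_subset comps_conn by auto
    then show "\<exists>q \<mu>. layered_forest D (k choose 2) q \<mu> \<and> (\<forall>v\<in>D. (\<exists>u\<in>{}. (v, u) \<in> E) \<longrightarrow> \<mu> v = 0)"
      using conn_case by blast
  qed auto
  then show ?thesis by blast
qed

subsection \<open>Fan minors and layered treedepth\<close>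

text \<open>Bridge from cuts to the reachability behind \<open>connected\<close>: no edge leaves the
  set of vertices reachable from \<open>x\<close>.\<close>

lemma connected_induce_subgraph:
  fixes G :: "'a pair_pre_digraph"
  assumes "conn A" "A \<subseteq> pverts G" and E: "parcs G = E"
  shows "connected (induce_subgraph G A)"
proof -
  let ?H = "with_proj (mk_symmetric (induce_subgraph (with_proj G) A))"
  have V: "verts ?H = A" by (simp add: mk_symmetric_def)
  have R: "(u, v) \<in> arcs_ends ?H" if "u \<in> A" "v \<in> A" "(u, v) \<in> E" for u v
    using that E by (force simp: mk_symmetric_def)
  have "x \<rightarrow>\<^sup>*\<^bsub>?H\<^esub> y" if x: "x \<in> A" and y: "y \<in> A" for x y
  proof -
    define U where "U = {z \<in> A. (x, z) \<in> rtrancl_on A (arcs_ends ?H)}"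
    have "x \<in> U" using x unfolding U_def by auto
    have "A \<subseteq> U"
    proof (rule ccontr)
      assume "\<not> A \<subseteq> U"
      then obtain u v where uv: "u \<in> U" "v \<in> A" "v \<notin> U" "(u, v) \<in> E"
        using connD[OF assms(1), of U] \<open>x \<in> U\<close> x unfolding touch_def by blast
      then have "(x, v) \<in> rtrancl_on A (arcs_ends ?H)"
        using R[of u v] unfolding U_def by (auto intro: rtrancl_on.rtrancl_on_into_rtrancl_on)
      then show False using uv unfolding U_def by blast
    qed
    then show ?thesis using y V unfolding reachable_def U_def by auto
  qed
  then show ?thesis
    using V conn_nonempty[OF assms(1)] unfolding connected_def strongly_connected_def by simp
qed

text \<open>\<open>R\<close> is the branch set of the hub. Every branch set of the rooted path
  contains a neighbour of \<open>R\<close>, so the hub touches all of them.\<close>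

lemma minor_model_fan:
  fixes G :: "'a pair_pre_digraph"
  assumes X: "fan X" "card (pverts X) = Suc k" and E: "parcs G = E"
    and R: "R \<subseteq> pverts G" "conn R" and C: "C \<subseteq> pverts G" "R \<inter> C = {}"
    and rp: "rooted_path {c \<in> C. \<exists>w\<in>R. (c, w) \<in> E} k C"
  shows "\<exists>B. minor_model B X G"
proof -
  obtain vs where vs: "distinct vs" "set vs = pverts X"
    "\<And>x y. (x, y) \<in> parcs X \<Longrightarrow> \<exists>i j. i < length vs \<and> j < length vs \<and> i \<noteq> j \<and> x = vs ! i \<and> y = vs ! j \<and>
       (i = 0 \<or> j = 0 \<or> i = Suc j \<or> j = Suc i)"
    using fan_enumeration[OF X(1)] by metis
  have len: "length vs = Suc k" using X(2) vs(1,2) distinct_card by metis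
  obtain Bs where Bs: "path_model Bs" "length Bs = k"
    "\<forall>B\<in>set Bs. B \<subseteq> C \<and> B \<inter> {c \<in> C. \<exists>w\<in>R. (c, w) \<in> E} \<noteq> {}"
    using rp unfolding rooted_path_def by blast
  define Ls where "Ls = R # Bs"
  have lenL: "length Ls = Suc k" unfolding Ls_def using Bs(2) by simp
  have L: "conn (Ls ! i)" "Ls ! i \<subseteq> pverts G" if i: "i < Suc k" for i
  proof -
    have "Ls ! i \<in> set Ls" using i lenL by simp
    then show "conn (Ls ! i)" "Ls ! i \<subseteq> pverts G"
      using R C(1) Bs(1,3) unfolding Ls_def path_model_def by auto
  qed
  have "sorted_wrt disjnt Ls"
  proof -
    have "disjnt R B" if "B \<in> set Bs" for B using that Bs(3) C(2) unfolding disjnt_def by blast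
    then show ?thesis using Bs(1) unfolding Ls_def path_model_def by simp
  qed
  then have dL: "Ls ! i \<inter> Ls ! j = {}" if "i < Suc k" "j < Suc k" "i \<noteq> j" for i j
    using that lenL unfolding sorted_wrt_iff_nth_less disjnt_def
    by (metis Int_commute linorder_neqE_nat)
  have hub: "touch (Ls ! 0) (Ls ! i)" if i: "0 < i" "i < Suc k" for i
  proof -
    have "Ls ! i \<in> set Bs" using i Bs(2) unfolding Ls_def by (cases i) auto
    then have "Ls ! i \<inter> {c \<in> C. \<exists>w\<in>R. (c, w) \<in> E} \<noteq> {}" using Bs(3) by blast
    then have "touch (Ls ! i) R" unfolding touch_def by blast
    then show ?thesis using touch_sym unfolding Ls_def by simp
  qed
  have nxt: "touch (Ls ! i) (Ls ! Suc i)" if i: "Suc i < Suc k" for i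
  proof (cases i)
    case 0
    then show ?thesis using hub i by simp
  next
    case (Suc j)
    then show ?thesis
      using successively_nth[of touch Bs j] i Bs(1,2) unfolding Ls_def path_model_def by simp
  qed
  have tch: "touch (Ls ! i) (Ls ! j)"
    if ij: "i < Suc k" "j < Suc k" "i \<noteq> j" "i = 0 \<or> j = 0 \<or> i = Suc j \<or> j = Suc i" for i j
  proof -
    consider "i = 0" "0 < j" | "j = 0" "0 < i" | "i = Suc j" | "j = Suc i" using ij by auto
    then show ?thesis by cases (use ij hub nxt touch_sym in auto)
  qed
  \<comment> \<open>The position of a vertex of \<open>X\<close> in the enumeration selects its
    branch set in \<open>Ls\<close>.\<close>
  define ix where "ix = inv_into {..<Suc k} ((!) vs)"
  have ix: "ix (vs ! i) = i" if "i < Suc k" for i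
    unfolding ix_def using inj_on_nth[OF vs(1)] len that by (intro inv_into_f_f) auto
  have pv: "\<exists>i<Suc k. x = vs ! i" if "x \<in> pverts X" for x
    using that vs(2) len by (metis in_set_conv_nth)
  have "minor_model (\<lambda>x. Ls ! ix x) X G"
    unfolding minor_model_def
  proof (intro conjI ballI impI)
    fix x assume "x \<in> pverts X"
    then obtain i where i: "i < Suc k" "x = vs ! i" using pv by blast
    then show "Ls ! ix x \<subseteq> pverts G" "connected (induce_subgraph G (Ls ! ix x))"
      using ix L connected_induce_subgraph[OF _ _ E] by simp_all
    fix y assume "y \<in> pverts X" "x \<noteq> y"
    moreover obtain j where j: "j < Suc k" "y = vs ! j" using pv calculation(1) by blast
    ultimately show "Ls ! ix x \<inter> Ls ! ix y = {}" using i ix dL[of i j] by auto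
  next
    fix e assume "e \<in> parcs X"
    moreover obtain x y where e: "e = (x, y)" by (cases e) auto
    ultimately obtain i j where ij: "i < length vs" "j < length vs" "i \<noteq> j" "x = vs ! i" "y = vs ! j"
       "i = 0 \<or> j = 0 \<or> i = Suc j \<or> j = Suc i" using vs(3)[of x y] by blast
    then have "touch (Ls ! ix x) (Ls ! ix y)" using tch[of i j] ix len by simp
    then show "case e of (x, y) \<Rightarrow> \<exists>u\<in>Ls ! ix x. \<exists>v\<in>Ls ! ix y. (u, v) \<in> parcs G"
      unfolding e touch_def E by simp
  qed
  then show ?thesis by blast
qed

section \<open>Rooted forests as digraphs, read off from root paths\<close>

definition forest_of :: "'a pair_pre_digraph \<Rightarrow> ('a \<Rightarrow> 'a list) \<Rightarrow> 'a pair_pre_digraph" where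
  "forest_of G p = \<lparr> pverts = pverts G, parcs = {(u, v). u \<in> pverts G \<and> v \<in> pverts G \<and> p v = p u @ [v]} \<rparr>"

definition tree_of :: "'a pair_pre_digraph \<Rightarrow> ('a \<Rightarrow> 'a list) \<Rightarrow> 'a \<Rightarrow> 'a pair_pre_digraph" where
  "tree_of G p r = \<lparr> pverts = {v \<in> pverts G. hd (p v) = r},
     parcs = {(u, v). u \<in> pverts G \<and> v \<in> pverts G \<and> p v = p u @ [v] \<and> hd (p v) = r} \<rparr>"

text \<open>The parent \<open>u\<close> is the entry before \<open>v\<close>: \<open>p u\<close> is
  a prefix of \<open>p v\<close> ending in \<open>u\<close>, and by distinctness it is everything
  before \<open>v\<close>.\<close>

lemma tree_paths_parent:
  assumes "tree_paths T p" "v \<in> T" "p v \<noteq> [v]"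
  shows "\<exists>u\<in>T. p v = p u @ [v]"
proof -
  note t = tree_pathsD[OF assms(1,2)]
  define b where "b = butlast (p v)"
  have pv: "p v = b @ [v]" using t(1,2) append_butlast_last_id[of "p v"] unfolding b_def by simp
  have bne: "b \<noteq> []" using pv assms(3) by auto
  define u where "u = last b"
  have ub: "u \<in> set b" using bne unfolding u_def by simp
  then have uV: "u \<in> T" using pv t(4) by auto
  obtain s where s: "p v = p u @ s" using t(6)[of u] ub pv by auto
  note tu = tree_pathsD[OF assms(1) uV]
  have "s \<noteq> []"
  proof
    assume "s = []"
    then have "last (p v) = last (p u)" using s by simp
    then have "u = v" using t(2) tu(2) by simp
    then show False using ub pv t(3) by simp
  qed
  then obtain s' where s': "s = s' @ [v]" using s pv by (cases s rule: rev_cases) auto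
  then have b: "b = p u @ s'" using s pv by simp
  have "s' = []"
  proof (rule ccontr)
    assume "s' \<noteq> []"
    then have "u \<in> set s'" using b last_appendR[of s' "p u"] last_in_set[of s'] unfolding u_def[symmetric]
      by (metis u_def)
    then show False using b tu(5) pv t(3) by auto
  qed
  then show ?thesis using b pv uV by auto
qed

text \<open>The list of the first entry is a prefix of \<open>p v\<close>, so it begins and ends
  with that entry; being distinct, it has length one.\<close>

lemma tree_paths_root:
  assumes "tree_paths T p" "v \<in> T"
  shows "hd (p v) \<in> T \<and> p (hd (p v)) = [hd (p v)]"
proof -
  note t = tree_pathsD[OF assms]
  let ?r = "hd (p v)"
  have r: "?r \<in> set (p v)" using t(1) by simp
  then have rV: "?r \<in> T" using t(4) by blast
  obtain s where s: "p v = p ?r @ s" using t(6)[OF r] by blast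
  note tr = tree_pathsD[OF assms(1) rV]
  have "hd (p ?r) = ?r" using s tr(1) by (metis hd_append2)
  moreover have "last (p ?r) = ?r" using tr(2) .
  ultimately have "p ?r = [?r]" using tr(1,3) by (cases "p ?r") (auto split: if_splits dest: last_in_set)
  then show ?thesis using rV by blast
qed

text \<open>An arc into \<open>v\<close> can only come from the vertex whose list is
  \<open>p v\<close> without \<open>v\<close>; read backwards, a walk from \<open>r\<close> must
  follow \<open>p v\<close>.\<close>

lemma rooted_tree_tree_of:
  fixes G :: "'a pair_pre_digraph"
  assumes G: "pair_graph G" and tp: "tree_paths (pverts G) p" and r: "r \<in> pverts G" "p r = [r]"
  shows "rooted_tree (tree_of G p r) r"
proof -
  let ?T = "tree_of G p r"
  have fin: "finite (pverts G)" by (rule pair_graph_finite[OF G])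
  have ne: "p u \<noteq> []" if "u \<in> pverts G" for u using tree_pathsD(1)[OF tp that] .
  have wf: "pair_wf_digraph ?T"
    by unfold_locales (use ne in \<open>auto simp: tree_of_def\<close>)
  have "parcs ?T \<subseteq> pverts G \<times> pverts G" unfolding tree_of_def by auto
  then have "finite (parcs ?T)" using fin finite_subset by blast
  then have "pair_fin_digraph ?T"
    using wf fin unfolding pair_fin_digraph_def pair_fin_digraph_axioms_def by (simp add: tree_of_def)
  moreover have rT: "r \<in> pverts ?T" using r by (simp add: tree_of_def)
  moreover have aw: "pre_digraph.awalk ?T r q v \<longleftrightarrow> set q \<subseteq> parcs ?T \<and> pcas r q v" for q v
    using rT unfolding pre_digraph.awalk_def by (simp add: cas_with_proj_eq)
  have "\<exists>!q. pre_digraph.awalk ?T r q v" if v: "v \<in> pverts ?T" for v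
  proof (rule ex1I)
    show "pre_digraph.awalk ?T r (vwalk_arcs (p v)) v"
      using v
    proof (induction "length (p v)" arbitrary: v rule: less_induct)
      case less
      have vV: "v \<in> pverts G" "hd (p v) = r" using less.prems by (auto simp: tree_of_def)
      show ?case
      proof (cases "p v = [v]")
        case True
        then show ?thesis using vV aw by simp
      next
        case False
        then obtain u where u: "u \<in> pverts G" "p v = p u @ [v]" using tree_paths_parent[OF tp vV(1)] by blast
        have hdu: "hd (p u) = r" using u vV ne[OF u(1)] by simp
        then have "pre_digraph.awalk ?T r (vwalk_arcs (p u)) u" using less.hyps[of u] u by (simp add: tree_of_def)
        then have c: "set (vwalk_arcs (p u)) \<subseteq> parcs ?T" "pcas r (vwalk_arcs (p u)) u" using aw by blast+
        have e: "(u, v) \<in> parcs ?T" using u vV by (simp add: tree_of_def)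
        have eq: "vwalk_arcs (p v) = vwalk_arcs (p u) @ [(u, v)]"
          using u(2) vwalk_arcs_snoc[OF ne[OF u(1)]] tree_pathsD(2)[OF tp u(1)] by simp
        have "pcas r (vwalk_arcs (p v)) v" unfolding eq pcas_snoc fst_conv snd_conv using c(2) by blast
        moreover have "set (vwalk_arcs (p v)) \<subseteq> parcs ?T" unfolding eq using c(1) e by simp
        ultimately show ?thesis using aw by blast
      qed
    qed
    show "q = vwalk_arcs (p v)" if "pre_digraph.awalk ?T r q v" for q
      using that
    proof (induction q arbitrary: v rule: rev_induct)
      case Nil
      then show ?case using aw r(2) by simp
    next
      case (snoc a q)
      then have q: "set q \<subseteq> parcs ?T" "pcas r q (fst a)" "snd a = v" "a \<in> parcs ?T" using aw by (auto simp: pcas_snoc)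
      then have "q = vwalk_arcs (p (fst a))" using snoc.IH aw by blast
      moreover have u: "fst a \<in> pverts G" "p v = p (fst a) @ [v]" using q(3,4) by (auto simp: tree_of_def)
      moreover have "vwalk_arcs (p v) = vwalk_arcs (p (fst a)) @ [(fst a, v)]"
        using u(2) vwalk_arcs_snoc[OF ne[OF u(1)]] tree_pathsD(2)[OF tp u(1)] by simp
      ultimately show ?case using q(3) by (cases a) simp
    qed
  qed
  ultimately show ?thesis unfolding rooted_tree_def by blast
qed

lemma rooted_forest_forest_of:
  fixes G :: "'a pair_pre_digraph"
  assumes G: "pair_graph G" and tp: "tree_paths (pverts G) p"
  shows "rooted_forest (forest_of G p)"
proof -
  let ?F = "forest_of G p"
  define Rs where "Rs = {r \<in> pverts G. p r = [r]}"
  have fin: "finite (pverts G)" by (rule pair_graph_finite[OF G])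
  have wf: "pair_wf_digraph ?F"
    by unfold_locales (auto simp: forest_of_def)
  have "parcs ?F \<subseteq> pverts G \<times> pverts G" unfolding forest_of_def by auto
  then have "finite (parcs ?F)" using fin finite_subset by blast
  then have "pair_fin_digraph ?F"
    using wf fin unfolding pair_fin_digraph_def pair_fin_digraph_axioms_def by (simp add: forest_of_def)
  moreover have "\<forall>T\<in>tree_of G p ` Rs. \<exists>r. rooted_tree T r"
    using rooted_tree_tree_of[OF G tp] unfolding Rs_def by blast
  moreover have "pairwise (\<lambda>S T. disjnt (pverts S) (pverts T)) (tree_of G p ` Rs)"
    unfolding pairwise_def disjnt_def by (auto simp: tree_of_def)
  moreover have "pverts ?F = (\<Union>T\<in>tree_of G p ` Rs. pverts T)"
    using tree_paths_root[OF tp] unfolding Rs_def by (auto simp: tree_of_def forest_of_def)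
  moreover have "parcs ?F = (\<Union>T\<in>tree_of G p ` Rs. parcs T)"
    using tree_paths_root[OF tp] unfolding Rs_def by (auto simp: tree_of_def forest_of_def)
  ultimately show ?thesis unfolding rooted_forest_def by blast
qed

lemma forest_of_reachable:
  fixes G :: "'a pair_pre_digraph"
  assumes tp: "tree_paths (pverts G) p"
  shows "v \<in> pverts G \<Longrightarrow> u \<in> set (p v) \<Longrightarrow> u \<rightarrow>\<^sup>*\<^bsub>forest_of G p\<^esub> v"
proof (induction "length (p v)" arbitrary: v rule: less_induct)
  case less
  show ?case
  proof (cases "u = v")
    case True
    then show ?thesis using less.prems unfolding reachable_def by (simp add: forest_of_def)
  next
    case False
    then have "p v \<noteq> [v]" using less.prems(2) by auto
    then obtain w where w: "w \<in> pverts G" "p v = p w @ [v]" using tree_paths_parent[OF tp less.prems(1)] by blast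
    then have "u \<rightarrow>\<^sup>*\<^bsub>forest_of G p\<^esub> w" using less False by simp
    moreover have "(w, v) \<in> parcs (forest_of G p)" using w less.prems(1) by (simp add: forest_of_def)
    ultimately show ?thesis
      using less.prems(1) unfolding reachable_def
      by (auto intro: rtrancl_on.rtrancl_on_into_rtrancl_on simp: forest_of_def)
  qed
qed

lemma elimination_forest_forest_of:
  fixes G :: "'a pair_pre_digraph"
  assumes G: "pair_graph G" and tp: "tree_paths (pverts G) p" and cmp: "\<And>u v. (u, v) \<in> parcs G \<Longrightarrow> comparable p u v"
  shows "elimination_forest (forest_of G p) G"
proof -
  let ?C = "forest_closure (forest_of G p)"
  have V: "pverts (forest_of G p) = pverts G" by (simp add: forest_of_def)
  have "parcs G \<subseteq> parcs ?C"
  proof (rule subrelI)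
    fix u v assume uv: "(u, v) \<in> parcs G"
    have "u \<in> pverts G" "v \<in> pverts G" "u \<noteq> v" using pair_graph_arcD[OF G uv] .
    then show "(u, v) \<in> parcs ?C"
      using cmp[OF uv] forest_of_reachable[OF tp] V unfolding comparable_def forest_closure_def by auto
  qed
  moreover have "wf_digraph (with_proj ?C)"
    unfolding wf_digraph_wp_iff by unfold_locales (auto simp: forest_closure_def)
  moreover have "wf_digraph (with_proj G)"
    using G unfolding wf_digraph_wp_iff by (simp add: pair_graph_def pair_digraph_def pair_fin_digraph_def)
  moreover have "pverts ?C = pverts G" using V by (simp add: forest_closure_def)
  ultimately have "subgraph (with_proj G) (with_proj ?C)"
    unfolding subgraph_def compatible_def by simp
  then show ?thesis unfolding elimination_forest_def using rooted_forest_forest_of[OF G tp] V by blast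
qed

text \<open>Each arc appends its head to the list of its tail, so the list of the last vertex
  collects the whole path.\<close>

lemma root_leaf_path_subset:
  fixes G :: "'a pair_pre_digraph"
  assumes "tree_paths (pverts G) p" "root_leaf_path (forest_of G p) Q"
  shows "last Q \<in> pverts G \<and> set Q \<subseteq> set (p (last Q))"
proof -
  have Q: "Q \<noteq> []" "set Q \<subseteq> pverts G" "set (vwalk_arcs Q) \<subseteq> parcs (forest_of G p)"
    using assms(2) unfolding root_leaf_path_def vpath_def vwalk_def by (simp_all add: forest_of_def)
  from Q have "set Q \<subseteq> set (p (last Q))"
  proof (induction Q rule: rev_induct)
    case (snoc v xs)
    have vV: "v \<in> pverts G" using snoc.prems by simp
    show ?case
    proof (cases "xs = []")
      case True
      then show ?thesis using tree_pathsD(5)[OF assms(1) vV] by simp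
    next
      case False
      then have "vwalk_arcs (xs @ [v]) = vwalk_arcs xs @ [(last xs, v)]" by (rule vwalk_arcs_snoc)
      then have "set xs \<subseteq> set (p (last xs))" "p v = p (last xs) @ [v]"
        using snoc False by (auto simp: forest_of_def)
      then show ?thesis by auto
    qed
  qed simp
  then show ?thesis using Q by auto
qed

lemma layered_treedepth_le:
  fixes G :: "'a pair_pre_digraph"
  assumes G: "pair_graph G" and E: "parcs G = E" and "layered_forest (pverts G) b p lay"
  shows "layered_treedepth G \<le> b"
proof -
  have tp: "tree_paths (pverts G) p"
    and edge: "\<forall>u\<in>pverts G. \<forall>v\<in>pverts G. (u, v) \<in> parcs G \<longrightarrow> comparable p u v \<and> lay u \<le> Suc (lay v)"
    and width: "\<forall>v\<in>pverts G. \<forall>i. card {u \<in> set (p v). lay u = i} \<le> b"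
    using assms(3) E by (simp_all add: layered_forest_def)
  define L where "L i = {v \<in> pverts G. lay v = i}" for i
  have edge': "comparable p u v \<and> lay u \<le> Suc (lay v) \<and> lay v \<le> Suc (lay u) \<and> u \<in> pverts G \<and> v \<in> pverts G"
    if "(u, v) \<in> parcs G" for u v
    using edge pair_graph_arcD[OF G that] that E_sym[of u v] E by blast
  have ef: "elimination_forest (forest_of G p) G"
    using elimination_forest_forest_of[OF G tp] edge' by blast
  have ly: "layering L G"
    unfolding layering_def
  proof (intro conjI ballI)
    show "\<forall>i j. i \<noteq> j \<longrightarrow> L i \<inter> L j = {}" "(\<Union>i. L i) = pverts G" unfolding L_def by auto
    fix e assume "e \<in> parcs G"
    moreover obtain u v where e: "e = (u, v)" by (cases e) auto
    ultimately have uv: "lay u \<le> Suc (lay v)" "lay v \<le> Suc (lay u)" "u \<in> pverts G" "v \<in> pverts G" using edge' by blast+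
    \<comment> \<open>The lower of the two layers is the witness.\<close>
    have "\<exists>i. u \<in> L i \<union> L (Suc i) \<and> v \<in> L i \<union> L (Suc i)"
      by (rule exI[of _ "min (lay u) (lay v)"]) (use uv in \<open>auto simp: L_def min_def\<close>)
    then show "case e of (u, v) \<Rightarrow> \<exists>i. u \<in> L i \<union> L (Suc i) \<and> v \<in> L i \<union> L (Suc i)" unfolding e by simp
  qed
  have le: "card (set Q \<inter> L i) \<le> b" if "root_leaf_path (forest_of G p) Q" for Q i
  proof -
    have Q: "last Q \<in> pverts G" "set Q \<subseteq> set (p (last Q))" using root_leaf_path_subset[OF tp that] by blast+
    have "card (set Q \<inter> L i) \<le> card {u \<in> set (p (last Q)). lay u = i}"
      by (rule card_mono) (use Q in \<open>auto simp: L_def\<close>)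
    then show ?thesis using width Q(1) le_trans by blast
  qed
  let ?W = "insert 0 {card (set Q \<inter> L i) | Q i. root_leaf_path (forest_of G p) Q}"
  have "?W \<subseteq> {..b}" using le by auto
  then have "Max ?W \<le> b" using finite_subset[of ?W "{..b}"] by (intro Max.boundedI) auto
  then have "layered_width (forest_of G p) L \<le> b" unfolding layered_width_def .
  moreover have "layered_treedepth G \<le> layered_width (forest_of G p) L"
    unfolding layered_treedepth_def by (rule Least_le) (use ef ly in blast)
  ultimately show ?thesis by simp
qed

end

lemma sym_relation_pair_graph: "pair_graph G \<Longrightarrow> sym_relation (parcs G)"
proof
  fix x y assume "pair_graph G" "(x, y) \<in> parcs G"
  then show "(y, x) \<in> parcs G"
    using arcs_ends_symmetric[of "with_proj G" x y] pair_sym_digraph.pair_sym_arcs[of G]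
    by (simp add: pair_graph_def pair_pseudo_graph_def)
qed

theorem theorem1p2:
  fixes X :: "'x pair_pre_digraph" and G :: "'a pair_pre_digraph"
  assumes "fan X" and "card (pverts X) \<ge> 3"
    and "pair_graph G"
    and "minor_free X G"
  shows "layered_treedepth G \<le> (card (pverts X) - 1) choose 2"
proof -
  \<comment> \<open>The number of vertices of the fan apart from the hub.\<close>
  define k where "k = card (pverts X) - 1"
  have k: "2 \<le> k" "card (pverts X) = Suc k" using assms(2) unfolding k_def by auto
  note sr = sym_relation_pair_graph[OF assms(3)]
  have "\<exists>p lay. sym_relation.layered_forest (parcs G) (pverts G) (k choose 2) p lay"
  proof (rule sym_relation.layered_forest_exists[OF sr pair_graph_finite[OF assms(3)] k(1)])
    fix R C
    assume "R \<subseteq> pverts G" "C \<subseteq> pverts G" "R \<inter> C = {}" "sym_relation.conn (parcs G) R"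
    then show "\<not> sym_relation.rooted_path (parcs G) {c \<in> C. \<exists>w\<in>R. (c, w) \<in> parcs G} k C"
      using sym_relation.minor_model_fan[OF sr assms(1) k(2) refl, of R C] assms(4)
      unfolding minor_free_def by blast
  qed
  then show ?thesis
    using sym_relation.layered_treedepth_le[OF sr assms(3) refl] unfolding k_def by blast
qed

end
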